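(* Let $f$ be smooth in the sense that $f\in\Sigma^s(\mathbb{R})$ for all $s\ge0$, and let $\delta>0$. There exists $C$ such that for all $s$ there exist $C_s$ and $h_0>0$ such that for all $h=\sqrt2\,N^{-1/2}\le h_0$ ($N$ an even positive integer), all integers $n_{\max}$ with $$\tfrac14\delta|\log h|\le n_{\max}\le\tfrac13\delta|\log h|,$$ and all $t\ge0$, $$\|\pi_h\psi(t,\cdot)-\psi_h(t,\cdot)\|_{\ell^2(h\mathbb{Z})}\le C h^{2-\delta}+\frac{C_s}{|\log h|^s},$$ where $\psi(t,\cdot)=e^{-itH}f$ and $\psi_h(t,\cdot)=\sum_{n=0}^{n_{\max}}c_{n,h}\,e^{-i(2n+1)t}\varphi_{n,h}$ with $c_{n,h}=h\sum_{a\in A_h}f(a)\varphi_{n,h}(a)$.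
   Context: $H=-\partial_x^2+x^2$ on $L^2(\mathbb{R})$; with the Hermite functions $\psi_n$ ($H\psi_n=(2n+1)\psi_n$, orthonormal basis of $L^2(\mathbb{R})$), $e^{-itH}f=\sum_{n\ge0}\left(\int_{\mathbb{R}}f\psi_n\,dx\right)e^{-i(2n+1)t}\psi_n$. $\Sigma^n(\mathbb{R})=\{\psi\in L^2(\mathbb{R}):\|\psi\|_{H^n(\mathbb{R})}+\|\langle x\rangle^n\psi\|_{L^2(\mathbb{R})}<\infty\}$ with $\langle x\rangle=(1+x^2)^{1/2}$. $(\pi_hg)(a)=g(a)$ for $a\in h\mathbb{Z}$ (continuous representative), and $\|u\|^2_{\ell^2(h\mathbb{Z})}=h\sum_{a\in h\mathbb{Z}}|u(a)|^2$. Set $A_h=h\mathbb{Z}\cap[-1/h,1/h]$. Scaled Kravchuk polynomials: $k_{0,h}=1$, $k_{n,h}=0$ for $n<0$, $k_{n+1,h}(x)=2x\,k_{n,h}(x)-2n\left(1-h^2\frac{n-1}{2}\right)k_{n-1,h}(x)$. Kravchuk functions: for $0\le n\le N$, $a\in h\mathbb{Z}$, $\varphi_{n,h}(a)=\alpha_{n,h}k_{n,h}(a)\sqrt{\rho_h(a)}$, where $\alpha_{n,h}=\frac1{h^n}\sqrt{\frac{(N-n)!}{N!\,n!}}$, $\rho_h(a)=\frac1{h2^N}\binom Nk$ with $k=\frac1{h^2}+\frac ah$ for $a\in A_h$, and $\rho_h(a)=0$ for $a\notin A_h$. (The function $\psi_h$ solves $i\partial_t\psi_h=H_h\psi_h$,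 where $H_h$ is the discrete operator satisfying $H_h\varphi_{n,h}=(2n+1)\varphi_{n,h}$.) *)

theory Defs
  imports "HOL-Analysis.Analysis"
begin

section \<open>The spaces \<open>L\<^sup>2(\<real>)\<close> and \<open>\<Sigma>\<^sup>n(\<real>)\<close>\<close>

text \<open>
  Elements of \<open>L\<^sup>2(\<real>)\<close> are represented by Borel measurable functions.  Nothing below depends
  on the representative: point values are only taken through \<open>cont_rep\<close>.
\<close>

definition L2_space :: "(real \<Rightarrow> complex) set" where
  "L2_space = {f. f \<in> borel_measurable lborel \<and> integrable lborel (\<lambda>x. (norm (f x))\<^sup>2)}"

definition L2_norm :: "(real \<Rightarrow> complex) \<Rightarrow> real" where
  "L2_norm f = sqrt (\<integral>x. (norm (f x))\<^sup>2 \<partial>lborel)"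

definition test_functions :: "(real \<Rightarrow> real) set" where
  "test_functions =
     {\<phi>. (\<forall>k x. (deriv ^^ k) \<phi> field_differentiable at x) \<and>
         (\<exists>R. \<forall>x. \<bar>x\<bar> > R \<longrightarrow> \<phi> x = 0)}"

definition weak_deriv :: "nat \<Rightarrow> (real \<Rightarrow> complex) \<Rightarrow> (real \<Rightarrow> complex) \<Rightarrow> bool" where
  "weak_deriv k f g \<longleftrightarrow>
     (\<forall>\<phi>\<in>test_functions.
        (\<integral>x. f x * complex_of_real ((deriv ^^ k) \<phi> x) \<partial>lborel) =
        (- 1) ^ k * (\<integral>x. g x * complex_of_real (\<phi> x) \<partial>lborel))"

definition Sobolev_space :: "nat \<Rightarrow> (real \<Rightarrow> complex) set" where
  "Sobolev_space n = {f \<in> L2_space. \<forall>k\<le>n. \<exists>g\<in>L2_space. weak_deriv k f g}"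

definition jbracket :: "real \<Rightarrow> real" where
  "jbracket x = sqrt (1 + x\<^sup>2)"

definition Sigma_space :: "nat \<Rightarrow> (real \<Rightarrow> complex) set" where
  "Sigma_space n =
     {f \<in> Sobolev_space n. (\<lambda>x. complex_of_real (jbracket x ^ n) * f x) \<in> L2_space}"

definition cont_rep :: "(real \<Rightarrow> complex) \<Rightarrow> real \<Rightarrow> complex" where
  "cont_rep g = (THE g'. continuous_on UNIV g' \<and> (AE x in lborel. g x = g' x))"


section \<open>Hermite functions and the propagator of the harmonic oscillator\<close>

text \<open>Physicists' Hermite polynomials, i.e. with leading coefficient \<open>2 ^ n\<close>.\<close>

fun hermite_poly :: "nat \<Rightarrow> real \<Rightarrow> real" where
  "hermite_poly 0 x = 1"
| "hermite_poly (Suc 0) x = 2 * x"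
| "hermite_poly (Suc (Suc n)) x =
     2 * x * hermite_poly (Suc n) x - 2 * real (Suc n) * hermite_poly n x"

definition hermite_fun :: "nat \<Rightarrow> real \<Rightarrow> real" where
  "hermite_fun n x = hermite_poly n x * exp (- x\<^sup>2 / 2) / sqrt (2 ^ n * fact n * sqrt pi)"

definition hermite_coeff :: "(real \<Rightarrow> complex) \<Rightarrow> nat \<Rightarrow> complex" where
  "hermite_coeff f n = (\<integral>x. f x * complex_of_real (hermite_fun n x) \<partial>lborel)"

text \<open>
  \<open>propagator t f\<close> is (a representative of) \<open>e\<^bsup>-itH\<^esup> f\<close>, the sum of the Hermite series
  in the sense of convergence in \<open>L\<^sup>2(\<real>)\<close>.
\<close>

definition propagator :: "real \<Rightarrow> (real \<Rightarrow> complex) \<Rightarrow> real \<Rightarrow> complex" where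
  "propagator t f =
     (SOME u. u \<in> L2_space \<and>
        (\<lambda>K. L2_norm (\<lambda>x. u x -
           (\<Sum>n<K. hermite_coeff f n * exp (- \<i> * complex_of_real (real (2 * n + 1) * t)) *
                    complex_of_real (hermite_fun n x)))) \<longlonglongrightarrow> 0)"


section \<open>The lattice \<open>h\<int>\<close> and Kravchuk functions\<close>

definition mesh :: "nat \<Rightarrow> real" where
  "mesh N = sqrt 2 * real N powr (- 1 / 2)"

definition lattice :: "real \<Rightarrow> real set" where
  "lattice h = range (\<lambda>k::int. h * real_of_int k)"

text \<open>\<open>u\<close> is only evaluated on \<open>h\<int>\<close>; \<open>l2_lattice_norm\<close> is meaningful only for \<open>u\<close> in
  \<open>l2_lattice\<close>, since \<open>infsum\<close> is \<open>0\<close> on non-summable families.\<close>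

definition l2_lattice :: "real \<Rightarrow> (real \<Rightarrow> complex) set" where
  "l2_lattice h = {u. (\<lambda>a. (norm (u a))\<^sup>2) summable_on lattice h}"

definition l2_lattice_norm :: "real \<Rightarrow> (real \<Rightarrow> complex) \<Rightarrow> real" where
  "l2_lattice_norm h u = sqrt (h * (\<Sum>\<^sub>\<infinity>a\<in>lattice h. (norm (u a))\<^sup>2))"

definition lattice_restr :: "real \<Rightarrow> (real \<Rightarrow> complex) \<Rightarrow> real \<Rightarrow> complex" where
  "lattice_restr h g a = (if a \<in> lattice h then cont_rep g a else 0)"

definition lattice_window :: "real \<Rightarrow> real set" where
  "lattice_window h = lattice h \<inter> {- 1 / h .. 1 / h}"

text \<open>The second equation is the recursion at \<open>n = 0\<close>, where the coefficient of the
  polynomial of index \<open>-1\<close> vanishes; the third is the recursion at index \<open>n + 1\<close>.\<close>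

fun kravchuk_poly :: "real \<Rightarrow> nat \<Rightarrow> real \<Rightarrow> real" where
  "kravchuk_poly h 0 x = 1"
| "kravchuk_poly h (Suc 0) x = 2 * x"
| "kravchuk_poly h (Suc (Suc n)) x =
     2 * x * kravchuk_poly h (Suc n) x -
     2 * real (Suc n) * (1 - h\<^sup>2 * real n / 2) * kravchuk_poly h n x"

text \<open>For \<open>h = mesh N\<close> with \<open>N\<close> even and \<open>a \<in> lattice_window h\<close>, the number
  \<open>1 / h\<^sup>2 + a / h\<close> is an integer between \<open>0\<close> and \<open>N\<close>, so the rounding below is exact.\<close>

definition kravchuk_weight :: "nat \<Rightarrow> real \<Rightarrow> real" where
  "kravchuk_weight N a =
     (let h = mesh N in
      if a \<in> lattice_window h
      then 1 / (h * 2 ^ N) * real (N choose nat \<lfloor>1 / h\<^sup>2 + a / h\<rfloor>)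
      else 0)"

text \<open>Only meant for \<open>n \<le> N\<close>.\<close>

definition kravchuk_normalization :: "nat \<Rightarrow> nat \<Rightarrow> real" where
  "kravchuk_normalization N n = 1 / mesh N ^ n * sqrt (fact (N - n) / (fact N * fact n))"

definition kravchuk_fun :: "nat \<Rightarrow> nat \<Rightarrow> real \<Rightarrow> real" where
  "kravchuk_fun N n a =
     kravchuk_normalization N n * kravchuk_poly (mesh N) n a * sqrt (kravchuk_weight N a)"

definition kravchuk_coeff :: "(real \<Rightarrow> complex) \<Rightarrow> nat \<Rightarrow> nat \<Rightarrow> complex" where
  "kravchuk_coeff f N n =
     complex_of_real (mesh N) *
     (\<Sum>a\<in>lattice_window (mesh N).
        lattice_restr (mesh N) f a * complex_of_real (kravchuk_fun N n a))"

definition discrete_solution ::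
    "(real \<Rightarrow> complex) \<Rightarrow> nat \<Rightarrow> nat \<Rightarrow> real \<Rightarrow> real \<Rightarrow> complex" where
  "discrete_solution f N n_max t a =
     (\<Sum>n\<le>n_max. kravchuk_coeff f N n * exp (- \<i> * complex_of_real (real (2 * n + 1) * t)) *
        complex_of_real (kravchuk_fun N n a))"

end

theory Submission
  imports Defs "HOL-Probability.Probability" "HOL-Real_Asymp.Real_Asymp"
begin

text \<open>
  Write \<open>L = \<bar>log h\<bar>\<close>, \<open>\<psi>\<^sub>n\<close> for the Hermite and \<open>\<phi>\<^sub>n\<close> for the Kravchuk functions.  Any bound by a
  positive power of \<open>h\<close> is better than \<open>L\<^sup>-\<^sup>s\<close> for every \<open>s\<close>, so it suffices to follow a slowly
  growing number \<open>M \<approx> L\<^bsup>1/4\<^esup>\<close> of modes, and constants of size \<open>exp (O(M\<^sup>2))\<close> are harmless.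

  The coefficients \<open>\<integral> f \<psi>\<^sub>m\<close> decay faster than any power of \<open>m\<close> (\<open>hermite_coeff_decay\<close>):
  writing \<open>\<psi>\<^sub>m\<close> as a multiple of \<open>(x - D)\<^sup>k \<psi>\<^sub>m\<^sub>-\<^sub>k\<close>, one moves either the powers of \<open>x\<close> or the
  derivatives to \<open>f\<close>.  As \<open>(1 + x\<^sup>2) \<bar>\<psi>\<^sub>m(x)\<bar>\<close> is bounded by a polynomial in \<open>m\<close>, the Hermite
  series of \<open>e\<^bsup>-itH\<^esup> f\<close> converges absolutely in a weighted supremum norm that controls the lattice
  norm uniformly in \<open>h\<close>, and the modes beyond \<open>M\<close> contribute \<open>O(M\<^sup>-\<^sup>k)\<close> for every \<open>k\<close>
  (\<open>evol_tail\<close>).  The sum of the series is the continuous representative of \<open>e\<^bsup>-itH\<^esup> f\<close>; at time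
  zero this uses the completeness of the Hermite functions (\<open>hermite_complete\<close>), which follows from
  the uniqueness of characteristic functions.

  For the first modes, \<open>\<phi>\<^sub>n\<close> and \<open>\<psi>\<^sub>n\<close> satisfy three-term recursions whose coefficients differ
  by \<open>O(h\<^sup>2 n\<^sup>2)\<close>.  For \<open>n = 0\<close> both are almost normalised, and a one-sided local limit theorem for
  binomial coefficients bounds their inner product from below, so that the lattice norm of
  \<open>\<psi>\<^sub>0 - \<phi>\<^sub>0\<close> is \<open>O(h\<^bsup>1/2\<^esup>)\<close> (\<open>ground_state_error\<close>).  The recursion carries this to all
  \<open>n < M\<close> with a loss that is a function of \<open>M\<close> only (\<open>kravchuk_hermite_error\<close>).

  Finally, the Kravchuk functions are orthonormal (\<open>kravchuk_gram\<close>), so the discrete evolution is a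
  contraction after projection, and the error of the discrete solution is bounded by the errors at
  time \<open>t\<close> and at time \<open>0\<close> of replacing \<open>e\<^bsup>-itH\<^esup> f\<close> by \<open>M\<close> Kravchuk modes (\<open>discretization_error\<close>).
\<close>

section \<open>Rapidly decaying functions\<close>

text \<open>
  Continuous functions decaying faster than every power of \<open>x\<close>.  No condition is put on
  derivatives; smoothness is handled separately where it is needed.
\<close>

definition rapid :: "(real \<Rightarrow> real) \<Rightarrow> bool" where
  "rapid g \<longleftrightarrow> continuous_on UNIV g \<and> (\<forall>k. \<exists>C. \<forall>x. \<bar>x\<bar> ^ k * \<bar>g x\<bar> \<le> C)"

lemma rapidD: "rapid g \<Longrightarrow> \<exists>C\<ge>0. \<forall>x. \<bar>x\<bar> ^ k * \<bar>g x\<bar> \<le> C"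
proof -
  assume "rapid g"
  then obtain C where C: "\<forall>x. \<bar>x\<bar> ^ k * \<bar>g x\<bar> \<le> C" unfolding rapid_def by blast
  then have "0 \<le> C" using order_trans[OF _ C[rule_format, of 0]] by simp
  with C show ?thesis by blast
qed

lemma rapid_continuous: "rapid g \<Longrightarrow> continuous_on UNIV g"
  by (simp add: rapid_def)

lemma rapid_measurable [measurable_dest]: "rapid g \<Longrightarrow> g \<in> borel_measurable borel"
  by (simp add: rapid_def borel_measurable_continuous_onI)

lemma rapid_bounded: "rapid g \<Longrightarrow> \<exists>C\<ge>0. \<forall>x. \<bar>g x\<bar> \<le> C"
  using rapidD[of g 0] by simp

lemma rapid_add: assumes "rapid f" "rapid g" shows "rapid (\<lambda>x. f x + g x)"
  unfolding rapid_def
proof (intro conjI allI)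
  show "continuous_on UNIV (\<lambda>x. f x + g x)"
    using assms by (auto intro!: continuous_intros simp: rapid_def)
  fix k
  obtain C D where "\<forall>x. \<bar>x\<bar> ^ k * \<bar>f x\<bar> \<le> C" "\<forall>x. \<bar>x\<bar> ^ k * \<bar>g x\<bar> \<le> D"
    using rapidD assms by meson
  then have "\<bar>x\<bar> ^ k * \<bar>f x + g x\<bar> \<le> C + D" for x
    using mult_left_mono[OF abs_triangle_ineq[of "f x" "g x"], of "\<bar>x\<bar> ^ k"]
    by (simp add: distrib_left) (smt (verit))
  then show "\<exists>C. \<forall>x. \<bar>x\<bar> ^ k * \<bar>f x + g x\<bar> \<le> C" by blast
qed

lemma rapid_mult_bounded:
  assumes "rapid f" "continuous_on UNIV g" "\<And>x. \<bar>g x\<bar> \<le> B"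
  shows "rapid (\<lambda>x. g x * f x)"
  unfolding rapid_def
proof (intro conjI allI)
  show "continuous_on UNIV (\<lambda>x. g x * f x)"
    using assms by (auto intro!: continuous_intros simp: rapid_def)
  fix k
  obtain C where "C \<ge> 0" "\<forall>x. \<bar>x\<bar> ^ k * \<bar>f x\<bar> \<le> C"
    using rapidD assms by meson
  then have "\<bar>g x\<bar> * (\<bar>x\<bar> ^ k * \<bar>f x\<bar>) \<le> B * C" for x
    using assms(3)[of x] by (intro mult_mono) auto
  then show "\<exists>C. \<forall>x. \<bar>x\<bar> ^ k * \<bar>g x * f x\<bar> \<le> C"
    by (auto simp: abs_mult mult_ac)
qed

lemma rapid_mult: assumes "rapid f" "rapid g" shows "rapid (\<lambda>x. f x * g x)"
  using rapid_bounded[OF assms(1)] rapid_mult_bounded[OF assms(2) rapid_continuous[OF assms(1)]] by blast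

lemma rapid_cmult: assumes "rapid f" shows "rapid (\<lambda>x. c * f x)"
  by (rule rapid_mult_bounded[OF assms, where B = "\<bar>c\<bar>"]) auto

lemma rapid_diff: "rapid f \<Longrightarrow> rapid g \<Longrightarrow> rapid (\<lambda>x. f x - g x)"
  using rapid_add[of f "\<lambda>x. -1 * g x"] rapid_cmult[of g "-1"] by simp

lemma rapid_mult_x: assumes "rapid f" shows "rapid (\<lambda>x. x * f x)"
  unfolding rapid_def
proof (intro conjI allI)
  show "continuous_on UNIV (\<lambda>x. x * f x)"
    using assms by (auto intro!: continuous_intros simp: rapid_def)
  fix k
  show "\<exists>C. \<forall>x. \<bar>x\<bar> ^ k * \<bar>x * f x\<bar> \<le> C"
    using rapidD[OF assms, of "Suc k"] by (auto simp: abs_mult mult_ac)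
qed

lemma rapid_mult_power: "rapid f \<Longrightarrow> rapid (\<lambda>x. x ^ k * f x)"
  by (induction k) (auto simp: mult.assoc intro: rapid_mult_x)

lemma rapid_gaussian: "rapid (\<lambda>x. exp (- x\<^sup>2 / 2))"
  unfolding rapid_def
proof (intro conjI allI)
  show "continuous_on UNIV (\<lambda>x::real. exp (- x\<^sup>2 / 2))"
    by (auto intro!: continuous_intros)
  fix k
  have "\<bar>x\<bar> ^ k * \<bar>exp (- x\<^sup>2 / 2)\<bar> \<le> 1 + 2 ^ k * fact k" for x :: real
  proof -
    have 1: "(x\<^sup>2 / 2) ^ k / fact k \<le> exp (x\<^sup>2 / 2)"
    proof -
      have "(\<Sum>n\<in>{k}. (x\<^sup>2 / 2) ^ n /\<^sub>R fact n) \<le> (\<Sum>n. (x\<^sup>2 / 2) ^ n /\<^sub>R fact n)"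
        by (rule sum_le_suminf[OF summable_exp_generic]) auto
      also have "\<dots> = exp (x\<^sup>2 / 2)" by (simp only: exp_def)
      finally show ?thesis by (simp add: inverse_eq_divide)
    qed
    have "\<bar>x\<bar> ^ k \<le> 1 + (x\<^sup>2) ^ k"
    proof (cases "\<bar>x\<bar> \<le> 1")
      case True
      then have "\<bar>x\<bar> ^ k \<le> 1" by (simp add: power_le_one)
      then show ?thesis using zero_le_power[of "x\<^sup>2" k] by (smt (verit) zero_le_power2)
    next
      case False
      then have "\<bar>x\<bar> * 1 \<le> \<bar>x\<bar> * \<bar>x\<bar>" by (intro mult_left_mono) auto
      then have "\<bar>x\<bar> \<le> x\<^sup>2" by (simp add: power2_eq_square)
      then have "\<bar>x\<bar> ^ k \<le> (x\<^sup>2) ^ k" by (intro power_mono) auto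
      then show ?thesis by simp
    qed
    also have "(x\<^sup>2) ^ k \<le> 2 ^ k * fact k * exp (x\<^sup>2 / 2)"
    proof -
      have "(x\<^sup>2) ^ k = 2 ^ k * fact k * ((x\<^sup>2 / 2) ^ k / fact k)" by (simp add: power_divide)
      also have "\<dots> \<le> 2 ^ k * fact k * exp (x\<^sup>2 / 2)" using 1 by (intro mult_left_mono) auto
      finally show ?thesis .
    qed
    finally have "\<bar>x\<bar> ^ k \<le> 1 + 2 ^ k * fact k * exp (x\<^sup>2 / 2)" by simp
    then have "\<bar>x\<bar> ^ k * exp (- (x\<^sup>2 / 2)) \<le> (1 + 2 ^ k * fact k * exp (x\<^sup>2 / 2)) * exp (- (x\<^sup>2 / 2))"
      by (intro mult_right_mono) auto
    also have "\<dots> = exp (- (x\<^sup>2 / 2)) + 2 ^ k * fact k"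
    proof -
      have "exp (x\<^sup>2 / 2) * exp (- (x\<^sup>2 / 2)) = 1" by (simp flip: exp_add)
      then show ?thesis by (simp only: distrib_right mult.assoc mult_1_left mult_1_right)
    qed
    also have "\<dots> \<le> 1 + 2 ^ k * fact k" by simp
    finally show ?thesis by simp
  qed
  then show "\<exists>C. \<forall>x::real. \<bar>x\<bar> ^ k * \<bar>exp (- x\<^sup>2 / 2)\<bar> \<le> C" by blast
qed

lemma integrable_inverse_1_plus_sq: "integrable lborel (\<lambda>x::real. 1 / (1 + x\<^sup>2))"
  using integrable_inverse_1_plus_square
  by (simp add: set_integrable_def einterval_def inverse_eq_divide)

lemma rapid_integrable: assumes "rapid g" shows "integrable lborel g"
proof -
  obtain C D where C: "\<forall>x. \<bar>x\<bar> ^ 0 * \<bar>g x\<bar> \<le> C" and D: "\<forall>x. \<bar>x\<bar> ^ 2 * \<bar>g x\<bar> \<le> D"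
    using rapidD[OF assms] by meson
  have "norm (g x) \<le> (C + D) * (1 / (1 + x\<^sup>2))" for x
  proof -
    have "(1 + x\<^sup>2) * \<bar>g x\<bar> \<le> C + D"
      using C[rule_format, of x] D[rule_format, of x] by (simp add: distrib_right)
    moreover have "1 + x\<^sup>2 > 0" by (simp add: add_pos_nonneg)
    ultimately show ?thesis by (simp add: field_simps)
  qed
  moreover have "integrable lborel (\<lambda>x::real. (C + D) * (1 / (1 + x\<^sup>2)))"
    by (intro integrable_mult_right integrable_inverse_1_plus_sq)
  ultimately show ?thesis
    using rapid_measurable[OF assms]
    by (intro Bochner_Integration.integrable_bound[where g = g and f = "\<lambda>x. (C + D) * (1 / (1 + x\<^sup>2))"])
       (auto intro!: AE_I2 intro: order_trans[OF _ abs_ge_self] simp del: times_divide_eq_right)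
qed

lemma rapid_tendsto:
  assumes "rapid g" shows "(g \<longlongrightarrow> 0) at_top" "(g \<longlongrightarrow> 0) at_bot"
proof -
  obtain C where C: "\<forall>x. \<bar>x\<bar> ^ 1 * \<bar>g x\<bar> \<le> C" using rapidD[OF assms] by meson
  have ev: "\<bar>g x\<bar> \<le> C / \<bar>x\<bar>" if "x \<noteq> 0" for x
    using that C[rule_format, of x] by (simp add: field_simps)
  show "(g \<longlongrightarrow> 0) at_top"
  proof (rule Lim_null_comparison)
    show "\<forall>\<^sub>F x in at_top. norm (g x) \<le> C / \<bar>x\<bar>"
      using eventually_gt_at_top[of 0] by (rule eventually_mono) (metis ev less_irrefl real_norm_def)
    show "((\<lambda>x. C / \<bar>x\<bar>) \<longlongrightarrow> 0) at_top" by real_asymp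
  qed
  show "(g \<longlongrightarrow> 0) at_bot"
  proof (rule Lim_null_comparison)
    show "\<forall>\<^sub>F x in at_bot. norm (g x) \<le> C / \<bar>x\<bar>"
      using eventually_gt_at_bot[of 0] by (rule eventually_mono) (metis ev less_irrefl real_norm_def)
    show "((\<lambda>x. C / \<bar>x\<bar>) \<longlongrightarrow> 0) at_bot" by real_asymp
  qed
qed

lemma rapid_integral_deriv:
  assumes "rapid F" "rapid F'" "\<And>x. (F has_real_derivative F' x) (at x)"
  shows "(\<integral>x. F' x \<partial>lborel) = 0"
proof -
  have "(LBINT x=-\<infinity>..\<infinity>. F' x) = 0 - 0"
  proof (rule interval_integral_FTC_integrable)
    show "((F \<circ> real_of_ereal) \<longlongrightarrow> 0) (at_right (- \<infinity>))"
      using rapid_tendsto(2)[OF assms(1)] by (simp add: ereal_tendsto_simps)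
    show "((F \<circ> real_of_ereal) \<longlongrightarrow> 0) (at_left \<infinity>)"
      using rapid_tendsto(1)[OF assms(1)] by (simp add: ereal_tendsto_simps)
    show "\<And>x. - \<infinity> < ereal x \<Longrightarrow> ereal x < \<infinity> \<Longrightarrow> isCont F' x"
      using rapid_continuous[OF assms(2)] by (auto simp: continuous_on_eq_continuous_at)
    show "set_integrable lborel (einterval (- \<infinity>) \<infinity>) F'"
      using rapid_integrable[OF assms(2)] by (simp add: set_integrable_def)
  qed (use assms(3) in \<open>auto simp: has_real_derivative_iff_has_vector_derivative[symmetric]\<close>)
  then show ?thesis by (simp add: interval_lebesgue_integral_def set_lebesgue_integral_def)
qed

section \<open>Orthonormality from a three-term recursion\<close>

text \<open>
  The three-term recursion of orthonormal polynomials determines the Gram matrix.  If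
  \<open>E n m\<close> is the inner product of the \<open>n\<close>-th and the \<open>m\<close>-th function, symmetry of
  multiplication by \<open>x\<close> gives the hypothesis \<open>rec\<close>, and the first column \<open>E n 0\<close> then
  propagates to all columns.  The bound \<open>n + m \<le> N\<close> accommodates finite systems; the
  summands containing \<open>n - 1\<close> or \<open>m - 1\<close> for index \<open>0\<close> vanish because \<open>b 0 = 0\<close>.
\<close>

lemma jacobi_orthonormal:
  fixes E :: "nat \<Rightarrow> nat \<Rightarrow> real" and b :: "nat \<Rightarrow> real"
  assumes b0: "b 0 = 0" and bpos: "\<And>n. 0 < n \<Longrightarrow> n \<le> N \<Longrightarrow> b n \<noteq> 0"
    and E0: "\<And>n. n \<le> N \<Longrightarrow> E n 0 = (if n = 0 then 1 else 0)"
    and rec: "\<And>n m. n + m < N \<Longrightarrow>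
       b (Suc m) * E n (Suc m) + b m * E n (m - 1) = b (Suc n) * E (Suc n) m + b n * E (n - 1) m"
  shows "n + m \<le> N \<Longrightarrow> E n m = (if n = m then 1 else 0)"
proof (induction m arbitrary: n rule: less_induct)
  case (less m)
  show ?case
  proof (cases m)
    case 0
    then show ?thesis using E0[of n] less.prems by simp
  next
    case (Suc m')
    have r: "b (Suc m') * E n (Suc m') + b m' * E n (m' - 1) = b (Suc n) * E (Suc n) m' + b n * E (n - 1) m'"
      using less.prems Suc by (intro rec) auto
    have e1: "E (Suc n) m' = (if Suc n = m' then 1 else 0)"
      using less.prems Suc by (intro less.IH) auto
    have e2: "b n * E (n - 1) m' = (if n = Suc m' then b n else 0)"
    proof (cases "n = 0")
      case False
      then have "E (n - 1) m' = (if n - 1 = m' then 1 else 0)"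
        using less.prems Suc by (intro less.IH) auto
      then show ?thesis using False by auto
    qed (simp add: b0)
    have e3: "b m' * E n (m' - 1) = (if Suc n = m' then b m' else 0)"
    proof (cases "m' = 0")
      case False
      then have "E n (m' - 1) = (if n = m' - 1 then 1 else 0)"
        using less.prems Suc by (intro less.IH) auto
      then show ?thesis using False by auto
    qed (simp add: b0)
    have "b (Suc m') * E n (Suc m') = b (Suc m') * (if n = Suc m' then 1 else 0)"
      using r e1 e2 e3 by (auto split: if_splits)
    moreover have "b (Suc m') \<noteq> 0" using less.prems Suc by (intro bpos) auto
    ultimately show ?thesis using Suc by simp
  qed
qed

section \<open>Hermite functions\<close>

text \<open>
  The off-diagonal entries \<open>\<surd>(n / 2)\<close> of the Jacobi matrix of the Hermite functions.
\<close>

definition hermite_jac :: "nat \<Rightarrow> real" where "hermite_jac n = sqrt (real n / 2)"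

lemma hermite_jac_0 [simp]: "hermite_jac 0 = 0" and hermite_jac_nonneg [simp]: "hermite_jac n \<ge> 0"
  and hermite_jac_pos [simp]: "n > 0 \<Longrightarrow> hermite_jac n > 0"
  and hermite_jac_sq: "hermite_jac n * hermite_jac n = real n / 2"
  by (simp_all add: hermite_jac_def)

lemma hermite_jac_eq_0_iff [simp]: "hermite_jac n = 0 \<longleftrightarrow> n = 0"
  by (simp add: hermite_jac_def)

lemma hermite_jac_le: "hermite_jac n \<le> real n"
proof (cases "n = 0")
  case False
  then have "real n / 2 \<le> (real n)\<^sup>2" by (simp add: power2_eq_square field_simps)
  then show ?thesis unfolding hermite_jac_def by (intro real_le_lsqrt) auto
qed simp

lemma hermite_poly_Suc:
  "hermite_poly (Suc n) x = 2 * x * hermite_poly n x - 2 * real n * hermite_poly (n - 1) x"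
  by (cases n) auto

lemma hermite_poly_deriv:
  "(hermite_poly n has_real_derivative 2 * real n * hermite_poly (n - 1) x) (at x)"
proof (induction n rule: less_induct)
  case (less n)
  show ?case
  proof (cases n)
    case 0
    have "hermite_poly 0 = (\<lambda>x. 1)" by auto
    then show ?thesis using 0 by simp
  next
    case (Suc m)
    have eq: "hermite_poly n = (\<lambda>x. 2 * x * hermite_poly m x - 2 * real m * hermite_poly (m - 1) x)"
      using Suc hermite_poly_Suc by auto
    have d1: "(hermite_poly m has_real_derivative 2 * real m * hermite_poly (m - 1) x) (at x)"
      using less[of m] Suc by simp
    have d2: "((\<lambda>x. 2 * real m * hermite_poly (m - 1) x) has_real_derivative
        2 * real m * (2 * real (m - 1) * hermite_poly (m - 1 - 1) x)) (at x)"
      using less[of "m - 1"] Suc by (intro DERIV_cmult) auto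
    have "(hermite_poly n has_real_derivative
        (2 * hermite_poly m x + 2 * x * (2 * real m * hermite_poly (m - 1) x))
          - 2 * real m * (2 * real (m - 1) * hermite_poly (m - 1 - 1) x)) (at x)"
      unfolding eq by (rule DERIV_diff[OF _ d2]) (auto intro!: derivative_eq_intros d1)
    also have "(2 * hermite_poly m x + 2 * x * (2 * real m * hermite_poly (m - 1) x))
          - 2 * real m * (2 * real (m - 1) * hermite_poly (m - 1 - 1) x) =
        2 * real n * hermite_poly (n - 1) x"
    proof (cases m)
      case (Suc k)
      have "2 * hermite_poly m x + 2 * real m * (2 * x * hermite_poly k x - 2 * real k * hermite_poly (k - 1) x)
         = 2 * hermite_poly m x + 2 * real m * hermite_poly m x"
        using hermite_poly_Suc[of k x] Suc by simp
      then show ?thesis using Suc \<open>n = Suc m\<close> by (simp add: algebra_simps)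
    qed (use Suc in auto)
    finally show ?thesis .
  qed
qed

text \<open>
  The normalising factor in the definition of the \<open>n\<close>-th Hermite function.
\<close>

definition hermite_nrm :: "nat \<Rightarrow> real" where
  "hermite_nrm n = sqrt (2 ^ n * fact n * sqrt pi)"

lemma hermite_nrm_pos [simp]: "hermite_nrm n > 0"
  by (simp add: hermite_nrm_def)

lemma hermite_nrm_nonzero [simp]: "hermite_nrm n \<noteq> 0"
  using hermite_nrm_pos[of n] by linarith

lemma hermite_nrm_Suc: "hermite_nrm (Suc n) = 2 * hermite_jac (Suc n) * hermite_nrm n"
proof -
  have "(2 * hermite_jac (Suc n) * hermite_nrm n)\<^sup>2 = 4 * (hermite_jac (Suc n) * hermite_jac (Suc n)) * (hermite_nrm n)\<^sup>2"
    by (simp add: power2_eq_square)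
  also have "\<dots> = 2 ^ Suc n * fact (Suc n) * sqrt pi"
    unfolding hermite_jac_sq by (simp add: hermite_nrm_def field_simps)
  finally show ?thesis unfolding hermite_nrm_def[of "Suc n"]
    using less_imp_le[OF hermite_nrm_pos[of n]] by (intro real_sqrt_unique) auto
qed

lemma hermite_poly_eq: "hermite_poly n x * exp (- x\<^sup>2 / 2) = hermite_nrm n * hermite_fun n x"
  by (simp add: hermite_fun_def flip: hermite_nrm_def)

lemma hermite_fun_rec:
  "x * hermite_fun n x = hermite_jac (Suc n) * hermite_fun (Suc n) x + hermite_jac n * hermite_fun (n - 1) x"
proof -
  have "hermite_nrm n * (2 * (x * hermite_fun n x)) = 2 * x * (hermite_poly n x * exp (- x\<^sup>2 / 2))"
    by (simp only: hermite_poly_eq mult.left_commute mult.assoc)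
  also have "\<dots> = hermite_poly (Suc n) x * exp (- x\<^sup>2 / 2) + 2 * real n * (hermite_poly (n - 1) x * exp (- x\<^sup>2 / 2))"
    by (simp add: hermite_poly_Suc algebra_simps)
  also have "\<dots> = hermite_nrm n * (2 * hermite_jac (Suc n) * hermite_fun (Suc n) x) + 2 * real n * hermite_nrm (n - 1) * hermite_fun (n - 1) x"
    by (simp only: hermite_poly_eq hermite_nrm_Suc) (simp add: algebra_simps)
  also have "2 * real n * hermite_nrm (n - 1) = hermite_nrm n * (2 * hermite_jac n)"
  proof (cases n)
    case (Suc m)
    have "2 * real n * hermite_nrm m = 4 * (hermite_jac n * hermite_jac n) * hermite_nrm m"
      by (simp add: hermite_jac_sq)
    also have "\<dots> = (2 * hermite_jac n * hermite_nrm m) * (2 * hermite_jac n)" by simp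
    finally show ?thesis by (simp add: Suc hermite_nrm_Suc)
  qed simp
  finally have "hermite_nrm n * (2 * (x * hermite_fun n x)) =
     hermite_nrm n * (2 * (hermite_jac (Suc n) * hermite_fun (Suc n) x + hermite_jac n * hermite_fun (n - 1) x))"
    by (simp add: algebra_simps)
  then show ?thesis using hermite_nrm_pos[of n] by simp
qed

text \<open>
  Together with the recursion, this says that \<open>x\<close> and \<open>d / dx\<close> are the sum and the
  difference of the annihilation and the creation operator.
\<close>

lemma hermite_fun_deriv:
  "(hermite_fun n has_real_derivative
      (hermite_jac n * hermite_fun (n - 1) x - hermite_jac (Suc n) * hermite_fun (Suc n) x)) (at x)"
proof -
  have eq: "hermite_fun n = (\<lambda>x. hermite_poly n x * exp (- x\<^sup>2 / 2) / hermite_nrm n)"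
    by (simp add: hermite_fun_def hermite_nrm_def fun_eq_iff)
  have "(hermite_fun n has_real_derivative
      (2 * real n * hermite_poly (n - 1) x * exp (- x\<^sup>2 / 2) + hermite_poly n x * (exp (- x\<^sup>2 / 2) * (- x))) / hermite_nrm n) (at x)"
    unfolding eq
    by (rule DERIV_cdivide, rule DERIV_cong[OF DERIV_mult[OF hermite_poly_deriv]])
       (auto intro!: derivative_eq_intros simp: algebra_simps)
  also have "(2 * real n * hermite_poly (n - 1) x * exp (- x\<^sup>2 / 2) + hermite_poly n x * (exp (- x\<^sup>2 / 2) * (- x))) / hermite_nrm n
     = 2 * real n * (hermite_poly (n - 1) x * exp (- x\<^sup>2 / 2)) / hermite_nrm n - x * (hermite_poly n x * exp (- x\<^sup>2 / 2) / hermite_nrm n)"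
    by (simp add: algebra_simps add_divide_distrib diff_divide_distrib)
  also have "hermite_poly n x * exp (- x\<^sup>2 / 2) / hermite_nrm n = hermite_fun n x"
    by (simp add: eq)
  also have "2 * real n * (hermite_poly (n - 1) x * exp (- x\<^sup>2 / 2)) / hermite_nrm n = 2 * hermite_jac n * hermite_fun (n - 1) x"
  proof (cases n)
    case (Suc m)
    have "2 * real n * (hermite_nrm m * hermite_fun m x) = 4 * (hermite_jac n * hermite_jac n) * (hermite_nrm m * hermite_fun m x)"
      by (simp add: hermite_jac_sq)
    also have "\<dots> = (2 * hermite_jac n * hermite_fun m x) * hermite_nrm n"
      by (simp only: Suc hermite_nrm_Suc) (simp only: mult_ac)
    finally have e: "2 * real n * (hermite_nrm m * hermite_fun m x) = (2 * hermite_jac n * hermite_fun m x) * hermite_nrm n" .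
    have "n - 1 = m" by (simp add: Suc)
    then show ?thesis unfolding hermite_poly_eq by (simp only: e nonzero_mult_div_cancel_right[OF hermite_nrm_nonzero])
  qed simp
  also have "2 * hermite_jac n * hermite_fun (n - 1) x - x * hermite_fun n x =
     hermite_jac n * hermite_fun (n - 1) x - hermite_jac (Suc n) * hermite_fun (Suc n) x"
    by (simp add: hermite_fun_rec)
  finally show ?thesis .
qed

lemma hermite_fun_0: "hermite_fun 0 x = exp (- x\<^sup>2 / 2) / sqrt (sqrt pi)"
  by (simp add: hermite_fun_def)

lemma rapid_hermite_fun: "rapid (hermite_fun n)"
proof (induction n rule: less_induct)
  case (less n)
  show ?case
  proof (cases n)
    case 0
    have "hermite_fun 0 = (\<lambda>x. 1 / sqrt (sqrt pi) * exp (- x\<^sup>2 / 2))"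
      by (auto simp: hermite_fun_0)
    then show ?thesis using 0 rapid_cmult[OF rapid_gaussian, of "1 / sqrt (sqrt pi)"] by simp
  next
    case (Suc m)
    have "hermite_fun n x = 1 / hermite_jac n * (x * hermite_fun m x - hermite_jac m * hermite_fun (m - 1) x)" for x
      using hermite_fun_rec[of x m] hermite_jac_pos[of n] Suc by (simp add: field_simps)
    then have "hermite_fun n = (\<lambda>x. 1 / hermite_jac n * (x * hermite_fun m x - hermite_jac m * hermite_fun (m - 1) x))"
      by auto
    moreover have "rapid (\<lambda>x. 1 / hermite_jac n * (x * hermite_fun m x - hermite_jac m * hermite_fun (m - 1) x))"
      using less[of m] less[of "m - 1"] Suc
      by (intro rapid_cmult rapid_diff rapid_mult_x) auto
    ultimately show ?thesis by simp
  qed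
qed

lemma hermite_fun_integrable_mult: "integrable lborel (\<lambda>x. hermite_fun n x * hermite_fun m x)"
  by (intro rapid_integrable rapid_mult rapid_hermite_fun)

lemma hermite_gram_0: "(\<integral>x. hermite_fun n x * hermite_fun 0 x \<partial>lborel) = (if n = 0 then 1 else 0)"
proof (cases n)
  case 0
  have 1: "hermite_fun 0 x * hermite_fun 0 x = 1 / sqrt pi * exp (- x\<^sup>2)" for x
  proof -
    have "hermite_fun 0 x * hermite_fun 0 x = (exp (- x\<^sup>2 / 2) * exp (- x\<^sup>2 / 2)) / (sqrt (sqrt pi) * sqrt (sqrt pi))"
      unfolding hermite_fun_0 by (simp add: times_divide_times_eq)
    also have "\<dots> = 1 / sqrt pi * exp (- x\<^sup>2)"
      by (simp flip: exp_add)
    finally show ?thesis .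
  qed
  have "has_bochner_integral lborel (\<lambda>x::real. exp (- x\<^sup>2)) (2 *\<^sub>R (sqrt pi / 2))"
    by (rule has_bochner_integral_even_function[OF gaussian_moment_0]) simp
  then have "(\<integral>x. exp (- x\<^sup>2) \<partial>lborel) = sqrt pi"
    using has_bochner_integral_integral_eq by fastforce
  then show ?thesis using 0 by (simp add: 1)
next
  case (Suc m)
  \<comment> \<open>the integrand is the derivative of the product of the functions of index \<open>n - 1\<close> and \<open>0\<close>\<close>
  have "(\<integral>x. - 2 * hermite_jac n * (hermite_fun n x * hermite_fun 0 x) \<partial>lborel) = 0"
  proof (rule rapid_integral_deriv[where F = "\<lambda>x. hermite_fun m x * hermite_fun 0 x"])
    fix x
    have "((\<lambda>x. hermite_fun m x * hermite_fun 0 x) has_real_derivative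
       (hermite_jac m * hermite_fun (m - 1) x - hermite_jac (Suc m) * hermite_fun (Suc m) x) * hermite_fun 0 x
       + (hermite_jac 0 * hermite_fun (0 - 1) x - hermite_jac (Suc 0) * hermite_fun (Suc 0) x) * hermite_fun m x) (at x)"
      by (rule DERIV_mult[OF hermite_fun_deriv hermite_fun_deriv])
    also have "(hermite_jac 0 * hermite_fun (0 - 1) x - hermite_jac (Suc 0) * hermite_fun (Suc 0) x) * hermite_fun m x = - hermite_fun 0 x * (x * hermite_fun m x)"
      using hermite_fun_rec[of x 0] by (simp add: mult_ac)
    also have "(hermite_jac m * hermite_fun (m - 1) x - hermite_jac (Suc m) * hermite_fun (Suc m) x) * hermite_fun 0 x
       + - hermite_fun 0 x * (x * hermite_fun m x) = - 2 * hermite_jac n * (hermite_fun n x * hermite_fun 0 x)"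
      by (simp add: hermite_fun_rec Suc algebra_simps)
    finally show "((\<lambda>x. hermite_fun m x * hermite_fun 0 x) has_real_derivative
         - 2 * hermite_jac n * (hermite_fun n x * hermite_fun 0 x)) (at x)" .
  qed (intro rapid_cmult rapid_mult rapid_hermite_fun)+
  then show ?thesis using Suc hermite_jac_pos[of n] by simp
qed

lemma hermite_gram: "(\<integral>x. hermite_fun n x * hermite_fun m x \<partial>lborel) = (if n = m then 1 else 0)"
proof (rule jacobi_orthonormal[where b = hermite_jac and N = "n + m" and E = "\<lambda>n m. \<integral>x. hermite_fun n x * hermite_fun m x \<partial>lborel"])
  fix n m :: nat
  have "hermite_jac (Suc m) * (\<integral>x. hermite_fun n x * hermite_fun (Suc m) x \<partial>lborel) + hermite_jac m * (\<integral>x. hermite_fun n x * hermite_fun (m - 1) x \<partial>lborel)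
    = (\<integral>x. hermite_jac (Suc m) * (hermite_fun n x * hermite_fun (Suc m) x) + hermite_jac m * (hermite_fun n x * hermite_fun (m - 1) x) \<partial>lborel)"
    by (subst Bochner_Integration.integral_add) (auto intro!: hermite_fun_integrable_mult integrable_mult_right)
  also have "\<dots> = (\<integral>x. hermite_jac (Suc n) * (hermite_fun (Suc n) x * hermite_fun m x) + hermite_jac n * (hermite_fun (n - 1) x * hermite_fun m x) \<partial>lborel)"
  proof (rule Bochner_Integration.integral_cong[OF refl])
    fix x
    have "hermite_fun n x * (x * hermite_fun m x) = (x * hermite_fun n x) * hermite_fun m x" by simp
    then show "hermite_jac (Suc m) * (hermite_fun n x * hermite_fun (Suc m) x) + hermite_jac m * (hermite_fun n x * hermite_fun (m - 1) x)
      = hermite_jac (Suc n) * (hermite_fun (Suc n) x * hermite_fun m x) + hermite_jac n * (hermite_fun (n - 1) x * hermite_fun m x)"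
      unfolding hermite_fun_rec by (simp add: algebra_simps)
  qed
  also have "\<dots> = hermite_jac (Suc n) * (\<integral>x. hermite_fun (Suc n) x * hermite_fun m x \<partial>lborel) + hermite_jac n * (\<integral>x. hermite_fun (n - 1) x * hermite_fun m x \<partial>lborel)"
    by (subst Bochner_Integration.integral_add) (auto intro!: hermite_fun_integrable_mult integrable_mult_right)
  finally show "hermite_jac (Suc m) * (\<integral>x. hermite_fun n x * hermite_fun (Suc m) x \<partial>lborel) + hermite_jac m * (\<integral>x. hermite_fun n x * hermite_fun (m - 1) x \<partial>lborel)
     = hermite_jac (Suc n) * (\<integral>x. hermite_fun (Suc n) x * hermite_fun m x \<partial>lborel) + hermite_jac n * (\<integral>x. hermite_fun (n - 1) x * hermite_fun m x \<partial>lborel)" .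
qed (auto simp: hermite_gram_0)

text \<open>
  The square of a Hermite function at a point is the integral of its derivative from
  \<open>-\<infinity>\<close>, which is at most \<open>\<integral> \<psi>\<^sub>n\<^sup>2 + \<psi>\<^sub>n'\<^sup>2\<close>.
\<close>

lemma hermite_fun_bound: "(hermite_fun n x)\<^sup>2 \<le> 2 * real n + 2"
proof -
  define d where "d = (\<lambda>x. hermite_jac n * hermite_fun (n - 1) x - hermite_jac (Suc n) * hermite_fun (Suc n) x)"
  define q where "q = (\<lambda>x. (hermite_fun n x)\<^sup>2 + (d x)\<^sup>2)"
  have rd: "rapid d" unfolding d_def by (intro rapid_diff rapid_cmult rapid_hermite_fun)
  have rq: "rapid q" unfolding q_def power2_eq_square by (intro rapid_add rapid_mult rd rapid_hermite_fun)
  have Iq: "(\<integral>x. q x \<partial>lborel) \<le> 2 * real n + 2"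
  proof -
    have "q x \<le> hermite_fun n x * hermite_fun n x + (real n * (hermite_fun (n - 1) x * hermite_fun (n - 1) x)
          + real (Suc n) * (hermite_fun (Suc n) x * hermite_fun (Suc n) x))" for x
    proof -
      have "(d x)\<^sup>2 \<le> 2 * (hermite_jac n * hermite_fun (n - 1) x)\<^sup>2 + 2 * (hermite_jac (Suc n) * hermite_fun (Suc n) x)\<^sup>2"
        unfolding d_def using sum_squares_ge_zero[of "hermite_jac n * hermite_fun (n - 1) x + hermite_jac (Suc n) * hermite_fun (Suc n) x" 0]
        by (simp add: power2_eq_square algebra_simps)
      also have "\<dots> = real n * (hermite_fun (n - 1) x)\<^sup>2 + real (Suc n) * (hermite_fun (Suc n) x)\<^sup>2"
        by (simp add: power_mult_distrib power2_eq_square[of "hermite_jac _"] hermite_jac_sq)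
      finally show ?thesis by (simp add: q_def power2_eq_square)
    qed
    then have "(\<integral>x. q x \<partial>lborel) \<le> (\<integral>x. hermite_fun n x * hermite_fun n x + (real n * (hermite_fun (n - 1) x * hermite_fun (n - 1) x)
          + real (Suc n) * (hermite_fun (Suc n) x * hermite_fun (Suc n) x)) \<partial>lborel)"
      by (intro integral_mono rapid_integrable rq rapid_add rapid_cmult rapid_mult rapid_hermite_fun)
    also have "\<dots> = 1 + (real n * 1 + real (Suc n) * 1)"
      by (subst Bochner_Integration.integral_add | intro Bochner_Integration.integrable_add integrable_mult_right hermite_fun_integrable_mult | simp add: hermite_gram)+
    finally show ?thesis by simp
  qed
  have le: "(hermite_fun n x)\<^sup>2 - (hermite_fun n y)\<^sup>2 \<le> 2 * real n + 2" if "y \<le> x" for y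
  proof -
    have der: "((\<lambda>x. (hermite_fun n x)\<^sup>2) has_real_derivative 2 * hermite_fun n z * d z) (at z)" for z
      unfolding power2_eq_square d_def
      by (rule DERIV_cong[OF DERIV_mult[OF hermite_fun_deriv hermite_fun_deriv]]) (simp add: algebra_simps)
    have cont: "isCont (\<lambda>z. 2 * hermite_fun n z * d z) z" for z
      using rapid_continuous[OF rapid_cmult[OF rapid_mult[OF rapid_hermite_fun[of n] rd], of 2]]
      by (simp add: continuous_on_eq_continuous_at mult.assoc)
    have "(hermite_fun n x)\<^sup>2 - (hermite_fun n y)\<^sup>2 = (\<integral>z. (2 * hermite_fun n z * d z) * indicator {y..x} z \<partial>lborel)"
      by (rule integral_FTC_Icc_real[symmetric]) (use that der cont in auto)
    also have "\<dots> \<le> (\<integral>z. q z \<partial>lborel)"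
    proof (rule integral_mono_AE')
      show "integrable lborel q" by (rule rapid_integrable[OF rq])
      have "2 * hermite_fun n z * d z \<le> q z" for z
        unfolding q_def using sum_squares_bound[of "hermite_fun n z" "d z"] by simp
      moreover have "0 \<le> q z" for z by (simp add: q_def)
      ultimately show "AE z in lborel. (2 * hermite_fun n z * d z) * indicator {y..x} z \<le> q z"
        "AE z in lborel. 0 \<le> q z"
        by (auto intro!: AE_I2 split: split_indicator)
    qed
    finally show ?thesis using Iq by simp
  qed
  have lim: "((\<lambda>y. (hermite_fun n x)\<^sup>2 - (hermite_fun n y)\<^sup>2) \<longlongrightarrow> (hermite_fun n x)\<^sup>2 - 0\<^sup>2) at_bot"
    by (intro tendsto_intros rapid_tendsto rapid_hermite_fun)
  have "(hermite_fun n x)\<^sup>2 - 0\<^sup>2 \<le> 2 * real n + 2"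
    by (rule tendsto_upperbound[OF lim]) (auto intro!: eventually_mono[OF eventually_le_at_bot[of x]] le)
  then show ?thesis by simp
qed

lemma hermite_fun_abs_bound: "\<bar>hermite_fun n x\<bar> \<le> 2 * (real n + 1)"
proof (rule power2_le_imp_le)
  have "(hermite_fun n x)\<^sup>2 \<le> 2 * real n + 2" by (rule hermite_fun_bound)
  also have "\<dots> \<le> (2 * (real n + 1))\<^sup>2" by (simp add: power2_eq_square algebra_simps)
  finally show "\<bar>hermite_fun n x\<bar>\<^sup>2 \<le> (2 * (real n + 1))\<^sup>2" by simp
qed simp

text \<open>
  Multiplication by \<open>x\<^sup>2\<close> is two applications of the recursion, each costing at most a factor
  linear in \<open>n\<close>.
\<close>

lemma hermite_fun_weighted_bound: "(1 + x\<^sup>2) * \<bar>hermite_fun n x\<bar> \<le> 10 * (real n + 3) ^ 3"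
proof -
  have step: "\<bar>x * hermite_fun n x\<bar> \<le> (real n + 1) * \<bar>hermite_fun (Suc n) x\<bar> + real n * \<bar>hermite_fun (n - 1) x\<bar>" for n
  proof -
    have "\<bar>x * hermite_fun n x\<bar> \<le> hermite_jac (Suc n) * \<bar>hermite_fun (Suc n) x\<bar> + hermite_jac n * \<bar>hermite_fun (n - 1) x\<bar>"
      unfolding hermite_fun_rec by (rule order_trans[OF abs_triangle_ineq]) (simp add: abs_mult)
    also have "\<dots> \<le> (real n + 1) * \<bar>hermite_fun (Suc n) x\<bar> + real n * \<bar>hermite_fun (n - 1) x\<bar>"
      using hermite_jac_le[of n] hermite_jac_le[of "Suc n"] by (intro add_mono mult_right_mono) auto
    finally show ?thesis .
  qed
  have b1: "\<bar>x * hermite_fun n x\<bar> \<le> 4 * (real n + 2)\<^sup>2" for n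
  proof -
    have "\<bar>x * hermite_fun n x\<bar> \<le> (real n + 1) * (2 * (real (Suc n) + 1)) + real n * (2 * (real (n - 1) + 1))"
      using step[of n] by (rule order_trans) (intro add_mono mult_left_mono hermite_fun_abs_bound; simp)
    also have "\<dots> \<le> (real n + 1) * (2 * (real (Suc n) + 1)) + real n * (2 * (real n + 1))"
      by (intro add_mono mult_left_mono) auto
    also have "\<dots> \<le> 4 * (real n + 2)\<^sup>2" by (simp add: power2_eq_square algebra_simps)
    finally show ?thesis .
  qed
  have "\<bar>x\<bar> * \<bar>x * hermite_fun n x\<bar> \<le> (real n + 1) * \<bar>x * hermite_fun (Suc n) x\<bar> + real n * \<bar>x * hermite_fun (n - 1) x\<bar>"
    using mult_left_mono[OF step[of n], of "\<bar>x\<bar>"] by (simp add: abs_mult algebra_simps)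
  also have "\<dots> \<le> (real n + 1) * (4 * (real (Suc n) + 2)\<^sup>2) + real n * (4 * (real (n - 1) + 2)\<^sup>2)"
    by (intro add_mono mult_left_mono b1) auto
  also have "\<dots> \<le> (real n + 1) * (4 * (real n + 3)\<^sup>2) + real n * (4 * (real n + 2)\<^sup>2)"
  proof -
    have "(real (n - 1) + 2)\<^sup>2 \<le> (real n + 2)\<^sup>2" by (intro power_mono) auto
    then have "real n * (4 * (real (n - 1) + 2)\<^sup>2) \<le> real n * (4 * (real n + 2)\<^sup>2)"
      by (intro mult_left_mono) auto
    moreover have "real (Suc n) + 2 = real n + 3" by simp
    ultimately show ?thesis by (simp only: add_le_cancel_left)
  qed
  finally have "\<bar>x\<bar> * \<bar>x * hermite_fun n x\<bar> \<le> (real n + 1) * (4 * (real n + 3)\<^sup>2) + real n * (4 * (real n + 2)\<^sup>2)" .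
  moreover have "\<bar>x\<bar> * \<bar>x * hermite_fun n x\<bar> = x\<^sup>2 * \<bar>hermite_fun n x\<bar>"
    by (simp add: abs_mult power2_eq_square flip: mult.assoc)
  ultimately have b2: "x\<^sup>2 * \<bar>hermite_fun n x\<bar> \<le> (real n + 1) * (4 * (real n + 3)\<^sup>2) + real n * (4 * (real n + 2)\<^sup>2)"
    by simp
  have "(1 + x\<^sup>2) * \<bar>hermite_fun n x\<bar> \<le> 2 * (real n + 1) + ((real n + 1) * (4 * (real n + 3)\<^sup>2) + real n * (4 * (real n + 2)\<^sup>2))"
    using b2 hermite_fun_abs_bound[of n x] by (simp add: distrib_right)
  also have "\<dots> \<le> 10 * (real n + 3) ^ 3"
    by (simp add: power2_eq_square power3_eq_cube algebra_simps)
  finally show ?thesis .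
qed

section \<open>Completeness of the Hermite functions\<close>

lemma L2_mult_integrable:
  fixes f :: "real \<Rightarrow> complex"
  assumes "f \<in> L2_space" "rapid g"
  shows "integrable lborel (\<lambda>x. f x * complex_of_real (g x))"
proof -
  have f: "f \<in> borel_measurable lborel" "integrable lborel (\<lambda>x. (norm (f x))\<^sup>2)"
    using assms(1) by (auto simp: L2_space_def)
  have g: "integrable lborel (\<lambda>x. g x * g x)" by (intro rapid_integrable rapid_mult assms)
  have [measurable]: "g \<in> borel_measurable borel" using assms(2) by (rule rapid_measurable)
  show ?thesis
  proof (rule Bochner_Integration.integrable_bound)
    show "integrable lborel (\<lambda>x. (norm (f x))\<^sup>2 + g x * g x)" using f g by (intro Bochner_Integration.integrable_add)
    show "(\<lambda>x. f x * complex_of_real (g x)) \<in> borel_measurable lborel" using f(1) by measurable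
    have "norm (f x * complex_of_real (g x)) \<le> norm ((norm (f x))\<^sup>2 + g x * g x)" for x
    proof -
      have "2 * (norm (f x) * \<bar>g x\<bar>) \<le> (norm (f x))\<^sup>2 + g x * g x"
        using sum_squares_bound[of "norm (f x)" "\<bar>g x\<bar>"] by (simp add: power2_eq_square)
      moreover have "0 \<le> norm (f x) * \<bar>g x\<bar>" by simp
      ultimately have "norm (f x) * \<bar>g x\<bar> \<le> (norm (f x))\<^sup>2 + g x * g x" by linarith
      then show ?thesis by (simp add: norm_mult)
    qed
    then show "AE x in lborel. norm (f x * complex_of_real (g x)) \<le> norm ((norm (f x))\<^sup>2 + g x * g x)" by simp
  qed
qed

text \<open>
  A weak substitute for the Cauchy-Schwarz inequality that is sufficient for families of
  normalised functions \<open>g\<close>.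
\<close>

lemma L2_pairing_bound:
  fixes f :: "real \<Rightarrow> complex"
  assumes "f \<in> L2_space" "rapid g"
  shows "norm (\<integral>x. f x * complex_of_real (g x) \<partial>lborel) \<le> (\<integral>x. (norm (f x))\<^sup>2 \<partial>lborel) + (\<integral>x. g x * g x \<partial>lborel)"
proof -
  have f: "integrable lborel (\<lambda>x. (norm (f x))\<^sup>2)" using assms(1) by (auto simp: L2_space_def)
  have g: "integrable lborel (\<lambda>x. g x * g x)" by (intro rapid_integrable rapid_mult assms)
  have "norm (\<integral>x. f x * complex_of_real (g x) \<partial>lborel) \<le> (\<integral>x. norm (f x * complex_of_real (g x)) \<partial>lborel)"
    by (rule integral_norm_bound)
  also have "\<dots> \<le> (\<integral>x. (norm (f x))\<^sup>2 + g x * g x \<partial>lborel)"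
  proof (rule integral_mono)
    fix x
    have "2 * (norm (f x) * \<bar>g x\<bar>) \<le> (norm (f x))\<^sup>2 + g x * g x"
      using sum_squares_bound[of "norm (f x)" "\<bar>g x\<bar>"] by (simp add: power2_eq_square)
    moreover have "0 \<le> norm (f x) * \<bar>g x\<bar>" by simp
    ultimately have "norm (f x) * \<bar>g x\<bar> \<le> (norm (f x))\<^sup>2 + g x * g x" by linarith
    then show "norm (f x * complex_of_real (g x)) \<le> (norm (f x))\<^sup>2 + g x * g x" by (simp add: norm_mult)
  qed (use f g L2_mult_integrable[OF assms] in \<open>auto intro: integrable_norm\<close>)
  finally show ?thesis using f g by simp
qed

text \<open>
  Injectivity of the Fourier transform on \<open>L\<^sup>1\<close>: the positive and the negative part of \<open>w\<close>
  have the same mass and, after normalisation, the same characteristic function.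
\<close>

lemma AE_zero_if_char_zero:
  fixes w :: "real \<Rightarrow> real"
  assumes w: "integrable lborel w"
    and zero: "\<And>t. (\<integral>x. iexp (t * x) * complex_of_real (w x) \<partial>lborel) = 0"
  shows "AE x in lborel. w x = 0"
proof -
  have [measurable]: "w \<in> borel_measurable borel" using w by auto
  define p where "p = (\<lambda>x. max 0 (w x))"
  define n where "n = (\<lambda>x. max 0 (- w x))"
  have pm [measurable]: "p \<in> borel_measurable borel" "n \<in> borel_measurable borel" unfolding p_def n_def by measurable
  have ip: "integrable lborel p" and inn: "integrable lborel n"
    unfolding p_def n_def using w by (auto intro!: integrable_max)
  have pos: "p x \<ge> 0" "n x \<ge> 0" for x by (auto simp: p_def n_def)
  have wpn: "w x = p x - n x" for x by (auto simp: p_def n_def)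
  have ch: "integrable lborel (\<lambda>x. iexp (t * x) * complex_of_real (q x))" if "integrable lborel q" for q :: "real \<Rightarrow> real" and t
  proof (rule Bochner_Integration.integrable_bound[OF that])
    show "(\<lambda>x. iexp (t * x) * complex_of_real (q x)) \<in> borel_measurable lborel" using that by measurable
    show "AE x in lborel. norm (iexp (t * x) * complex_of_real (q x)) \<le> norm (q x)"
      by (simp add: norm_mult norm_exp_i_times)
  qed
  have eq: "(\<integral>x. iexp (t * x) * complex_of_real (p x) \<partial>lborel) = (\<integral>x. iexp (t * x) * complex_of_real (n x) \<partial>lborel)" for t
  proof -
    have "(\<integral>x. iexp (t * x) * complex_of_real (p x) \<partial>lborel) - (\<integral>x. iexp (t * x) * complex_of_real (n x) \<partial>lborel)
      = (\<integral>x. iexp (t * x) * complex_of_real (p x) - iexp (t * x) * complex_of_real (n x) \<partial>lborel)"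
      by (rule Bochner_Integration.integral_diff[symmetric]) (intro ch ip inn)+
    also have "\<dots> = (\<integral>x. iexp (t * x) * complex_of_real (w x) \<partial>lborel)"
      by (simp add: wpn algebra_simps)
    finally show ?thesis using zero[of t] by simp
  qed
  define c where "c = (\<integral>x. p x \<partial>lborel)"
  have cn: "c = (\<integral>x. n x \<partial>lborel)"
    using eq[of 0] by (simp add: c_def integral_complex_of_real)
  have c0: "c \<ge> 0" unfolding c_def using pos by simp
  show ?thesis
  proof (cases "c = 0")
    case True
    then have "AE x in lborel. p x = 0" "AE x in lborel. n x = 0"
      using cn integral_nonneg_eq_0_iff_AE[OF ip] integral_nonneg_eq_0_iff_AE[OF inn] pos by (auto simp: c_def)
    then show ?thesis by eventually_elim (simp add: wpn)
  next
    case False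
    then have cpos: "c > 0" using c0 by simp
    define M where "M = (\<lambda>q::real \<Rightarrow> real. density lborel (\<lambda>x. ennreal (q x / c)))"
    have rd: "real_distribution (M q)" and chr: "char (M q) t = (\<integral>x. iexp (t * x) * complex_of_real (q x) \<partial>lborel) / c"
      if q: "integrable lborel q" "\<And>x. q x \<ge> 0" "(\<integral>x. q x \<partial>lborel) = c" for q t
    proof -
      have [measurable]: "q \<in> borel_measurable borel" using q by auto
      have "emeasure (M q) (space (M q)) = (\<integral>\<^sup>+x. ennreal (q x / c) \<partial>lborel)"
        unfolding M_def by (subst emeasure_density) auto
      also have "\<dots> = ennreal (\<integral>x. q x / c \<partial>lborel)"
        using q cpos by (intro nn_integral_eq_integral) auto
      also have "\<dots> = 1" using q cpos by simp
      finally have "prob_space (M q)" by (rule prob_spaceI)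
      then show "real_distribution (M q)"
        unfolding real_distribution_def real_distribution_axioms_def by (auto simp: M_def)
      have "char (M q) t = (\<integral>x. (q x / c) *\<^sub>R iexp (t * x) \<partial>lborel)"
        unfolding char_def M_def using q cpos by (subst integral_density) auto
      also have "\<dots> = (\<integral>x. iexp (t * x) * complex_of_real (q x) / c \<partial>lborel)"
        by (simp add: scaleR_conv_of_real mult_ac)
      also have "\<dots> = (\<integral>x. iexp (t * x) * complex_of_real (q x) \<partial>lborel) / c" by simp
      finally show "char (M q) t = (\<integral>x. iexp (t * x) * complex_of_real (q x) \<partial>lborel) / c" .
    qed
    have "M p = M n"
    proof (rule Levy_uniqueness)
      show "char (M p) = char (M n)"
        using chr[OF ip pos(1)] chr[OF inn pos(2)] eq cn by (auto simp: c_def fun_eq_iff)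
    qed (use rd[OF ip pos(1)] rd[OF inn pos(2)] cn in \<open>auto simp: c_def\<close>)
    then have "AE x in lborel. ennreal (p x / c) = ennreal (n x / c)"
      unfolding M_def by (subst (asm) sigma_finite_measure.density_unique_iff[OF sigma_finite_lborel]) auto
    then show ?thesis
      by eventually_elim (use cpos pos in \<open>auto simp: wpn\<close>)
  qed
qed

text \<open>
  The Fourier transform of \<open>g(x) exp (- x\<^sup>2 / 2)\<close> is the sum of its moment series, because
  \<open>exp \<bar>t x\<bar> \<bar>g(x)\<bar> exp (- x\<^sup>2 / 2)\<close> is an integrable majorant of the partial sums.
\<close>

lemma gaussian_moments_complete:
  fixes g :: "real \<Rightarrow> real"
  assumes g: "g \<in> borel_measurable borel" "integrable lborel (\<lambda>x. (g x)\<^sup>2)"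
    and zero: "\<And>k. (\<integral>x. g x * (x ^ k * exp (- x\<^sup>2 / 2)) \<partial>lborel) = 0"
  shows "AE x in lborel. g x = 0"
proof -
  note [measurable] = g(1)
  define w where "w = (\<lambda>x. g x * exp (- x\<^sup>2 / 2))"
  have wm [measurable]: "w \<in> borel_measurable borel" unfolding w_def by measurable
  have dom: "integrable lborel (\<lambda>x. exp \<bar>t * x\<bar> * \<bar>w x\<bar>)" for t
  proof (rule Bochner_Integration.integrable_bound)
    show "integrable lborel (\<lambda>x. (g x)\<^sup>2 + exp (2 * t\<^sup>2) * exp (- x\<^sup>2 / 2))"
      by (intro Bochner_Integration.integrable_add g(2) integrable_mult_right rapid_integrable rapid_gaussian)
    show "(\<lambda>x. exp \<bar>t * x\<bar> * \<bar>w x\<bar>) \<in> borel_measurable lborel" by measurable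
    have "norm (exp \<bar>t * x\<bar> * \<bar>w x\<bar>) \<le> norm ((g x)\<^sup>2 + exp (2 * t\<^sup>2) * exp (- x\<^sup>2 / 2))" for x
    proof -
      define e where "e = exp (\<bar>t * x\<bar> - x\<^sup>2 / 2)"
      have "0 \<le> (2 * \<bar>t\<bar> - \<bar>x\<bar>)\<^sup>2" by simp
      then have le: "2 * \<bar>t * x\<bar> - x\<^sup>2 \<le> 2 * t\<^sup>2 - x\<^sup>2 / 2"
        by (simp add: power2_diff power_mult_distrib abs_mult)
      have "e\<^sup>2 = exp (2 * \<bar>t * x\<bar> - x\<^sup>2)" unfolding e_def by (simp flip: exp_double)
      also have "\<dots> \<le> exp (2 * t\<^sup>2 - x\<^sup>2 / 2)" using le by simp
      also have "\<dots> = exp (2 * t\<^sup>2) * exp (- x\<^sup>2 / 2)" by (simp flip: exp_add)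
      finally have e2: "e\<^sup>2 \<le> exp (2 * t\<^sup>2) * exp (- x\<^sup>2 / 2)" .
      have "exp \<bar>t * x\<bar> * \<bar>w x\<bar> = \<bar>g x\<bar> * (exp \<bar>t * x\<bar> * exp (- x\<^sup>2 / 2))" by (simp add: w_def abs_mult)
      also have "exp \<bar>t * x\<bar> * exp (- x\<^sup>2 / 2) = e" by (simp add: e_def flip: exp_add)
      finally have "exp \<bar>t * x\<bar> * \<bar>w x\<bar> = \<bar>g x\<bar> * e" .
      moreover have "2 * (\<bar>g x\<bar> * e) \<le> (g x)\<^sup>2 + e\<^sup>2"
        using sum_squares_bound[of "\<bar>g x\<bar>" e] by simp
      moreover have "0 \<le> \<bar>g x\<bar> * e" by (simp add: e_def)
      ultimately have "exp \<bar>t * x\<bar> * \<bar>w x\<bar> \<le> (g x)\<^sup>2 + exp (2 * t\<^sup>2) * exp (- x\<^sup>2 / 2)"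
        using e2 by linarith
      then show ?thesis by simp
    qed
    then show "AE x in lborel. norm (exp \<bar>t * x\<bar> * \<bar>w x\<bar>) \<le> norm ((g x)\<^sup>2 + exp (2 * t\<^sup>2) * exp (- x\<^sup>2 / 2))" by simp
  qed
  have wint: "integrable lborel w"
  proof (rule integrable_norm_cancel)
    show "integrable lborel (\<lambda>x. norm (w x))" using dom[of 0] by simp
  qed measurable
  have mono: "integrable lborel (\<lambda>x. w x * x ^ k)" for k
  proof (rule Bochner_Integration.integrable_bound)
    show "integrable lborel (\<lambda>x. (g x)\<^sup>2 + (x ^ k * exp (- x\<^sup>2 / 2)) * (x ^ k * exp (- x\<^sup>2 / 2)))"
      by (intro Bochner_Integration.integrable_add g(2) rapid_integrable rapid_mult rapid_mult_power rapid_gaussian)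
    show "(\<lambda>x. w x * x ^ k) \<in> borel_measurable lborel" by measurable
    have "norm (w x * x ^ k) \<le> norm ((g x)\<^sup>2 + (x ^ k * exp (- x\<^sup>2 / 2)) * (x ^ k * exp (- x\<^sup>2 / 2)))" for x
    proof -
      define e where "e = x ^ k * exp (- x\<^sup>2 / 2)"
      have "norm (w x * x ^ k) = \<bar>g x\<bar> * \<bar>e\<bar>" by (simp add: w_def e_def abs_mult)
      moreover have "2 * (\<bar>g x\<bar> * \<bar>e\<bar>) \<le> (g x)\<^sup>2 + e * e"
        using sum_squares_bound[of "\<bar>g x\<bar>" "\<bar>e\<bar>"] by (simp add: power2_eq_square)
      moreover have "0 \<le> \<bar>g x\<bar> * \<bar>e\<bar>" by simp
      ultimately show ?thesis unfolding e_def[symmetric] by simp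
    qed
    then show "AE x in lborel. norm (w x * x ^ k) \<le> norm ((g x)\<^sup>2 + (x ^ k * exp (- x\<^sup>2 / 2)) * (x ^ k * exp (- x\<^sup>2 / 2)))" by simp
  qed
  have mz: "(\<integral>x. w x * x ^ k \<partial>lborel) = 0" for k
    using zero[of k] by (simp add: w_def mult_ac)
  have "(\<integral>x. iexp (t * x) * complex_of_real (w x) \<partial>lborel) = 0" for t
  proof -
    define s where "s = (\<lambda>n x. (\<Sum>k<n. (\<i> * complex_of_real (t * x)) ^ k /\<^sub>R fact k) * complex_of_real (w x))"
    define c where "c = (\<lambda>k. (\<i> * complex_of_real t) ^ k /\<^sub>R fact k)"
    have s_alt: "s n x = (\<Sum>k<n. c k * complex_of_real (w x * x ^ k))" for n x
      unfolding s_def c_def sum_distrib_right by (intro sum.cong) (simp_all add: power_mult_distrib scaleR_conv_of_real mult_ac)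
    have "(\<lambda>n. \<integral>x. s n x \<partial>lborel) \<longlonglongrightarrow> (\<integral>x. iexp (t * x) * complex_of_real (w x) \<partial>lborel)"
    proof (rule integral_dominated_convergence[where w = "\<lambda>x. exp \<bar>t * x\<bar> * \<bar>w x\<bar>"])
      show "(\<lambda>x. iexp (t * x) * complex_of_real (w x)) \<in> borel_measurable lborel" by measurable
      show "s n \<in> borel_measurable lborel" for n unfolding s_def by measurable
      show "integrable lborel (\<lambda>x. exp \<bar>t * x\<bar> * \<bar>w x\<bar>)" by (rule dom)
      have "(\<lambda>n. s n x) \<longlonglongrightarrow> iexp (t * x) * complex_of_real (w x)" for x
      proof -
        have "(\<lambda>k. (\<i> * complex_of_real (t * x)) ^ k /\<^sub>R fact k) sums exp (\<i> * complex_of_real (t * x))"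
          by (rule exp_converges)
        then show ?thesis unfolding s_def sums_def by (intro tendsto_mult tendsto_const)
      qed
      then show "AE x in lborel. (\<lambda>n. s n x) \<longlonglongrightarrow> iexp (t * x) * complex_of_real (w x)" by simp
      have "norm (s n x) \<le> exp \<bar>t * x\<bar> * \<bar>w x\<bar>" for n x
      proof -
        have "norm (\<Sum>k<n. (\<i> * complex_of_real (t * x)) ^ k /\<^sub>R fact k) \<le> (\<Sum>k<n. \<bar>t * x\<bar> ^ k /\<^sub>R fact k)"
          by (rule order_trans[OF norm_sum]) (simp add: norm_power norm_mult abs_mult)
        also have "\<dots> \<le> (\<Sum>k. \<bar>t * x\<bar> ^ k /\<^sub>R fact k)" by (rule sum_le_suminf[OF summable_exp_generic]) auto
        also have "\<dots> = exp \<bar>t * x\<bar>" by (simp only: exp_def)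
        finally show ?thesis unfolding s_def by (auto simp: norm_mult intro!: mult_right_mono)
      qed
      then show "AE x in lborel. norm (s n x) \<le> exp \<bar>t * x\<bar> * \<bar>w x\<bar>" for n by simp
    qed
    moreover have "(\<integral>x. s n x \<partial>lborel) = 0" for n
    proof -
      have "(\<integral>x. s n x \<partial>lborel) = (\<Sum>k<n. c k * complex_of_real (\<integral>x. w x * x ^ k \<partial>lborel))"
        unfolding s_alt using mono by (subst Bochner_Integration.integral_sum) (auto simp del: of_real_mult simp: integral_complex_of_real)
      then show ?thesis by (simp add: mz)
    qed
    ultimately show ?thesis by (simp add: LIMSEQ_const_iff)
  qed
  then have "AE x in lborel. w x = 0" by (rule AE_zero_if_char_zero[OF wint])
  then show ?thesis by eventually_elim (simp add: w_def)
qed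

text \<open>
  A linear functional that vanishes on all Hermite functions vanishes on all their products
  with powers of \<open>x\<close>, by the recursion.
\<close>

lemma hermite_span_monomial:
  fixes F :: "(real \<Rightarrow> real) \<Rightarrow> real"
  assumes add: "\<And>u v. rapid u \<Longrightarrow> rapid v \<Longrightarrow> F (\<lambda>x. u x + v x) = F u + F v"
    and cmult: "\<And>c u. rapid u \<Longrightarrow> F (\<lambda>x. c * u x) = c * F u"
    and zero: "\<And>n. F (hermite_fun n) = 0"
  shows "F (\<lambda>x. x ^ k * hermite_fun n x) = 0"
proof (induction k arbitrary: n)
  case (Suc k)
  have "(\<lambda>x. x ^ Suc k * hermite_fun n x) =
     (\<lambda>x. hermite_jac (Suc n) * (x ^ k * hermite_fun (Suc n) x) + hermite_jac n * (x ^ k * hermite_fun (n - 1) x))"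
  proof
    fix x
    have "x ^ Suc k * hermite_fun n x = x ^ k * (x * hermite_fun n x)" by simp
    then show "x ^ Suc k * hermite_fun n x = hermite_jac (Suc n) * (x ^ k * hermite_fun (Suc n) x) + hermite_jac n * (x ^ k * hermite_fun (n - 1) x)"
      unfolding hermite_fun_rec by (simp add: algebra_simps)
  qed
  then show ?case
    by (simp add: add cmult Suc rapid_cmult rapid_mult_power rapid_hermite_fun)
qed (simp add: zero)

lemma hermite_complete_real:
  fixes g :: "real \<Rightarrow> real"
  assumes g: "g \<in> borel_measurable borel" "integrable lborel (\<lambda>x. (g x)\<^sup>2)"
    and zero: "\<And>n. (\<integral>x. g x * hermite_fun n x \<partial>lborel) = 0"
  shows "AE x in lborel. g x = 0"
proof (rule gaussian_moments_complete[OF g])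
  fix k
  note [measurable] = g(1)
  have int: "integrable lborel (\<lambda>x. g x * u x)" if "rapid u" for u
  proof -
    have "(\<lambda>x. complex_of_real (g x)) \<in> L2_space" using g by (auto simp: L2_space_def)
    from L2_mult_integrable[OF this that] have "integrable lborel (\<lambda>x. complex_of_real (g x * u x))" by simp
    then show ?thesis using complex_of_real_integrable_eq by blast
  qed
  have "(\<integral>x. g x * (x ^ k * hermite_fun 0 x) \<partial>lborel) = 0"
    by (rule hermite_span_monomial[where F = "\<lambda>u. \<integral>x. g x * u x \<partial>lborel"])
       (simp_all add: distrib_left int zero mult.left_commute)
  moreover have "g x * (x ^ k * hermite_fun 0 x) = (g x * (x ^ k * exp (- x\<^sup>2 / 2))) / sqrt (sqrt pi)" for x
    by (simp add: hermite_fun_0)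
  ultimately show "(\<integral>x. g x * (x ^ k * exp (- x\<^sup>2 / 2)) \<partial>lborel) = 0" by simp
qed

lemma hermite_complete:
  assumes g: "g \<in> L2_space" and zero: "\<And>n. hermite_coeff g n = 0"
  shows "AE x in lborel. g x = 0"
proof -
  have gm [measurable]: "g \<in> borel_measurable borel" and gi: "integrable lborel (\<lambda>x. (norm (g x))\<^sup>2)"
    using g by (auto simp: L2_space_def)
  have int: "integrable lborel (\<lambda>x. g x * complex_of_real (hermite_fun n x))" for n
    by (rule L2_mult_integrable[OF g rapid_hermite_fun])
  have "AE x in lborel. Re (g x) = 0"
  proof (rule hermite_complete_real)
    show "integrable lborel (\<lambda>x. (Re (g x))\<^sup>2)"
      by (rule Bochner_Integration.integrable_bound[OF gi]) (auto simp: cmod_def)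
    show "(\<integral>x. Re (g x) * hermite_fun n x \<partial>lborel) = 0" for n
      using integral_Re[OF int[of n]] zero[of n] by (simp add: hermite_coeff_def)
  qed measurable
  moreover have "AE x in lborel. Im (g x) = 0"
  proof (rule hermite_complete_real)
    show "integrable lborel (\<lambda>x. (Im (g x))\<^sup>2)"
      by (rule Bochner_Integration.integrable_bound[OF gi]) (auto simp: cmod_def)
    show "(\<integral>x. Im (g x) * hermite_fun n x \<partial>lborel) = 0" for n
      using integral_Im[OF int[of n]] zero[of n] by (simp add: hermite_coeff_def)
  qed measurable
  ultimately show ?thesis by eventually_elim (simp add: complex_eq_iff)
qed

section \<open>Weak derivatives and smooth cutoffs\<close>

text \<open>
  Derivatives of all orders exist everywhere.
\<close>

definition smooth :: "(real \<Rightarrow> real) \<Rightarrow> bool" where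
  "smooth f \<longleftrightarrow> (\<forall>k x. (deriv ^^ k) f field_differentiable at x)"

lemma smooth_deriv: "smooth f \<Longrightarrow> smooth (deriv f)"
  unfolding smooth_def
proof (intro allI)
  fix k x assume "\<forall>k x. (deriv ^^ k) f field_differentiable at x"
  then have "(deriv ^^ Suc k) f field_differentiable at x" by blast
  then show "(deriv ^^ k) (deriv f) field_differentiable at x" by (simp add: funpow_swap1)
qed

lemma smooth_has_derivative: assumes "smooth f" shows "(f has_real_derivative deriv f x) (at x)"
proof -
  have "(deriv ^^ 0) f field_differentiable at x" using assms unfolding smooth_def by blast
  then show ?thesis by (simp add: DERIV_deriv_iff_field_differentiable)
qed

text \<open>
  Coinduction: a function is smooth if it lies in a class in which every member has a
  derivative in the class.
\<close>

lemma smoothI: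
  assumes "f \<in> S" "\<And>g. g \<in> S \<Longrightarrow> \<exists>g'\<in>S. \<forall>x. (g has_real_derivative g' x) (at x)"
  shows "smooth f"
proof -
  have "(deriv ^^ k) f \<in> S" for k
  proof (induction k)
    case (Suc k)
    obtain g' where "g' \<in> S" "\<forall>x. ((deriv ^^ k) f has_real_derivative g' x) (at x)" using assms(2)[OF Suc] by blast
    moreover from this have "deriv ((deriv ^^ k) f) = g'" by (auto intro!: DERIV_imp_deriv)
    ultimately show ?case by simp
  qed (simp add: assms(1))
  then show ?thesis unfolding smooth_def using assms(2) field_differentiable_def by meson
qed

text \<open>
  Sums of products of smooth functions, a class closed under differentiation.
\<close>

inductive_set prod_span :: "(real \<Rightarrow> real) set" where
  prod: "smooth f \<Longrightarrow> smooth g \<Longrightarrow> (\<lambda>x. f x * g x) \<in> prod_span"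
| sum: "u \<in> prod_span \<Longrightarrow> v \<in> prod_span \<Longrightarrow> (\<lambda>x. u x + v x) \<in> prod_span"

lemma prod_span_deriv: "u \<in> prod_span \<Longrightarrow> \<exists>u'\<in>prod_span. \<forall>x. (u has_real_derivative u' x) (at x)"
proof (induction rule: prod_span.induct)
  case (prod f g)
  have "(\<lambda>x. deriv f x * g x + deriv g x * f x) \<in> prod_span"
    using prod by (intro prod_span.intros smooth_deriv)
  moreover have "((\<lambda>x. f x * g x) has_real_derivative deriv f x * g x + deriv g x * f x) (at x)" for x
    using prod by (intro DERIV_mult smooth_has_derivative)
  ultimately show ?case by (intro bexI[of _ "\<lambda>x. deriv f x * g x + deriv g x * f x"]) auto
next
  case (sum u v)
  then obtain u' v' where "u' \<in> prod_span" "v' \<in> prod_span"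
    "\<And>x. (u has_real_derivative u' x) (at x)" "\<And>x. (v has_real_derivative v' x) (at x)" by blast
  then show ?case by (intro bexI[of _ "\<lambda>x. u' x + v' x"]) (auto intro: DERIV_add prod_span.sum)
qed

lemma smooth_mult: "smooth f \<Longrightarrow> smooth g \<Longrightarrow> smooth (\<lambda>x. f x * g x)"
  by (rule smoothI[OF prod_span.prod]; (assumption | erule prod_span_deriv))

lemma smooth_affine: assumes "smooth f" shows "smooth (\<lambda>x. f (c * x + d))"
proof (rule smoothI[where S = "{u. \<exists>b g. smooth g \<and> u = (\<lambda>x. b * g (c * x + d))}"])
  show "(\<lambda>x. f (c * x + d)) \<in> {u. \<exists>b g. smooth g \<and> u = (\<lambda>x. b * g (c * x + d))}"
    using assms by (auto intro!: exI[of _ 1] exI[of _ f])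
  fix u assume "u \<in> {u. \<exists>b g. smooth g \<and> u = (\<lambda>x. b * g (c * x + d))}"
  then obtain b g where g: "smooth g" "u = (\<lambda>x. b * g (c * x + d))" by blast
  have "(u has_real_derivative (b * c) * deriv g (c * x + d)) (at x)" for x
    unfolding g(2) by (rule DERIV_cong[OF DERIV_cmult[OF DERIV_chain2[OF smooth_has_derivative[OF g(1)]]]])
      (auto intro!: derivative_eq_intros)
  then show "\<exists>u'\<in>{u. \<exists>b g. smooth g \<and> u = (\<lambda>x. b * g (c * x + d))}. \<forall>x. (u has_real_derivative u' x) (at x)"
    using smooth_deriv[OF g(1)] by (intro bexI[of _ "\<lambda>x. (b * c) * deriv g (c * x + d)"]) blast+
qed

text \<open>
  The functions \<open>p (1 / x) exp (- 1 / x)\<close> for \<open>x > 0\<close>, extended by zero; the class is closed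
  under differentiation, also at the origin.
\<close>

definition flat_fun :: "real poly \<Rightarrow> real \<Rightarrow> real" where
  "flat_fun p x = (if x > 0 then poly p (1 / x) * exp (- (1 / x)) else 0)"

lemma poly_exp_tendsto_0: "((\<lambda>x::real. poly p x * exp (- x)) \<longlongrightarrow> 0) at_top"
proof (induction p rule: pCons_induct)
  case (pCons a p)
  have mono: "((\<lambda>x::real. x ^ k * exp (- x)) \<longlongrightarrow> 0) at_top" for k by real_asymp
  have "((\<lambda>x. \<Sum>i\<le>degree (pCons a p). coeff (pCons a p) i * (x ^ i * exp (- x))) \<longlongrightarrow> (\<Sum>i\<le>degree (pCons a p). coeff (pCons a p) i * 0)) at_top"
    by (intro tendsto_sum tendsto_mult tendsto_const mono)
  then show ?case by (simp add: poly_altdef sum_distrib_right mult.assoc)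
qed simp

lemma flat_fun_deriv:
  "(flat_fun p has_real_derivative flat_fun ([:0,0,1:] * (p - pderiv p)) x) (at x)"
proof -
  consider "x > 0" | "x < 0" | "x = 0" by linarith
  then show ?thesis
  proof cases
    case 1
    have "((\<lambda>x. poly p (1 / x) * exp (- (1 / x))) has_real_derivative
        poly (pderiv p) (1 / x) * (- 1 / x\<^sup>2) * exp (- (1 / x)) + exp (- (1 / x)) * (1 / x\<^sup>2) * poly p (1 / x)) (at x)"
    proof (rule DERIV_mult)
      show "((\<lambda>x. poly p (1 / x)) has_real_derivative poly (pderiv p) (1 / x) * (- 1 / x\<^sup>2)) (at x)"
        by (rule DERIV_chain2[OF poly_DERIV]) (use 1 in \<open>auto intro!: derivative_eq_intros simp: power2_eq_square\<close>)
      show "((\<lambda>x. exp (- (1 / x))) has_real_derivative exp (- (1 / x)) * (1 / x\<^sup>2)) (at x)"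
        using 1 by (auto intro!: derivative_eq_intros simp: power2_eq_square)
    qed
    moreover have "\<forall>\<^sub>F y in nhds x. flat_fun p y = poly p (1 / y) * exp (- (1 / y))"
      using eventually_nhds_in_open[of "{0<..}" x] 1 by (auto elim!: eventually_mono simp: flat_fun_def)
    ultimately have "(flat_fun p has_real_derivative
        poly (pderiv p) (1 / x) * (- 1 / x\<^sup>2) * exp (- (1 / x)) + exp (- (1 / x)) * (1 / x\<^sup>2) * poly p (1 / x)) (at x)"
      by (subst DERIV_cong_ev[OF refl _ refl]) auto
    moreover have "poly (pderiv p) (1 / x) * (- 1 / x\<^sup>2) * exp (- (1 / x)) + exp (- (1 / x)) * (1 / x\<^sup>2) * poly p (1 / x)
       = flat_fun ([:0,0,1:] * (p - pderiv p)) x"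
      using 1 by (simp add: flat_fun_def power2_eq_square algebra_simps)
    ultimately show ?thesis by simp
  next
    case 2
    have "\<forall>\<^sub>F y in nhds x. flat_fun p y = 0"
      using eventually_nhds_in_open[of "{..<0}" x] 2 by (auto elim!: eventually_mono simp: flat_fun_def)
    then have "(flat_fun p has_real_derivative 0) (at x)"
      by (subst DERIV_cong_ev[OF refl _ refl]) auto
    then show ?thesis using 2 by (simp add: flat_fun_def)
  next
    case 3
    have "((\<lambda>y. flat_fun p y / y) \<longlongrightarrow> 0) (at 0)"
      unfolding filterlim_at_split
    proof
      show "((\<lambda>y. flat_fun p y / y) \<longlongrightarrow> 0) (at_left 0)"
        by (rule tendsto_eventually) (auto simp: eventually_at_filter flat_fun_def)
      have "((\<lambda>y. poly (pCons 0 p) (inverse y) * exp (- inverse y)) \<longlongrightarrow> 0) (at_right 0)"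
        by (rule filterlim_compose[OF poly_exp_tendsto_0 filterlim_inverse_at_top_right])
      moreover have "\<forall>\<^sub>F y in at_right 0. poly (pCons 0 p) (inverse y) * exp (- inverse y) = flat_fun p y / y"
        by (auto simp: eventually_at_filter flat_fun_def field_simps)
      ultimately show "((\<lambda>y. flat_fun p y / y) \<longlongrightarrow> 0) (at_right 0)"
        by (rule Lim_transform_eventually)
    qed
    then show ?thesis using 3 by (simp add: DERIV_def flat_fun_def)
  qed
qed

lemma smooth_flat_fun: "smooth (flat_fun p)"
proof (rule smoothI[where S = "range flat_fun"])
  fix g assume "g \<in> range flat_fun"
  then obtain q where "g = flat_fun q" by blast
  then show "\<exists>g'\<in>range flat_fun. \<forall>x. (g has_real_derivative g' x) (at x)"
    using flat_fun_deriv[of q] by (intro bexI[of _ "flat_fun ([:0,0,1:] * (q - pderiv q))"]) simp_all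
qed simp

text \<open>
  A smooth function supported in \<open>[-1, 1]\<close>, with value \<open>1\<close> at the origin.
\<close>

definition bump :: "real \<Rightarrow> real" where
  "bump x = exp 2 * (flat_fun 1 (1 - x) * flat_fun 1 (1 + x))"

lemma smooth_const: "smooth (\<lambda>x. c)"
proof (rule smoothI[where S = "range (\<lambda>c x. c)"])
  fix g :: "real \<Rightarrow> real" assume "g \<in> range (\<lambda>c x. c)"
  then show "\<exists>g'\<in>range (\<lambda>c x. c). \<forall>x. (g has_real_derivative g' x) (at x)"
    by (intro bexI[of _ "\<lambda>x. 0"]) auto
qed auto

lemma smooth_cmult: "smooth f \<Longrightarrow> smooth (\<lambda>x. c * f x)"
  by (rule smooth_mult[OF smooth_const])

lemma smooth_bump: "smooth bump"
proof -
  have "smooth (\<lambda>x. exp 2 * (flat_fun 1 (-1 * x + 1) * flat_fun 1 (1 * x + 1)))"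
    by (intro smooth_cmult smooth_mult smooth_affine smooth_flat_fun)
  then show ?thesis unfolding bump_def by (simp add: add.commute)
qed

lemma bump_0: "bump 0 = 1"
proof -
  have "exp 2 * (exp (- 1) * exp (- 1)) = (1::real)" by (simp flip: exp_add)
  then show ?thesis by (simp add: bump_def flat_fun_def)
qed

lemma bump_outside: "\<bar>x\<bar> \<ge> 1 \<Longrightarrow> bump x = 0"
  by (auto simp: bump_def flat_fun_def)

lemma smooth_continuous: assumes "smooth f" shows "continuous_on UNIV f"
  by (rule continuous_at_imp_continuous_on) (intro ballI DERIV_isCont[OF smooth_has_derivative[OF assms]])

lemma compact_support_bounded:
  fixes u :: "real \<Rightarrow> real"
  assumes "continuous_on UNIV u" "\<And>x. \<bar>x\<bar> > 1 \<Longrightarrow> u x = 0"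
  shows "\<exists>B\<ge>0. \<forall>x. \<bar>u x\<bar> \<le> B"
proof -
  have "compact (u ` {-1..1})" using assms(1) by (intro compact_continuous_image) (auto intro: continuous_on_subset)
  then have "bounded (u ` {-1..1})" by (rule compact_imp_bounded)
  then obtain B where B: "B > 0" "\<forall>x\<in>{-1..1}. \<bar>u x\<bar> \<le> B" unfolding bounded_pos by auto
  have "\<bar>u x\<bar> \<le> B" for x
  proof (cases "\<bar>x\<bar> > 1")
    case False
    then have "x \<in> {-1..1}" by auto
    then show ?thesis using B(2) by blast
  qed (use B assms(2)[of x] in simp)
  then show ?thesis using B(1) by (intro exI[of _ B]) auto
qed

lemma deriv_bump_outside: "\<bar>x\<bar> > 1 \<Longrightarrow> deriv bump x = 0"
proof -
  assume x: "\<bar>x\<bar> > 1"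
  have "open {x::real. \<bar>x\<bar> > 1}" by (intro open_Collect_less continuous_intros)
  then have "\<forall>\<^sub>F y in nhds x. bump y = 0"
    using eventually_nhds_in_open[of "{x. \<bar>x\<bar> > 1}" x] x by (auto elim!: eventually_mono simp: bump_outside)
  then have "(bump has_real_derivative 0) (at x)"
    by (subst DERIV_cong_ev[OF refl _ refl]) auto
  then show ?thesis by (rule DERIV_imp_deriv)
qed

lemma bump_bounded: "\<exists>B\<ge>0. \<forall>x. \<bar>bump x\<bar> \<le> B"
  by (rule compact_support_bounded[OF smooth_continuous[OF smooth_bump]]) (simp add: bump_outside)

lemma deriv_bump_bounded: "\<exists>B\<ge>0. \<forall>x. \<bar>deriv bump x\<bar> \<le> B"
  by (rule compact_support_bounded[OF smooth_continuous[OF smooth_deriv[OF smooth_bump]]]) (rule deriv_bump_outside)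

text \<open>
  A weak derivative of order \<open>k + 1\<close> is a first weak derivative of the one of order \<open>k\<close>,
  since derivatives of test functions are test functions.
\<close>

lemma weak_deriv_step:
  assumes "weak_deriv k f g" "weak_deriv (Suc k) f g'" "\<phi> \<in> test_functions"
  shows "(\<integral>x. g x * complex_of_real (deriv \<phi> x) \<partial>lborel) = - (\<integral>x. g' x * complex_of_real (\<phi> x) \<partial>lborel)"
proof -
  have sm: "smooth \<phi>" using assms(3) by (simp add: test_functions_def smooth_def)
  obtain R where R: "\<forall>x. \<bar>x\<bar> > R \<longrightarrow> \<phi> x = 0" using assms(3) by (auto simp: test_functions_def)
  have "deriv \<phi> x = 0" if "\<bar>x\<bar> > R" for x
  proof -
    have "open {x::real. \<bar>x\<bar> > R}" by (intro open_Collect_less continuous_intros)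
    then have "\<forall>\<^sub>F y in nhds x. \<phi> y = 0"
      using eventually_nhds_in_open[of "{x. \<bar>x\<bar> > R}" x] that R by (auto elim!: eventually_mono)
    then have "(\<phi> has_real_derivative 0) (at x)"
      by (subst DERIV_cong_ev[OF refl _ refl]) auto
    then show ?thesis by (rule DERIV_imp_deriv)
  qed
  then have "deriv \<phi> \<in> test_functions"
    using smooth_deriv[OF sm] unfolding test_functions_def smooth_def by blast
  then have "(\<integral>x. f x * complex_of_real ((deriv ^^ k) (deriv \<phi>) x) \<partial>lborel) =
        (- 1) ^ k * (\<integral>x. g x * complex_of_real (deriv \<phi> x) \<partial>lborel)"
    using assms(1) unfolding weak_deriv_def by blast
  moreover have "(\<integral>x. f x * complex_of_real ((deriv ^^ Suc k) \<phi> x) \<partial>lborel) =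
        (- 1) ^ Suc k * (\<integral>x. g' x * complex_of_real (\<phi> x) \<partial>lborel)"
    using assms(2,3) unfolding weak_deriv_def by blast
  ultimately have "(- 1) ^ k * (\<integral>x. g x * complex_of_real (deriv \<phi> x) \<partial>lborel) =
     (- 1) ^ k * (- (\<integral>x. g' x * complex_of_real (\<phi> x) \<partial>lborel))"
    by (simp add: funpow_Suc_right del: funpow.simps)
  then show ?thesis by (simp only: mult_cancel_left) auto
qed

text \<open>
  Weak derivatives may be tested against smooth rapidly decaying functions: cut off with
  \<open>bump (x / (n + 1))\<close> and pass to the limit.
\<close>

lemma weak_deriv_rapid:
  assumes "weak_deriv k f g" "weak_deriv (Suc k) f g'" "g \<in> L2_space" "g' \<in> L2_space"
    and "smooth u" "rapid u" "rapid (deriv u)"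
  shows "(\<integral>x. g x * complex_of_real (deriv u x) \<partial>lborel) = - (\<integral>x. g' x * complex_of_real (u x) \<partial>lborel)"
proof -
  obtain B where B: "B \<ge> 0" "\<And>x. \<bar>bump x\<bar> \<le> B" using bump_bounded by blast
  obtain D where D: "D \<ge> 0" "\<And>x. \<bar>deriv bump x\<bar> \<le> D" using deriv_bump_bounded by blast
  define c where "c = (\<lambda>n::nat. 1 / (real n + 1))"
  have c: "0 < c n" "c n \<le> 1" for n by (auto simp: c_def)
  have c0: "c \<longlonglongrightarrow> 0" unfolding c_def by real_asymp
  define v where "v = (\<lambda>n x. bump (c n * x) * u x)"
  have cb: "smooth (\<lambda>x. bump (c n * x))" for n using smooth_affine[OF smooth_bump, of "c n" 0] by simp
  have vs: "smooth (v n)" for n unfolding v_def by (intro smooth_mult cb assms)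
  have vtest: "v n \<in> test_functions" for n
  proof -
    have "v n x = 0" if "\<bar>x\<bar> > 1 / c n" for x
    proof -
      have "\<bar>c n * x\<bar> \<ge> 1" using that c[of n] by (simp add: abs_mult field_simps)
      then show ?thesis by (simp add: v_def bump_outside)
    qed
    then show ?thesis using vs[of n] by (auto simp: test_functions_def smooth_def)
  qed
  have dv: "deriv (v n) x = c n * deriv bump (c n * x) * u x + bump (c n * x) * deriv u x" for n x
  proof -
    have "((\<lambda>x. bump (c n * x)) has_real_derivative deriv bump (c n * x) * c n) (at x)"
      by (rule DERIV_chain2[OF smooth_has_derivative[OF smooth_bump]]) (auto intro!: derivative_eq_intros)
    from DERIV_mult[OF this smooth_has_derivative[OF assms(5)]]
    show ?thesis unfolding v_def by (intro DERIV_imp_deriv) (simp add: mult_ac)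
  qed
  have gm [measurable]: "g \<in> borel_measurable borel" "g' \<in> borel_measurable borel" using assms(3,4) by (auto simp: L2_space_def)
  have um [measurable]: "u \<in> borel_measurable borel" "deriv u \<in> borel_measurable borel" using assms(6,7) by (auto intro: rapid_measurable)
  have bm [measurable]: "bump \<in> borel_measurable borel" "deriv bump \<in> borel_measurable borel"
    by (auto intro!: borel_measurable_continuous_onI smooth_continuous smooth_bump smooth_deriv)
  have "isCont bump 0" using smooth_continuous[OF smooth_bump] by (simp add: continuous_on_eq_continuous_at)
  have b1: "(\<lambda>n. bump (c n * x)) \<longlonglongrightarrow> 1" for x
  proof -
    have "(\<lambda>n. c n * x) \<longlonglongrightarrow> 0 * x" by (intro tendsto_mult c0 tendsto_const)
    then have "(\<lambda>n. bump (c n * x)) \<longlonglongrightarrow> bump 0"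
      using \<open>isCont bump 0\<close> by (intro isCont_tendsto_compose[of 0 bump]) auto
    then show ?thesis by (simp add: bump_0)
  qed
  have vlim: "(\<lambda>n. v n x) \<longlonglongrightarrow> u x" for x
    unfolding v_def using tendsto_mult[OF b1 tendsto_const, of x "u x"] by simp
  have dvlim: "(\<lambda>n. deriv (v n) x) \<longlonglongrightarrow> deriv u x" for x
  proof -
    have "(\<lambda>n. c n * deriv bump (c n * x)) \<longlonglongrightarrow> 0"
    proof (rule Lim_null_comparison)
      show "\<forall>\<^sub>F n in sequentially. norm (c n * deriv bump (c n * x)) \<le> c n * D"
      proof (intro always_eventually allI)
        fix n
        have "\<bar>c n\<bar> * \<bar>deriv bump (c n * x)\<bar> \<le> c n * D" using c[of n] D by (intro mult_mono) auto
        then show "norm (c n * deriv bump (c n * x)) \<le> c n * D" by (simp add: abs_mult)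
      qed
      show "(\<lambda>n. c n * D) \<longlonglongrightarrow> 0" using tendsto_mult[OF c0 tendsto_const, of D] by simp
    qed
    from tendsto_add[OF tendsto_mult[OF this tendsto_const[of "u x"]] tendsto_mult[OF b1[of x] tendsto_const[of "deriv u x"]]]
    show ?thesis unfolding dv by simp
  qed
  have L1: "(\<lambda>n. \<integral>x. g' x * complex_of_real (v n x) \<partial>lborel) \<longlonglongrightarrow> (\<integral>x. g' x * complex_of_real (u x) \<partial>lborel)"
  proof (rule integral_dominated_convergence[where w = "\<lambda>x. B * norm (g' x * complex_of_real (u x))"])
    show "integrable lborel (\<lambda>x. B * norm (g' x * complex_of_real (u x)))"
      using L2_mult_integrable[OF assms(4,6)] by (intro integrable_mult_right integrable_norm)
    show "AE x in lborel. (\<lambda>n. g' x * complex_of_real (v n x)) \<longlonglongrightarrow> g' x * complex_of_real (u x)"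
      using vlim by (auto intro!: tendsto_intros)
    show "AE x in lborel. norm (g' x * complex_of_real (v n x)) \<le> B * norm (g' x * complex_of_real (u x))" for n
    proof (rule AE_I2)
      fix x
      have "\<bar>bump (c n * x)\<bar> * (norm (g' x) * \<bar>u x\<bar>) \<le> B * (norm (g' x) * \<bar>u x\<bar>)" using B by (intro mult_right_mono) auto
      then show "norm (g' x * complex_of_real (v n x)) \<le> B * norm (g' x * complex_of_real (u x))"
        by (simp add: v_def norm_mult abs_mult mult_ac)
    qed
  qed (unfold v_def, measurable)
  have L2: "(\<lambda>n. \<integral>x. g x * complex_of_real (deriv (v n) x) \<partial>lborel) \<longlonglongrightarrow> (\<integral>x. g x * complex_of_real (deriv u x) \<partial>lborel)"
  proof (rule integral_dominated_convergence[where w = "\<lambda>x. D * norm (g x * complex_of_real (u x)) + B * norm (g x * complex_of_real (deriv u x))"])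
    show "integrable lborel (\<lambda>x. D * norm (g x * complex_of_real (u x)) + B * norm (g x * complex_of_real (deriv u x)))"
      using L2_mult_integrable[OF assms(3,6)] L2_mult_integrable[OF assms(3,7)]
      by (intro Bochner_Integration.integrable_add integrable_mult_right integrable_norm)
    show "AE x in lborel. (\<lambda>n. g x * complex_of_real (deriv (v n) x)) \<longlonglongrightarrow> g x * complex_of_real (deriv u x)"
      using dvlim by (auto intro!: tendsto_intros)
    show "AE x in lborel. norm (g x * complex_of_real (deriv (v n) x)) \<le> D * norm (g x * complex_of_real (u x)) + B * norm (g x * complex_of_real (deriv u x))" for n
    proof (rule AE_I2)
      fix x
      have "\<bar>deriv (v n) x\<bar> \<le> \<bar>c n * deriv bump (c n * x)\<bar> * \<bar>u x\<bar> + \<bar>bump (c n * x)\<bar> * \<bar>deriv u x\<bar>"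
        unfolding dv by (rule order_trans[OF abs_triangle_ineq]) (simp add: abs_mult)
      also have "\<dots> \<le> D * \<bar>u x\<bar> + B * \<bar>deriv u x\<bar>"
      proof (intro add_mono mult_right_mono B)
        have "\<bar>c n\<bar> * \<bar>deriv bump (c n * x)\<bar> \<le> 1 * D" using c[of n] D by (intro mult_mono) auto
        then show "\<bar>c n * deriv bump (c n * x)\<bar> \<le> D" by (simp add: abs_mult)
      qed auto
      finally have "norm (g x) * \<bar>deriv (v n) x\<bar> \<le> norm (g x) * (D * \<bar>u x\<bar> + B * \<bar>deriv u x\<bar>)" by (intro mult_left_mono) auto
      then show "norm (g x * complex_of_real (deriv (v n) x)) \<le> D * norm (g x * complex_of_real (u x)) + B * norm (g x * complex_of_real (deriv u x))"
        by (simp add: norm_mult algebra_simps)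
    qed
    show "(\<lambda>x. g x * complex_of_real (deriv (v n) x)) \<in> borel_measurable lborel" for n unfolding dv by measurable
  qed measurable
  have "(\<integral>x. g x * complex_of_real (deriv (v n) x) \<partial>lborel) = - (\<integral>x. g' x * complex_of_real (v n x) \<partial>lborel)" for n
    by (rule weak_deriv_step[OF assms(1,2) vtest])
  then show ?thesis using LIMSEQ_unique[OF L2] tendsto_minus[OF L1] by simp
qed

section \<open>Decay of the Hermite coefficients\<close>

text \<open>
  The derivative of order \<open>b\<close> of the \<open>m\<close>-th Hermite function, in the form given by
  \<open>hermite_fun_deriv\<close>.
\<close>

fun hermite_nth_deriv :: "nat \<Rightarrow> nat \<Rightarrow> real \<Rightarrow> real" where
  "hermite_nth_deriv 0 m x = hermite_fun m x"
| "hermite_nth_deriv (Suc b) m x = hermite_jac m * hermite_nth_deriv b (m - 1) x - hermite_jac (Suc m) * hermite_nth_deriv b (Suc m) x"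

lemma hermite_nth_deriv_deriv: "(hermite_nth_deriv b m has_real_derivative hermite_nth_deriv (Suc b) m x) (at x)"
proof (induction b arbitrary: m)
  case 0
  have "hermite_nth_deriv 0 m = hermite_fun m" by auto
  then show ?case using hermite_fun_deriv[of m x] by simp
next
  case (Suc b)
  have "hermite_nth_deriv (Suc b) m = (\<lambda>x. hermite_jac m * hermite_nth_deriv b (m - 1) x - hermite_jac (Suc m) * hermite_nth_deriv b (Suc m) x)" by auto
  then show ?case
    using DERIV_diff[OF DERIV_cmult[OF Suc[of "m - 1"], of "hermite_jac m"] DERIV_cmult[OF Suc[of "Suc m"], of "hermite_jac (Suc m)"]] by simp
qed

lemma deriv_hermite_nth_deriv: "deriv (hermite_nth_deriv b m) = hermite_nth_deriv (Suc b) m"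
  using hermite_nth_deriv_deriv by (intro ext DERIV_imp_deriv)

lemma rapid_hermite_nth_deriv: "rapid (hermite_nth_deriv b m)"
proof (induction b arbitrary: m)
  case 0
  have "hermite_nth_deriv 0 m = hermite_fun m" by auto
  then show ?case using rapid_hermite_fun[of m] by simp
next
  case (Suc b)
  have "hermite_nth_deriv (Suc b) m = (\<lambda>x. hermite_jac m * hermite_nth_deriv b (m - 1) x - hermite_jac (Suc m) * hermite_nth_deriv b (Suc m) x)" by auto
  then show ?case using Suc by (auto intro!: rapid_diff rapid_cmult)
qed

lemma smooth_hermite_nth_deriv: "smooth (hermite_nth_deriv b m)"
proof (rule smoothI[where S = "range (\<lambda>b. hermite_nth_deriv b m)"])
  fix g assume "g \<in> range (\<lambda>b. hermite_nth_deriv b m)"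
  then obtain b where "g = hermite_nth_deriv b m" by blast
  then show "\<exists>g'\<in>range (\<lambda>b. hermite_nth_deriv b m). \<forall>x. (g has_real_derivative g' x) (at x)"
    using hermite_nth_deriv_deriv[of b m] by (intro bexI[of _ "hermite_nth_deriv (Suc b) m"]) simp_all
qed simp

text \<open>
  The commutation rule \<open>x D\<^sup>b = D\<^sup>b x - b D\<^sup>b\<^sup>-\<^sup>1\<close>, applied to a Hermite function.
\<close>

lemma hermite_nth_deriv_mult_x:
  "x * hermite_nth_deriv b m x = hermite_jac (Suc m) * hermite_nth_deriv b (Suc m) x + hermite_jac m * hermite_nth_deriv b (m - 1) x - real b * hermite_nth_deriv (b - 1) m x"
proof (induction b arbitrary: m)
  case 0
  show ?case using hermite_fun_rec[of x m] by simp
next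
  case (Suc b)
  define D where "D = hermite_nth_deriv b"
  define E where "E = hermite_nth_deriv (b - 1)"
  have bE: "real b * (hermite_jac m * E (m - 1) x - hermite_jac (Suc m) * E (Suc m) x) = real b * D m x"
    by (cases b) (auto simp: D_def E_def)
  have 1: "hermite_jac m * (x * D (m - 1) x) = hermite_jac m * (hermite_jac m * D m x + hermite_jac (m - 1) * D (m - 1 - 1) x - real b * E (m - 1) x)"
    using Suc[of "m - 1"] by (cases m) (auto simp: D_def E_def)
  have 2: "x * D (Suc m) x = hermite_jac (Suc (Suc m)) * D (Suc (Suc m)) x + hermite_jac (Suc m) * D m x - real b * E (Suc m) x"
    using Suc[of "Suc m"] by (auto simp: D_def E_def)
  have "x * hermite_nth_deriv (Suc b) m x = hermite_jac m * (x * D (m - 1) x) - hermite_jac (Suc m) * (x * D (Suc m) x)"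
    by (simp add: D_def algebra_simps)
  also have "\<dots> = (hermite_jac m * hermite_jac m) * D m x - (hermite_jac (Suc m) * hermite_jac (Suc m)) * D m x + hermite_jac m * hermite_jac (m - 1) * D (m - 1 - 1) x
      - hermite_jac (Suc m) * hermite_jac (Suc (Suc m)) * D (Suc (Suc m)) x - real b * (hermite_jac m * E (m - 1) x - hermite_jac (Suc m) * E (Suc m) x)"
    unfolding 1 2 by (simp add: algebra_simps)
  also have "\<dots> = - (1 / 2) * D m x + hermite_jac m * hermite_jac (m - 1) * D (m - 1 - 1) x
      - hermite_jac (Suc m) * hermite_jac (Suc (Suc m)) * D (Suc (Suc m)) x - real b * D m x"
    unfolding bE hermite_jac_sq by (simp add: field_simps)
  finally have l: "x * hermite_nth_deriv (Suc b) m x = - (1 / 2) * D m x + hermite_jac m * hermite_jac (m - 1) * D (m - 1 - 1) x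
      - hermite_jac (Suc m) * hermite_jac (Suc (Suc m)) * D (Suc (Suc m)) x - real b * D m x" .
  have "hermite_jac (Suc m) * hermite_nth_deriv (Suc b) (Suc m) x + hermite_jac m * hermite_nth_deriv (Suc b) (m - 1) x - real (Suc b) * hermite_nth_deriv (Suc b - 1) m x
    = (hermite_jac (Suc m) * hermite_jac (Suc m)) * D m x - hermite_jac (Suc m) * hermite_jac (Suc (Suc m)) * D (Suc (Suc m)) x
      + hermite_jac m * (hermite_jac (m - 1) * D (m - 1 - 1) x) - (hermite_jac m * hermite_jac m) * D m x - real (Suc b) * D m x"
    by (cases m) (simp_all add: D_def algebra_simps)
  also have "\<dots> = - (1 / 2) * D m x + hermite_jac m * hermite_jac (m - 1) * D (m - 1 - 1) x
      - hermite_jac (Suc m) * hermite_jac (Suc (Suc m)) * D (Suc (Suc m)) x - real b * D m x"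
    unfolding hermite_jac_sq by (simp add: field_simps)
  finally show ?case using l by simp
qed

text \<open>
  The case of interest is \<open>G a b m = \<integral> f x\<^sup>a D\<^sup>b \<psi>\<^sub>m\<close>.  Moving the weight to \<open>f\<close> bounds this
  by a multiple of \<open>m\<^bsup>b/2\<^esup>\<close>, moving the derivatives to \<open>f\<close> by a multiple of
  \<open>m\<^bsup>a/2\<^esup>\<close>, and hence by \<open>m\<^bsup>(a + b)/4\<^esup>\<close>; no mixed norm such as that of \<open>x\<^sup>a D\<^sup>b f\<close> is
  needed.  Writing \<open>\<psi>\<^sub>m\<^sub>+\<^sub>1\<close> as \<open>(2 (m + 1))\<^bsup>-1/2\<^esup> (x - D) \<psi>\<^sub>m\<close> loses \<open>1/4\<close> in the exponent
  through the additional \<open>x\<close> or \<open>D\<close> but gains \<open>1/2\<close>, and this can be repeated.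
\<close>

lemma ladder_decay:
  fixes G :: "nat \<Rightarrow> nat \<Rightarrow> nat \<Rightarrow> complex"
  assumes G1: "\<And>a. \<exists>C. \<forall>m. norm (G a 0 m) \<le> C"
    and G2: "\<And>a b m. G a (Suc b) m = hermite_jac m * G a b (m - 1) - hermite_jac (Suc m) * G a b (Suc m)"
    and G3: "\<And>b. \<exists>C. \<forall>m. norm (G 0 b m) \<le> C"
    and G4: "\<And>a b m. G (Suc a) b m = hermite_jac (Suc m) * G a b (Suc m) + hermite_jac m * G a b (m - 1) - real b * G a (b - 1) m"
  shows "\<exists>C. \<forall>m. norm (G 0 0 m) * (real m + 1) ^ k \<le> C"
proof -
  define q where "q = (\<lambda>m::nat. sqrt (sqrt (real m + 1)))"
  have q1: "q m \<ge> 1" for m by (simp add: q_def)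
  have q0: "q m > 0" for m using q1[of m] by linarith
  have qq: "q m * q m = sqrt (real m + 1)" for m by (simp add: q_def)
  have qmono: "q m \<le> q (Suc m)" "q (m - 1) \<le> q m" for m by (auto simp: q_def)
  have q2: "q (Suc m) \<le> 2 * q m" for m
  proof -
    have "q (Suc m) \<le> sqrt (sqrt (16 * (real m + 1)))" unfolding q_def by (intro real_sqrt_le_mono) auto
    also have "\<dots> = 2 * q m"
    proof -
      have "sqrt 16 = (4::real)" "sqrt 4 = (2::real)" by (rule real_sqrt_unique; simp)+
      then show ?thesis by (simp only: real_sqrt_mult q_def)
    qed
    finally show ?thesis .
  qed
  have hBle: "hermite_jac (Suc m) \<le> q m ^ 2" "hermite_jac m \<le> q m ^ 2" for m
    by (auto simp: power2_eq_square qq hermite_jac_def intro!: real_sqrt_le_mono)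
  have hBge: "q m ^ 2 \<le> 2 * hermite_jac (Suc m)" for m
  proof -
    have "2 * hermite_jac (Suc m) = sqrt 4 * hermite_jac (Suc m)" by (simp add: real_sqrt_unique[of 2 4])
    also have "\<dots> = sqrt (2 * (real m + 1))"
    proof -
      have "sqrt 4 * sqrt (real (Suc m) / 2) = sqrt (4 * (real (Suc m) / 2))" by (simp only: real_sqrt_mult)
      also have "4 * (real (Suc m) / 2) = 2 * (real m + 1)" by simp
      finally show ?thesis by (simp only: hermite_jac_def)
    qed
    finally show ?thesis by (simp add: power2_eq_square qq)
  qed
  \<comment> \<open>one ladder step costs a factor \<open>\<surd>(m + 1) = (q m)\<^sup>2\<close>\<close>
  have up: "\<exists>C\<ge>0. \<forall>m. norm (u m) \<le> C * q m ^ (p + 2)"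
    if H: "\<And>m. norm (u m) \<le> hermite_jac m * norm (v (m - 1)) + hermite_jac (Suc m) * norm (v (Suc m)) + B * norm (w m)"
      and v: "C1 \<ge> 0" "\<forall>m. norm (v m) \<le> C1 * q m ^ p" and w: "C2 \<ge> 0" "\<forall>m. norm (w m) \<le> C2 * q m ^ p" and B: "B \<ge> 0"
    for u v w :: "nat \<Rightarrow> complex" and p C1 C2 B
  proof -
    have "norm (u m) \<le> (C1 + C1 * 2 ^ p + B * C2) * q m ^ (p + 2)" for m
    proof -
      have "hermite_jac m * norm (v (m - 1)) \<le> q m ^ 2 * (C1 * q m ^ p)"
      proof (intro mult_mono hBle)
        have "norm (v (m - 1)) \<le> C1 * q (m - 1) ^ p" using v by blast
        also have "\<dots> \<le> C1 * q m ^ p" using v qmono q0 by (intro mult_left_mono power_mono) (auto intro: less_imp_le)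
        finally show "norm (v (m - 1)) \<le> C1 * q m ^ p" .
      qed auto
      moreover have "hermite_jac (Suc m) * norm (v (Suc m)) \<le> q m ^ 2 * (C1 * 2 ^ p * q m ^ p)"
      proof (intro mult_mono hBle)
        have "norm (v (Suc m)) \<le> C1 * q (Suc m) ^ p" using v by blast
        also have "\<dots> \<le> C1 * (2 * q m) ^ p" using v q2 q0 by (intro mult_left_mono power_mono) (auto intro: less_imp_le)
        finally show "norm (v (Suc m)) \<le> C1 * 2 ^ p * q m ^ p" by (simp add: power_mult_distrib)
      qed auto
      moreover have "B * norm (w m) \<le> B * (C2 * q m ^ (p + 2))"
      proof (intro mult_left_mono B)
        have "norm (w m) \<le> C2 * q m ^ p" using w by blast
        also have "\<dots> \<le> C2 * q m ^ (p + 2)" using w q1 by (intro mult_left_mono power_increasing) auto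
        finally show "norm (w m) \<le> C2 * q m ^ (p + 2)" .
      qed
      ultimately show ?thesis using H[of m] by (simp add: power_add power2_eq_square algebra_simps)
    qed
    then show ?thesis using v w B by (intro exI[of _ "C1 + C1 * 2 ^ p + B * C2"]) auto
  qed
  have Bb: "\<exists>C\<ge>0. \<forall>m. norm (G a b m) \<le> C * q m ^ (2 * b)" for a b
  proof (induction b)
    case 0
    obtain C where C: "\<forall>m. norm (G a 0 m) \<le> C" using G1 by blast
    then have "C \<ge> 0" using norm_ge_zero order_trans by blast
    then show ?case using C by auto
  next
    case (Suc b)
    then obtain C where C: "C \<ge> 0" "\<forall>m. norm (G a b m) \<le> C * q m ^ (2 * b)" by blast
    have "\<exists>C\<ge>0. \<forall>m. norm (G a (Suc b) m) \<le> C * q m ^ (2 * b + 2)"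
    proof (rule up[OF _ C C, where B = 0])
      show "norm (G a (Suc b) m) \<le> hermite_jac m * norm (G a b (m - 1)) + hermite_jac (Suc m) * norm (G a b (Suc m)) + 0 * norm (G a b m)" for m
        unfolding G2 by (rule order_trans[OF norm_triangle_ineq4]) (simp add: norm_mult)
    qed simp
    then show ?case by (simp add: algebra_simps)
  qed
  have Ba: "\<exists>C\<ge>0. \<forall>m. norm (G a b m) \<le> C * q m ^ (2 * a)" for a b
  proof (induction a arbitrary: b)
    case 0
    obtain C where C: "\<forall>m. norm (G 0 b m) \<le> C" using G3 by blast
    then have "C \<ge> 0" using norm_ge_zero order_trans by blast
    then show ?case using C by auto
  next
    case (Suc a)
    obtain C where C: "C \<ge> 0" "\<forall>m. norm (G a b m) \<le> C * q m ^ (2 * a)" using Suc by blast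
    obtain C' where C': "C' \<ge> 0" "\<forall>m. norm (G a (b - 1) m) \<le> C' * q m ^ (2 * a)" using Suc by blast
    have "\<exists>C\<ge>0. \<forall>m. norm (G (Suc a) b m) \<le> C * q m ^ (2 * a + 2)"
    proof (rule up[OF _ C C', where B = "real b"])
      fix m
      have "norm (G (Suc a) b m) \<le> norm (hermite_jac (Suc m) * G a b (Suc m)) + norm (hermite_jac m * G a b (m - 1)) + norm (real b * G a (b - 1) m)"
        unfolding G4 by (rule order_trans[OF norm_triangle_ineq4]) (intro add_right_mono norm_triangle_ineq)
      then show "norm (G (Suc a) b m) \<le> hermite_jac m * norm (G a b (m - 1)) + hermite_jac (Suc m) * norm (G a b (Suc m)) + real b * norm (G a (b - 1) m)"
        by (simp add: norm_mult)
    qed simp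
    then show ?case by (simp add: algebra_simps)
  qed
  \<comment> \<open>the smaller of the two bounds, using \<open>2 min a b \<le> a + b\<close>\<close>
  have base: "\<exists>C\<ge>0. \<forall>m. norm (G a b m) \<le> C * q m ^ (a + b)" for a b
  proof -
    obtain C where C: "C \<ge> 0" "\<forall>m. norm (G a b m) \<le> C * q m ^ (2 * min a b)"
      using Ba[of a b] Bb[of a b] by (cases "a \<le> b") (auto simp: min_def)
    have "C * q m ^ (2 * min a b) \<le> C * q m ^ (a + b)" for m
      using C q1 by (intro mult_left_mono power_increasing) auto
    then show ?thesis using C order_trans by blast
  qed
  have G5: "2 * hermite_jac (Suc m) * G a b (Suc m) = G (Suc a) b m + real b * G a (b - 1) m - G a (Suc b) m" for a b m
    unfolding G2 G4 by (simp add: algebra_simps)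
  have dec: "\<exists>C\<ge>0. \<forall>m. norm (G a b m) * q m ^ r \<le> C * q m ^ (a + b)" for a b r
  proof (induction r arbitrary: a b)
    case 0
    then show ?case using base by simp
  next
    case (Suc r)
    obtain C1 where C1: "C1 \<ge> 0" "\<forall>m. norm (G (Suc a) b m) * q m ^ r \<le> C1 * q m ^ (Suc a + b)" using Suc by blast
    obtain C2 where C2: "C2 \<ge> 0" "\<forall>m. norm (G a (b - 1) m) * q m ^ r \<le> C2 * q m ^ (a + (b - 1))" using Suc by blast
    obtain C3 where C3: "C3 \<ge> 0" "\<forall>m. norm (G a (Suc b) m) * q m ^ r \<le> C3 * q m ^ (a + Suc b)" using Suc by blast
    define C where "C = C1 + real b * C2 + C3"
    have C: "C \<ge> 0" using C1 C2 C3 by (simp add: C_def)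
    have st: "norm (G a b (Suc m)) * q m ^ Suc r \<le> C * q m ^ (a + b)" for m
    proof -
      have "q m ^ 2 * norm (G a b (Suc m)) \<le> 2 * hermite_jac (Suc m) * norm (G a b (Suc m))"
        using hBge by (intro mult_right_mono) auto
      also have "\<dots> = norm (2 * hermite_jac (Suc m) * G a b (Suc m))" by (simp add: norm_mult)
      also have "\<dots> \<le> norm (G (Suc a) b m) + real b * norm (G a (b - 1) m) + norm (G a (Suc b) m)"
        unfolding G5 by (rule order_trans[OF norm_triangle_ineq4] add_right_mono order_trans[OF norm_triangle_ineq])+ (simp add: norm_mult)
      finally have "q m ^ 2 * norm (G a b (Suc m)) * q m ^ r \<le> (norm (G (Suc a) b m) + real b * norm (G a (b - 1) m) + norm (G a (Suc b) m)) * q m ^ r"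
        using q0[of m] by (intro mult_right_mono) auto
      also have "\<dots> = norm (G (Suc a) b m) * q m ^ r + real b * (norm (G a (b - 1) m) * q m ^ r) + norm (G a (Suc b) m) * q m ^ r"
        by (simp add: algebra_simps)
      also have "\<dots> \<le> C1 * q m ^ (Suc a + b) + real b * (C2 * q m ^ (a + (b - 1))) + C3 * q m ^ (a + Suc b)"
        using C1 C2 C3 by (intro add_mono mult_left_mono) auto
      also have "\<dots> \<le> C1 * q m ^ (Suc a + b) + real b * (C2 * q m ^ (Suc a + b)) + C3 * q m ^ (Suc a + b)"
      proof -
        have "q m ^ (a + (b - 1)) \<le> q m ^ (Suc a + b)" using q1[of m] by (intro power_increasing) auto
        then have "real b * (C2 * q m ^ (a + (b - 1))) \<le> real b * (C2 * q m ^ (Suc a + b))"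
          using C2(1) by (intro mult_left_mono) auto
        moreover have "a + Suc b = Suc a + b" by simp
        ultimately show ?thesis by (simp only: add_le_cancel_left add_le_cancel_right)
      qed
      also have "\<dots> = q m * (C * q m ^ (a + b))" by (simp add: C_def algebra_simps)
      finally have "q m * (norm (G a b (Suc m)) * q m ^ Suc r) \<le> q m * (C * q m ^ (a + b))"
        by (simp add: power2_eq_square mult_ac)
      then show ?thesis using q0[of m] by (simp only: mult_le_cancel_left_pos)
    qed
    define K where "K = norm (G a b 0) + 2 ^ Suc r * C"
    have "norm (G a b m) * q m ^ Suc r \<le> K * q m ^ (a + b)" for m
    proof (cases m)
      case 0
      have "q 0 = 1" by (simp add: q_def)
      then show ?thesis using 0 C by (simp add: K_def)
    next
      case (Suc n)
      have "norm (G a b (Suc n)) * q (Suc n) ^ Suc r \<le> norm (G a b (Suc n)) * (2 * q n) ^ Suc r"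
        using q2 q0 by (intro mult_left_mono power_mono) (auto intro: less_imp_le)
      also have "\<dots> = 2 ^ Suc r * (norm (G a b (Suc n)) * q n ^ Suc r)" by (simp only: power_mult_distrib mult_ac)
      also have "\<dots> \<le> 2 ^ Suc r * (C * q n ^ (a + b))" using st by (intro mult_left_mono) auto
      also have "\<dots> \<le> K * q (Suc n) ^ (a + b)" unfolding mult.assoc[symmetric] K_def
        using C qmono q0 by (intro mult_mono power_mono) (auto intro: less_imp_le)
      finally show ?thesis using Suc by simp
    qed
    then show ?case using C by (intro exI[of _ K]) (auto simp: K_def)
  qed
  obtain C where C: "\<forall>m. norm (G 0 0 m) * q m ^ (4 * k) \<le> C * q m ^ (0 + 0)" using dec[of 0 0 "4 * k"] by blast
  have "q m ^ (4 * k) = (real m + 1) ^ k" for m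
  proof -
    have "q m ^ 4 = (q m * q m) * (q m * q m)" by (simp add: eval_nat_numeral)
    also have "\<dots> = real m + 1" unfolding qq by simp
    finally show ?thesis by (simp add: power_mult)
  qed
  then show ?thesis using C by auto
qed

lemma Sigma_weighted_L2:
  assumes "f \<in> Sigma_space a"
  shows "(\<lambda>x. f x * complex_of_real (x ^ a)) \<in> L2_space"
proof -
  have f: "f \<in> borel_measurable borel" and w: "integrable lborel (\<lambda>x. (norm (complex_of_real (jbracket x ^ a) * f x))\<^sup>2)"
    using assms by (auto simp: Sigma_space_def Sobolev_space_def L2_space_def)
  note [measurable] = f
  have "integrable lborel (\<lambda>x. (norm (f x * complex_of_real (x ^ a)))\<^sup>2)"
  proof (rule Bochner_Integration.integrable_bound[OF w])
    have "norm ((norm (f x * complex_of_real (x ^ a)))\<^sup>2) \<le> norm ((norm (complex_of_real (jbracket x ^ a) * f x))\<^sup>2)" for x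
    proof -
      have le: "\<bar>x\<bar> \<le> jbracket x" unfolding jbracket_def by (rule real_le_rsqrt) simp
      then have "\<bar>x\<bar> ^ a \<le> jbracket x ^ a" by (intro power_mono) auto
      moreover have "\<bar>jbracket x\<bar> = jbracket x" using le by linarith
      ultimately have "\<bar>x ^ a\<bar> \<le> \<bar>jbracket x ^ a\<bar>" by (simp add: power_abs)
      then have "norm (f x) * \<bar>x ^ a\<bar> \<le> \<bar>jbracket x ^ a\<bar> * norm (f x)" by (simp add: mult.commute mult_left_mono)
      then have "norm (f x * complex_of_real (x ^ a)) \<le> norm (complex_of_real (jbracket x ^ a) * f x)"
        by (simp only: norm_mult norm_of_real)
      then show ?thesis by (simp add: power_mono)
    qed
    then show "AE x in lborel. norm ((norm (f x * complex_of_real (x ^ a)))\<^sup>2) \<le> norm ((norm (complex_of_real (jbracket x ^ a) * f x))\<^sup>2)" by simp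
  qed measurable
  then show ?thesis by (simp add: L2_space_def)
qed

lemma hermite_coeff_decay:
  assumes f: "\<forall>n. f \<in> Sigma_space n"
  shows "\<exists>C. \<forall>m. norm (hermite_coeff f m) * (real m + 1) ^ k \<le> C"
proof -
  define G where "G = (\<lambda>a b m. \<integral>x. f x * complex_of_real (x ^ a * hermite_nth_deriv b m x) \<partial>lborel)"
  have fL2: "f \<in> L2_space" using f by (auto simp: Sigma_space_def Sobolev_space_def)
  have int: "integrable lborel (\<lambda>x. f x * complex_of_real (u x))" if "rapid u" for u
    by (rule L2_mult_integrable[OF fL2 that])
  have lin: "(\<integral>x. f x * complex_of_real (c * u x + d * v x) \<partial>lborel) =
      c * (\<integral>x. f x * complex_of_real (u x) \<partial>lborel) + d * (\<integral>x. f x * complex_of_real (v x) \<partial>lborel)"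
    if "rapid u" "rapid v" for c d u v
  proof -
    have "(\<integral>x. f x * complex_of_real (c * u x + d * v x) \<partial>lborel) =
       (\<integral>x. complex_of_real c * (f x * complex_of_real (u x)) + complex_of_real d * (f x * complex_of_real (v x)) \<partial>lborel)"
      by (simp add: algebra_simps)
    then show ?thesis using int[OF that(1)] int[OF that(2)] by simp
  qed
  have rp: "rapid (\<lambda>x. x ^ a * hermite_nth_deriv b m x)" for a b m by (rule rapid_mult_power[OF rapid_hermite_nth_deriv])
  have herm: "(\<integral>x. hermite_fun m x * hermite_fun m x \<partial>lborel) = 1" for m by (simp add: hermite_gram)
  have "\<exists>C. \<forall>m. norm (G 0 0 m) * (real m + 1) ^ k \<le> C"
  proof (rule ladder_decay[where G = G])
    fix a
    define u where "u = (\<lambda>x. f x * complex_of_real (x ^ a))"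
    have u: "u \<in> L2_space" unfolding u_def using f by (intro Sigma_weighted_L2) auto
    have "norm (G a 0 m) \<le> (\<integral>x. (norm (u x))\<^sup>2 \<partial>lborel) + 1" for m
      using L2_pairing_bound[OF u rapid_hermite_fun[of m]] unfolding herm by (simp add: G_def u_def mult.assoc)
    then show "\<exists>C. \<forall>m. norm (G a 0 m) \<le> C" by blast
  next
    fix a b m
    have "x ^ a * hermite_nth_deriv (Suc b) m x = hermite_jac m * (x ^ a * hermite_nth_deriv b (m - 1) x) + (- hermite_jac (Suc m)) * (x ^ a * hermite_nth_deriv b (Suc m) x)" for x
      by (simp add: algebra_simps)
    then have "G a (Suc b) m = hermite_jac m * G a b (m - 1) + complex_of_real (- hermite_jac (Suc m)) * G a b (Suc m)"
      unfolding G_def by (simp only: lin[OF rp rp])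
    then show "G a (Suc b) m = hermite_jac m * G a b (m - 1) - hermite_jac (Suc m) * G a b (Suc m)" by simp
  next
    fix a b m
    have e: "x ^ Suc a * hermite_nth_deriv b m x = 1 * (hermite_jac (Suc m) * (x ^ a * hermite_nth_deriv b (Suc m) x) + hermite_jac m * (x ^ a * hermite_nth_deriv b (m - 1) x)) + (- real b) * (x ^ a * hermite_nth_deriv (b - 1) m x)" for x
    proof -
      have "x ^ Suc a * hermite_nth_deriv b m x = x ^ a * (x * hermite_nth_deriv b m x)" by simp
      then show ?thesis unfolding hermite_nth_deriv_mult_x by (simp add: algebra_simps)
    qed
    have "G (Suc a) b m = complex_of_real 1 * (\<integral>x. f x * complex_of_real (hermite_jac (Suc m) * (x ^ a * hermite_nth_deriv b (Suc m) x) + hermite_jac m * (x ^ a * hermite_nth_deriv b (m - 1) x)) \<partial>lborel)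
       + complex_of_real (- real b) * G a (b - 1) m"
      unfolding G_def e by (intro lin rapid_add rapid_cmult rp)
    also have "(\<integral>x. f x * complex_of_real (hermite_jac (Suc m) * (x ^ a * hermite_nth_deriv b (Suc m) x) + hermite_jac m * (x ^ a * hermite_nth_deriv b (m - 1) x)) \<partial>lborel)
       = hermite_jac (Suc m) * G a b (Suc m) + hermite_jac m * G a b (m - 1)"
      unfolding G_def by (intro lin rp)
    finally show "G (Suc a) b m = hermite_jac (Suc m) * G a b (Suc m) + hermite_jac m * G a b (m - 1) - real b * G a (b - 1) m" by simp
  next
    fix b
    have "\<forall>k. \<exists>g\<in>L2_space. weak_deriv k f g"
      using f by (auto simp: Sigma_space_def Sobolev_space_def)
    then obtain d where d: "\<And>k. d k \<in> L2_space" "\<And>k. weak_deriv k f (d k)" by metis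
    \<comment> \<open>the weak derivative of order \<open>0\<close> is \<open>f\<close> itself, so that the chain starts at \<open>f\<close>\<close>
    define e where "e = (\<lambda>k. if k = 0 then f else d k)"
    have "weak_deriv 0 f f" by (simp add: weak_deriv_def)
    then have e: "e k \<in> L2_space" "weak_deriv k f (e k)" for k
      using d[of k] fL2 by (cases "k = 0"; simp add: e_def)+
    have step: "(\<integral>x. e i x * complex_of_real (hermite_nth_deriv (Suc b) m x) \<partial>lborel) = - (\<integral>x. e (Suc i) x * complex_of_real (hermite_nth_deriv b m x) \<partial>lborel)" for i b m
      using weak_deriv_rapid[OF e(2) e(2) e(1) e(1) smooth_hermite_nth_deriv rapid_hermite_nth_deriv, of b m i] by (simp add: deriv_hermite_nth_deriv rapid_hermite_nth_deriv)
    have "norm (\<integral>x. e i x * complex_of_real (hermite_nth_deriv b m x) \<partial>lborel) = norm (\<integral>x. e (i + b) x * complex_of_real (hermite_fun m x) \<partial>lborel)" for i m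
    proof (induction b arbitrary: i)
      case (Suc b)
      then show ?case unfolding step by simp
    qed simp
    from this[of 0] have "norm (G 0 b m) \<le> (\<integral>x. (norm (e b x))\<^sup>2 \<partial>lborel) + 1" for m
      using L2_pairing_bound[OF e(1) rapid_hermite_fun[of m], of b] unfolding herm by (simp add: G_def e_def)
    then show "\<exists>C. \<forall>m. norm (G 0 b m) \<le> C" by blast
  qed
  then show ?thesis by (simp add: G_def hermite_coeff_def)
qed

section \<open>The Hermite series of the evolution\<close>

text \<open>
  The factor by which the propagator acts on the \<open>n\<close>-th mode.
\<close>

definition phase :: "real \<Rightarrow> nat \<Rightarrow> complex" where
  "phase t n = exp (- \<i> * complex_of_real (real (2 * n + 1) * t))"

lemma norm_phase [simp]: "norm (phase t n) = 1"
proof -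
  have "phase t n = exp (\<i> * complex_of_real (- (real (2 * n + 1) * t)))" by (simp add: phase_def)
  then show ?thesis by (simp only: norm_exp_i_times)
qed

lemma phase_0 [simp]: "phase 0 n = 1"
  by (simp add: phase_def)

text \<open>
  The \<open>n\<close>-th mode of \<open>e\<^bsup>-itH\<^esup> f\<close>.
\<close>

definition evol_term :: "(real \<Rightarrow> complex) \<Rightarrow> real \<Rightarrow> nat \<Rightarrow> real \<Rightarrow> complex" where
  "evol_term f t n x = hermite_coeff f n * phase t n * complex_of_real (hermite_fun n x)"

text \<open>
  The continuous representative of \<open>e\<^bsup>-itH\<^esup> f\<close>, as a pointwise sum of the Hermite series.
\<close>

definition evol :: "(real \<Rightarrow> complex) \<Rightarrow> real \<Rightarrow> real \<Rightarrow> complex" where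
  "evol f t x = (\<Sum>n. evol_term f t n x)"

lemma summable_inverse_square: "summable (\<lambda>n. 1 / (real n + 1) ^ 2)"
proof -
  have "summable (\<lambda>n. inverse (real (Suc n) ^ 2))"
    by (subst summable_Suc_iff[where f = "\<lambda>n. inverse (real n ^ 2)"]) (rule inverse_power_summable, simp)
  then show ?thesis by (simp add: inverse_eq_divide add.commute)
qed

lemma evol_term_bound:
  assumes f: "\<forall>n. f \<in> Sigma_space n"
  shows "\<exists>C\<ge>0. \<forall>t n x. norm (evol_term f t n x) * (1 + x\<^sup>2) \<le> C / (real n + 1) ^ k"
proof -
  obtain C where C: "\<forall>m. norm (hermite_coeff f m) * (real m + 1) ^ (k + 3) \<le> C"
    using hermite_coeff_decay[OF f] by blast
  have C0: "C \<ge> 0" using C[rule_format, of 0] order_trans[OF norm_ge_zero] by fastforce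
  have "norm (evol_term f t n x) * (1 + x\<^sup>2) \<le> 270 * C / (real n + 1) ^ k" for t n x
  proof -
    have "(1 + x\<^sup>2) * \<bar>hermite_fun n x\<bar> \<le> 10 * (real n + 3) ^ 3" by (rule hermite_fun_weighted_bound)
    also have "\<dots> \<le> 10 * (3 * (real n + 1)) ^ 3" by (intro mult_left_mono power_mono) auto
    also have "\<dots> = 270 * (real n + 1) ^ 3" by (simp only: power_mult_distrib) simp
    finally have b: "(1 + x\<^sup>2) * \<bar>hermite_fun n x\<bar> \<le> 270 * (real n + 1) ^ 3" .
    have "norm (evol_term f t n x) * (1 + x\<^sup>2) = norm (hermite_coeff f n) * ((1 + x\<^sup>2) * \<bar>hermite_fun n x\<bar>)"
      by (simp add: evol_term_def norm_mult)
    also have "\<dots> \<le> norm (hermite_coeff f n) * (270 * (real n + 1) ^ 3)" using b by (intro mult_left_mono) auto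
    finally have "norm (evol_term f t n x) * (1 + x\<^sup>2) * (real n + 1) ^ k \<le> norm (hermite_coeff f n) * (270 * (real n + 1) ^ 3) * (real n + 1) ^ k"
      by (intro mult_right_mono) auto
    also have "\<dots> = 270 * (norm (hermite_coeff f n) * (real n + 1) ^ (k + 3))" by (simp only: power_add mult_ac)
    also have "\<dots> \<le> 270 * C" using C by simp
    finally show ?thesis by (subst pos_le_divide_eq) auto
  qed
  then show ?thesis using C0 by (intro exI[of _ "270 * C"]) auto
qed

text \<open>
  The tail of the Hermite series is small in a weighted supremum norm, uniformly in time.
\<close>

lemma evol_tail:
  assumes f: "\<forall>n. f \<in> Sigma_space n"
  shows "\<exists>D\<ge>0. \<forall>t M x. (\<lambda>n. evol_term f t n x) sums evol f t x \<and>
     (1 + x\<^sup>2) * norm (evol f t x - (\<Sum>n<M. evol_term f t n x)) \<le> D / (real M + 1) ^ k"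
proof -
  obtain C where C: "C \<ge> 0" "\<And>t n x. norm (evol_term f t n x) * (1 + x\<^sup>2) \<le> C / (real n + 1) ^ (k + 2)"
    using evol_term_bound[OF f] by meson
  define S where "S = (\<Sum>n. 1 / (real n + 1) ^ 2)"
  have S0: "S \<ge> 0" unfolding S_def by (intro suminf_nonneg summable_inverse_square) auto
  have main: "(\<lambda>n. evol_term f t n x) sums evol f t x \<and>
     (1 + x\<^sup>2) * norm (evol f t x - (\<Sum>n<M. evol_term f t n x)) \<le> C * S / (real M + 1) ^ k" for t M x
  proof -
    have p: "1 + x\<^sup>2 \<ge> 1" by simp
    define c where "c = C / (1 + x\<^sup>2)"
    have c0: "c \<ge> 0" using C(1) p by (simp add: c_def)
    have b: "norm (evol_term f t n x) \<le> c / (real n + 1) ^ (k + 2)" for n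
    proof -
      have "norm (evol_term f t n x) \<le> (C / (real n + 1) ^ (k + 2)) / (1 + x\<^sup>2)"
        using C(2)[of t n x] by (subst pos_le_divide_eq) (auto intro: add_pos_nonneg)
      then show ?thesis by (simp add: c_def mult.commute)
    qed
    have b2: "norm (evol_term f t (n + M) x) \<le> c / (real M + 1) ^ k * (1 / (real n + 1) ^ 2)" for n M
    proof -
      have "(real M + 1) ^ k * (real n + 1) ^ 2 \<le> (real (n + M) + 1) ^ k * (real (n + M) + 1) ^ 2"
        by (intro mult_mono power_mono) auto
      also have "\<dots> = (real (n + M) + 1) ^ (k + 2)" by (simp only: power_add)
      finally have "c / (real (n + M) + 1) ^ (k + 2) \<le> c / ((real M + 1) ^ k * (real n + 1) ^ 2)"
        using c0 by (intro divide_left_mono mult_pos_pos zero_less_power) auto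
      then show ?thesis using b[of "n + M"] by simp
    qed
    have sm: "summable (\<lambda>n. c / (real M + 1) ^ k * (1 / (real n + 1) ^ 2))" for M
      by (intro summable_mult summable_inverse_square)
    have sn: "summable (\<lambda>n. norm (evol_term f t (n + M) x))" for M
      by (rule summable_comparison_test'[OF sm[of M], of 0]) (use b2 in auto)
    have s: "summable (\<lambda>n. evol_term f t n x)" using sn[of 0] by (simp add: summable_norm_cancel)
    have "evol f t x - (\<Sum>n<M. evol_term f t n x) = (\<Sum>n. evol_term f t (n + M) x)"
      unfolding evol_def by (rule suminf_minus_initial_segment[OF s, symmetric])
    then have "norm (evol f t x - (\<Sum>n<M. evol_term f t n x)) \<le> (\<Sum>n. norm (evol_term f t (n + M) x))"
      using summable_norm[OF sn[of M]] by simp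
    also have "\<dots> \<le> (\<Sum>n. c / (real M + 1) ^ k * (1 / (real n + 1) ^ 2))"
      by (intro suminf_le sn sm b2)
    also have "\<dots> = c / (real M + 1) ^ k * S" unfolding S_def by (intro suminf_mult summable_inverse_square)
    finally have "(1 + x\<^sup>2) * norm (evol f t x - (\<Sum>n<M. evol_term f t n x)) \<le> (1 + x\<^sup>2) * (c / (real M + 1) ^ k * S)"
      using p by (intro mult_left_mono) auto
    also have "\<dots> = ((1 + x\<^sup>2) * c) * S / (real M + 1) ^ k" by simp
    also have "(1 + x\<^sup>2) * c = C"
    proof -
      have "1 + x\<^sup>2 \<noteq> 0" using p by linarith
      then show ?thesis by (simp add: c_def)
    qed
    finally have "(1 + x\<^sup>2) * norm (evol f t x - (\<Sum>n<M. evol_term f t n x)) \<le> C * S / (real M + 1) ^ k" .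
    then show ?thesis using s by (simp add: evol_def summable_sums)
  qed
  show ?thesis using main C(1) S0 by (intro exI[of _ "C * S"]) auto
qed

lemma continuous_evol_term: "continuous_on UNIV (evol_term f t n)"
  unfolding evol_term_def using rapid_continuous[OF rapid_hermite_fun[of n]] by (intro continuous_intros)

lemma continuous_partial: "continuous_on UNIV (\<lambda>x. \<Sum>n<M. evol_term f t n x)"
  by (intro continuous_on_sum) (rule continuous_evol_term)

lemma evol_dist:
  assumes f: "\<forall>n. f \<in> Sigma_space n"
  shows "\<exists>D\<ge>0. \<forall>t M x. norm (evol f t x - (\<Sum>n<M. evol_term f t n x)) \<le> D / (real M + 1) * (1 / (1 + x\<^sup>2))"
proof -
  obtain D where D: "D \<ge> 0" "\<And>t M x. (1 + x\<^sup>2) * norm (evol f t x - (\<Sum>n<M. evol_term f t n x)) \<le> D / (real M + 1) ^ 1"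
    using evol_tail[OF f, of 1] by meson
  have "norm (evol f t x - (\<Sum>n<M. evol_term f t n x)) \<le> D / (real M + 1) * (1 / (1 + x\<^sup>2))" for t M x
  proof -
    have "1 + x\<^sup>2 > 0" by (simp add: add_pos_nonneg)
    then have "norm (evol f t x - (\<Sum>n<M. evol_term f t n x)) \<le> (D / (real M + 1)) / (1 + x\<^sup>2)"
      using D(2)[of x t M] by (subst pos_le_divide_eq) (auto simp: mult.commute)
    then show ?thesis by simp
  qed
  then show ?thesis using D(1) by blast
qed

lemma continuous_evol:
  assumes f: "\<forall>n. f \<in> Sigma_space n"
  shows "continuous_on UNIV (evol f t)"
proof -
  obtain D where D: "D \<ge> 0" "\<And>t M x. norm (evol f t x - (\<Sum>n<M. evol_term f t n x)) \<le> D / (real M + 1) * (1 / (1 + x\<^sup>2))"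
    using evol_dist[OF f] by meson
  have "uniform_limit UNIV (\<lambda>M x. \<Sum>n<M. evol_term f t n x) (evol f t) sequentially"
  proof (rule uniform_limitI)
    fix e :: real assume e: "e > 0"
    have "(\<lambda>M. D / (real M + 1)) \<longlonglongrightarrow> 0" by real_asymp
    then have "\<forall>\<^sub>F M in sequentially. D / (real M + 1) < e" using e by (rule order_tendstoD)
    then show "\<forall>\<^sub>F M in sequentially. \<forall>x\<in>UNIV. dist (\<Sum>n<M. evol_term f t n x) (evol f t x) < e"
    proof eventually_elim
      case (elim M)
      show ?case
      proof
        fix x
        have "dist (\<Sum>n<M. evol_term f t n x) (evol f t x) \<le> D / (real M + 1) * (1 / (1 + x\<^sup>2))"
          using D(2)[of t x M] by (simp add: dist_norm norm_minus_commute)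
        also have "\<dots> \<le> D / (real M + 1) * 1" using D(1) by (intro mult_left_mono) (auto simp: divide_le_eq_1 add_pos_nonneg)
        finally show "dist (\<Sum>n<M. evol_term f t n x) (evol f t x) < e" using elim by simp
      qed
    qed
  qed
  then show ?thesis by (rule uniform_limit_theorem[rotated]) (auto intro!: always_eventually continuous_partial)
qed

lemma L2_of_decay:
  fixes v :: "real \<Rightarrow> complex"
  assumes "continuous_on UNIV v" "\<And>x. norm (v x) \<le> d * (1 / (1 + x\<^sup>2))" "d \<ge> 0"
  shows "v \<in> L2_space" "L2_norm v \<le> d * sqrt (\<integral>x. 1 / (1 + x\<^sup>2) \<partial>lborel)"
proof -
  have [measurable]: "v \<in> borel_measurable borel" using assms(1) by (rule borel_measurable_continuous_onI)
  have b: "(norm (v x))\<^sup>2 \<le> d\<^sup>2 * (1 / (1 + x\<^sup>2))" for x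
  proof -
    have "(norm (v x))\<^sup>2 \<le> (d * (1 / (1 + x\<^sup>2)))\<^sup>2" using assms(2)[of x] by (intro power_mono) auto
    also have "\<dots> = d\<^sup>2 * ((1 / (1 + x\<^sup>2)) * (1 / (1 + x\<^sup>2)))" by (simp only: power_mult_distrib power2_eq_square[of "1 / (1 + x\<^sup>2)"])
    also have "\<dots> \<le> d\<^sup>2 * (1 / (1 + x\<^sup>2) * 1)" by (intro mult_left_mono) (auto simp: divide_le_eq_1 add_pos_nonneg)
    finally show ?thesis by simp
  qed
  have i: "integrable lborel (\<lambda>x::real. d\<^sup>2 * (1 / (1 + x\<^sup>2)))" by (intro integrable_mult_right integrable_inverse_1_plus_sq)
  have iv: "integrable lborel (\<lambda>x. (norm (v x))\<^sup>2)"
  proof (rule Bochner_Integration.integrable_bound[OF i])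
    have "norm ((norm (v x))\<^sup>2) \<le> norm (d\<^sup>2 * (1 / (1 + x\<^sup>2)))" for x
      using order_trans[OF b[of x] abs_ge_self] by simp
    then show "AE x in lborel. norm ((norm (v x))\<^sup>2) \<le> norm (d\<^sup>2 * (1 / (1 + x\<^sup>2)))" by simp
  qed measurable
  then show "v \<in> L2_space" by (simp add: L2_space_def)
  have "(\<integral>x. (norm (v x))\<^sup>2 \<partial>lborel) \<le> (\<integral>x. d\<^sup>2 * (1 / (1 + x\<^sup>2)) \<partial>lborel)"
    by (rule integral_mono[OF iv i b])
  also have "\<dots> = d\<^sup>2 * (\<integral>x. 1 / (1 + x\<^sup>2) \<partial>lborel)" by (rule integral_mult_right_zero)
  finally have "L2_norm v \<le> sqrt (d\<^sup>2 * (\<integral>x. 1 / (1 + x\<^sup>2) \<partial>lborel))" unfolding L2_norm_def by (rule real_sqrt_le_mono)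
  then show "L2_norm v \<le> d * sqrt (\<integral>x. 1 / (1 + x\<^sup>2) \<partial>lborel)" using assms(3) by (simp add: real_sqrt_mult)
qed

lemma L2_diff:
  assumes "u \<in> L2_space" "v \<in> L2_space"
  shows "(\<lambda>x. u x - v x) \<in> L2_space"
    and "(\<integral>x. (norm (u x - v x))\<^sup>2 \<partial>lborel) \<le> 2 * (\<integral>x. (norm (u x))\<^sup>2 \<partial>lborel) + 2 * (\<integral>x. (norm (v x))\<^sup>2 \<partial>lborel)"
proof -
  have [measurable]: "u \<in> borel_measurable borel" "v \<in> borel_measurable borel"
    and i: "integrable lborel (\<lambda>x. (norm (u x))\<^sup>2)" "integrable lborel (\<lambda>x. (norm (v x))\<^sup>2)"
    using assms by (auto simp: L2_space_def)
  have b: "(norm (u x - v x))\<^sup>2 \<le> 2 * (norm (u x))\<^sup>2 + 2 * (norm (v x))\<^sup>2" for x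
  proof -
    have "(norm (u x - v x))\<^sup>2 \<le> (norm (u x) + norm (v x))\<^sup>2" by (intro power_mono norm_triangle_ineq4) auto
    also have "\<dots> \<le> 2 * (norm (u x))\<^sup>2 + 2 * (norm (v x))\<^sup>2"
      using sum_squares_bound[of "norm (u x)" "norm (v x)"] by (simp add: power2_sum)
    finally show ?thesis .
  qed
  have j: "integrable lborel (\<lambda>x. 2 * (norm (u x))\<^sup>2 + 2 * (norm (v x))\<^sup>2)" using i by simp
  have k: "integrable lborel (\<lambda>x. (norm (u x - v x))\<^sup>2)"
  proof (rule Bochner_Integration.integrable_bound[OF j])
    have "norm ((norm (u x - v x))\<^sup>2) \<le> norm (2 * (norm (u x))\<^sup>2 + 2 * (norm (v x))\<^sup>2)" for x
      using order_trans[OF b[of x] abs_ge_self] by simp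
    then show "AE x in lborel. norm ((norm (u x - v x))\<^sup>2) \<le> norm (2 * (norm (u x))\<^sup>2 + 2 * (norm (v x))\<^sup>2)" by simp
  qed measurable
  then show "(\<lambda>x. u x - v x) \<in> L2_space" by (simp add: L2_space_def)
  show "(\<integral>x. (norm (u x - v x))\<^sup>2 \<partial>lborel) \<le> 2 * (\<integral>x. (norm (u x))\<^sup>2 \<partial>lborel) + 2 * (\<integral>x. (norm (v x))\<^sup>2 \<partial>lborel)"
    using integral_mono[OF k j b] i by simp
qed

text \<open>
  The set where the two functions differ is open, and a nonempty open set has positive measure.
\<close>

lemma continuous_AE_eq:
  fixes u v :: "real \<Rightarrow> complex"
  assumes "continuous_on UNIV u" "continuous_on UNIV v" "AE x in lborel. u x = v x"
  shows "u = v"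
proof (rule ccontr)
  assume "u \<noteq> v"
  define S where "S = {x. u x \<noteq> v x}"
  have S: "open S" unfolding S_def using assms(1,2) by (intro open_Collect_neq)
  have ne: "S \<noteq> {}" using \<open>u \<noteq> v\<close> by (auto simp: S_def)
  have "S \<in> sets lborel" using S by simp
  then have "S \<in> null_sets lborel"
    using assms(3) by (subst (asm) AE_iff_null_sets[of S, symmetric] | simp add: S_def AE_iff_null)+
  then have "negligible S" unfolding negligible_iff_null_sets by (rule null_sets_completionI)
  then show False using open_not_negligible[OF S ne] by blast
qed

lemma cont_rep_eq:
  assumes "continuous_on UNIV v" "AE x in lborel. g x = v x"
  shows "cont_rep g = v"
  unfolding cont_rep_def
proof (rule the_equality)
  fix w assume w: "continuous_on UNIV w \<and> (AE x in lborel. g x = w x)"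
  then have "AE x in lborel. w x = v x" using assms(2) by (auto elim: eventually_elim2)
  then show "w = v" using w assms(1) by (intro continuous_AE_eq) auto
qed (use assms in auto)

text \<open>
  The Hermite series converges in \<open>L\<^sup>2\<close> to its pointwise sum, and the limit in \<open>L\<^sup>2\<close> is
  determined almost everywhere.
\<close>

lemma cont_rep_propagator:
  assumes f: "\<forall>n. f \<in> Sigma_space n"
  shows "cont_rep (propagator t f) = evol f t"
proof -
  obtain D where D: "D \<ge> 0" "\<And>t M x. norm (evol f t x - (\<Sum>n<M. evol_term f t n x)) \<le> D / (real M + 1) * (1 / (1 + x\<^sup>2))"
    using evol_dist[OF f] by meson
  define S where "S = (\<lambda>M x. \<Sum>n<M. evol_term f t n x)"
  define I where "I = sqrt (\<integral>x. 1 / (1 + (x::real)\<^sup>2) \<partial>lborel)"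
  have c: "continuous_on UNIV (\<lambda>x. evol f t x - S M x)" for M
    unfolding S_def by (intro continuous_intros continuous_evol[OF f] continuous_partial)
  have d: "(\<lambda>x. evol f t x - S M x) \<in> L2_space" "L2_norm (\<lambda>x. evol f t x - S M x) \<le> D / (real M + 1) * I" for M
    using L2_of_decay[OF c, of M "D / (real M + 1)"] D by (auto simp: S_def I_def)
  have lim: "(\<lambda>M. L2_norm (\<lambda>x. evol f t x - S M x)) \<longlonglongrightarrow> 0"
  proof (rule Lim_null_comparison)
    show "\<forall>\<^sub>F M in sequentially. norm (L2_norm (\<lambda>x. evol f t x - S M x)) \<le> D / (real M + 1) * I"
      using d(2) by (auto simp: L2_norm_def intro!: always_eventually)
    show "(\<lambda>M. D / (real M + 1) * I) \<longlonglongrightarrow> 0" by real_asymp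
  qed
  define P where "P = (\<lambda>u. u \<in> L2_space \<and> (\<lambda>K. L2_norm (\<lambda>x. u x - S K x)) \<longlonglongrightarrow> 0)"
  have prp: "propagator t f = (SOME u. P u)"
    unfolding propagator_def P_def S_def evol_term_def phase_def ..
  have "P (evol f t)" unfolding P_def using lim d(1)[of 0] by (simp add: S_def)
  then have P: "P (propagator t f)" unfolding prp by (rule someI[of P])
  define p where "p = propagator t f"
  have pL: "p \<in> L2_space" and plim: "(\<lambda>K. L2_norm (\<lambda>x. p x - S K x)) \<longlonglongrightarrow> 0" using P by (auto simp: P_def p_def)
  have eL: "evol f t \<in> L2_space" using d(1)[of 0] by (simp add: S_def)
  have SL: "S K \<in> L2_space" for K
    using L2_diff(1)[OF eL d(1)[of K]] by simp
  define J where "J = (\<integral>x. (norm (p x - evol f t x))\<^sup>2 \<partial>lborel)"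
  have sq: "(\<integral>x. (norm (w x))\<^sup>2 \<partial>lborel) = (L2_norm w)\<^sup>2" for w by (simp add: L2_norm_def)
  have "J \<le> 2 * (L2_norm (\<lambda>x. p x - S K x))\<^sup>2 + 2 * (L2_norm (\<lambda>x. evol f t x - S K x))\<^sup>2" for K
    using L2_diff(2)[OF L2_diff(1)[OF pL SL[of K]] d(1)[of K]] by (simp add: J_def sq)
  moreover have "(\<lambda>K. 2 * (L2_norm (\<lambda>x. p x - S K x))\<^sup>2 + 2 * (L2_norm (\<lambda>x. evol f t x - S K x))\<^sup>2) \<longlonglongrightarrow> 2 * 0\<^sup>2 + 2 * 0\<^sup>2"
    by (intro tendsto_intros plim lim)
  ultimately have "J \<le> 2 * 0\<^sup>2 + 2 * 0\<^sup>2" by (intro LIMSEQ_le_const) auto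
  then have "J \<le> 0" by simp
  moreover have "J \<ge> 0" by (simp add: J_def)
  ultimately have "J = 0" by simp
  moreover have "integrable lborel (\<lambda>x. (norm (p x - evol f t x))\<^sup>2)" using L2_diff(1)[OF pL eL] by (simp add: L2_space_def)
  ultimately have "AE x in lborel. (norm (p x - evol f t x))\<^sup>2 = 0"
    unfolding J_def by (subst (asm) integral_nonneg_eq_0_iff_AE) auto
  then have "AE x in lborel. p x = evol f t x" by eventually_elim simp
  then show ?thesis unfolding p_def by (rule cont_rep_eq[OF continuous_evol[OF f]])
qed

text \<open>
  The difference of \<open>f\<close> and its Hermite series is orthogonal to all Hermite functions.
\<close>

lemma cont_rep_initial:
  assumes f: "\<forall>n. f \<in> Sigma_space n"
  shows "cont_rep f = evol f 0"
proof -
  obtain D where D: "D \<ge> 0" "\<And>t M x. norm (evol f t x - (\<Sum>n<M. evol_term f t n x)) \<le> D / (real M + 1) * (1 / (1 + x\<^sup>2))"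
    using evol_dist[OF f] by meson
  have fL: "f \<in> L2_space" using f by (auto simp: Sigma_space_def Sobolev_space_def)
  have eL: "evol f 0 \<in> L2_space"
    by (rule L2_of_decay(1)[OF continuous_evol[OF f], of 0 D]) (use D(2)[of 0 _ 0] D(1) in auto)
  have em: "evol f 0 \<in> borel_measurable borel" using eL by (simp add: L2_space_def)
  have coe: "hermite_coeff (evol f 0) k = hermite_coeff f k" for k
  proof -
    define S where "S = (\<lambda>M x. \<Sum>n<M. evol_term f 0 n x)"
    have [measurable]: "S M \<in> borel_measurable borel" for M
      unfolding S_def by (rule borel_measurable_continuous_onI[OF continuous_partial])
    note [measurable] = em rapid_measurable[OF rapid_hermite_fun[of k]]
    have dS: "norm (evol f 0 x - S M x) \<le> D / (real M + 1)" for M x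
    proof -
      have "norm (evol f 0 x - S M x) \<le> D / (real M + 1) * (1 / (1 + x\<^sup>2))" unfolding S_def by (rule D(2))
      also have "\<dots> \<le> D / (real M + 1) * 1" using D(1) by (intro mult_left_mono) (auto simp: divide_le_eq_1 add_pos_nonneg)
      finally show ?thesis by simp
    qed
    have bS: "norm (S M x) \<le> 2 * D" for M x
    proof -
      have "norm (S M x) \<le> norm (evol f 0 x) + norm (evol f 0 x - S M x)" by (metis add.commute norm_minus_commute norm_triangle_sub)
      also have "\<dots> \<le> D + D / (real M + 1)" using dS[of x 0] dS[of x M] by (intro add_mono) (auto simp: S_def)
      also have "D / (real M + 1) \<le> D / 1" using D(1) by (intro divide_left_mono) auto
      finally show ?thesis by simp
    qed
    have "(\<lambda>M. \<integral>x. S M x * complex_of_real (hermite_fun k x) \<partial>lborel) \<longlonglongrightarrow> (\<integral>x. evol f 0 x * complex_of_real (hermite_fun k x) \<partial>lborel)"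
    proof (rule integral_dominated_convergence[where w = "\<lambda>x. 2 * D * \<bar>hermite_fun k x\<bar>"])
      show "integrable lborel (\<lambda>x. 2 * D * \<bar>hermite_fun k x\<bar>)"
        by (intro integrable_mult_right integrable_abs rapid_integrable rapid_hermite_fun)
      have "(\<lambda>M. S M x) \<longlonglongrightarrow> evol f 0 x" for x
      proof -
        have "(\<lambda>M. S M x - evol f 0 x) \<longlonglongrightarrow> 0"
        proof (rule Lim_null_comparison)
          show "\<forall>\<^sub>F M in sequentially. norm (S M x - evol f 0 x) \<le> D / (real M + 1)"
            using dS[of x] by (intro always_eventually) (auto simp: norm_minus_commute)
          show "(\<lambda>M. D / (real M + 1)) \<longlonglongrightarrow> 0" by real_asymp
        qed
        then show ?thesis by (simp only: LIM_zero_iff)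
      qed
      then show "AE x in lborel. (\<lambda>M. S M x * complex_of_real (hermite_fun k x)) \<longlonglongrightarrow> evol f 0 x * complex_of_real (hermite_fun k x)"
        by (intro AE_I2 tendsto_mult tendsto_const)
      show "AE x in lborel. norm (S M x * complex_of_real (hermite_fun k x)) \<le> 2 * D * \<bar>hermite_fun k x\<bar>" for M
        using bS by (intro AE_I2) (simp add: norm_mult mult_right_mono)
    qed measurable
    moreover have "\<forall>\<^sub>F M in sequentially. (\<integral>x. S M x * complex_of_real (hermite_fun k x) \<partial>lborel) = hermite_coeff f k"
      using eventually_gt_at_top[of k]
    proof eventually_elim
      case (elim M)
      have "(\<integral>x. S M x * complex_of_real (hermite_fun k x) \<partial>lborel) =
        (\<integral>x. (\<Sum>n<M. hermite_coeff f n * complex_of_real (hermite_fun n x * hermite_fun k x)) \<partial>lborel)"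
        by (simp add: S_def evol_term_def sum_distrib_right mult.assoc)
      also have "\<dots> = (\<Sum>n<M. hermite_coeff f n * complex_of_real (\<integral>x. hermite_fun n x * hermite_fun k x \<partial>lborel))"
        using hermite_fun_integrable_mult
        by (subst Bochner_Integration.integral_sum) (auto simp del: of_real_mult simp: integral_complex_of_real)
      also have "\<dots> = (\<Sum>n<M. if n = k then hermite_coeff f n else 0)"
        unfolding hermite_gram by (intro sum.cong) auto
      also have "\<dots> = hermite_coeff f k" using elim by simp
      finally show ?case .
    qed
    then have "(\<lambda>M. \<integral>x. S M x * complex_of_real (hermite_fun k x) \<partial>lborel) \<longlonglongrightarrow> hermite_coeff f k"
      by (rule tendsto_eventually)
    ultimately show ?thesis
      unfolding hermite_coeff_def[of "evol f 0"] by (rule LIMSEQ_unique)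
  qed
  have "AE x in lborel. f x - evol f 0 x = 0"
  proof (rule hermite_complete)
    show "(\<lambda>x. f x - evol f 0 x) \<in> L2_space" by (rule L2_diff(1)[OF fL eL])
    fix n
    have "hermite_coeff (\<lambda>x. f x - evol f 0 x) n = hermite_coeff f n - hermite_coeff (evol f 0) n"
      unfolding hermite_coeff_def left_diff_distrib
      by (intro Bochner_Integration.integral_diff L2_mult_integrable fL eL rapid_hermite_fun)
    then show "hermite_coeff (\<lambda>x. f x - evol f 0 x) n = 0" by (simp add: coe)
  qed
  then have "AE x in lborel. f x = evol f 0 x" by eventually_elim simp
  then show ?thesis by (rule cont_rep_eq[OF continuous_evol[OF f]])
qed

section \<open>Kravchuk functions\<close>

lemma linear_times_pderiv_power:
  fixes X :: "real poly"
  assumes "pderiv X = [:c:]"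
  shows "X * pderiv (X ^ j) = smult (c * real j) (X ^ j)"
proof (cases j)
  case (Suc i)
  have "X * pderiv (X ^ j) = smult (real j) (X * X ^ i) * [:c:]"
    unfolding Suc pderiv_power_Suc assms by (simp add: mult.assoc)
  also have "\<dots> = smult (c * real j) (X ^ j)" by (simp add: Suc)
  finally show ?thesis .
qed simp

text \<open>
  The polynomial \<open>P = (1 + z)\<^sup>k (1 - z)\<^sup>N\<^sup>-\<^sup>k\<close> satisfies \<open>(1 - z\<^sup>2) P' = (2 k - N - N z) P\<close>;
  comparing coefficients gives the recursion of the Kravchuk polynomials in their degree.
\<close>

lemma kravchuk_generating_coeff:
  fixes N k :: nat
  assumes "k \<le> N"
  defines "P \<equiv> [:1,1:] ^ k * [:1,-1:] ^ (N - k) :: real poly"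
  shows "coeff P 0 = 1" "coeff P 1 = 2 * real k - real N"
    "real (n + 2) * coeff P (n + 2) = (2 * real k - real N) * coeff P (n + 1) - (real N - real n) * coeff P n"
proof -
  let ?X = "[:1,1:] :: real poly" and ?Y = "[:1,-1:] :: real poly"
  have dX: "?X * pderiv (?X ^ j) = smult (1 * real j) (?X ^ j)" for j
    by (rule linear_times_pderiv_power) (simp add: pderiv_pCons)
  have dY: "?Y * pderiv (?Y ^ j) = smult (-1 * real j) (?Y ^ j)" for j
    by (rule linear_times_pderiv_power) (simp add: pderiv_pCons)
  have alg: "X * Y * (A * dB + B * dA) = Y * (X * dA) * B + X * A * (Y * dB)" for X Y A B dA dB :: "real poly"
    by (simp add: algebra_simps)
  have alg2: "Y * smult (1 * real k) A * B + X * A * smult (-1 * real (N - k)) B = (smult (real k) Y + smult (- real (N - k)) X) * (A * B)"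
    for X Y A B :: "real poly"
    by (simp add: algebra_simps)
  have "?X * ?Y * pderiv P = ?Y * (?X * pderiv (?X ^ k)) * ?Y ^ (N - k) + ?X * ?X ^ k * (?Y * pderiv (?Y ^ (N - k)))"
    unfolding P_def pderiv_mult by (rule alg)
  also have "\<dots> = (smult (real k) ?Y + smult (- real (N - k)) ?X) * P"
    unfolding dX dY P_def by (rule alg2)
  also have "smult (real k) ?Y + smult (- real (N - k)) ?X = [:2 * real k - real N, - real N:]"
    using assms by simp
  also have "?X * ?Y = [:1, 0, -1:]" by simp
  finally have eq: "[:1, 0, -1:] * pderiv P = [:2 * real k - real N, - real N:] * P" .
  show c0: "coeff P 0 = 1" unfolding P_def by (simp add: coeff_mult_0 coeff_0_power)
  have "coeff ([:1, 0, -1:] * pderiv P) 0 = coeff ([:2 * real k - real N, - real N:] * P) 0"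
    using eq by simp
  then show "coeff P 1 = 2 * real k - real N" using c0 by (simp add: coeff_mult_0 coeff_pderiv)
  have "coeff ([:1, 0, -1:] * pderiv P) (Suc n) = coeff ([:2 * real k - real N, - real N:] * P) (Suc n)"
    using eq by simp
  then show "real (n + 2) * coeff P (n + 2) = (2 * real k - real N) * coeff P (n + 1) - (real N - real n) * coeff P n"
    by (cases n) (simp_all add: coeff_pderiv algebra_simps)
qed

lemma kravchuk_poly_eq_coeff:
  assumes "k \<le> N" "h\<^sup>2 * real N = 2" "h > 0"
  shows "kravchuk_poly h n (h * (real k - real N / 2)) = h ^ n * fact n * coeff ([:1,1:] ^ k * [:1,-1:] ^ (N - k)) n"
proof (induction n rule: less_induct)
  case (less n)
  define P where "P = ([:1,1:] ^ k * [:1,-1:] ^ (N - k) :: real poly)"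
  note c = kravchuk_generating_coeff[OF assms(1), folded P_def]
  consider "n = 0" | "n = 1" | m where "n = m + 2"
    by (metis One_nat_def add_2_eq_Suc' not0_implies_Suc)
  then show ?case
  proof cases
    case 1 then show ?thesis using c by (simp flip: P_def)
  next
    case 2 then show ?thesis using c by (simp flip: P_def)
  next
    case 3
    let ?x = "h * (real k - real N / 2)"
    have e: "kravchuk_poly h (Suc (Suc m)) ?x = 2 * ?x * kravchuk_poly h (Suc m) ?x -
       2 * real (Suc m) * (1 - h\<^sup>2 * real m / 2) * kravchuk_poly h m ?x" by simp
    have i: "kravchuk_poly h (Suc m) ?x = h ^ Suc m * fact (Suc m) * coeff P (Suc m)"
      "kravchuk_poly h m ?x = h ^ m * fact m * coeff P m"
      using less[of "Suc m"] less[of m] 3 by (simp_all add: P_def)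
    have t: "2 * (1 - h\<^sup>2 * real m / 2) = h\<^sup>2 * (real N - real m)" using assms(2) by (simp add: algebra_simps)
    have "kravchuk_poly h (Suc (Suc m)) ?x = 2 * ?x * (h ^ Suc m * fact (Suc m) * coeff P (Suc m))
        - real (Suc m) * (2 * (1 - h\<^sup>2 * real m / 2)) * (h ^ m * fact m * coeff P m)"
      unfolding e i by (simp only: mult_ac)
    also have "\<dots> = h ^ (m + 2) * fact (Suc m) * ((2 * real k - real N) * coeff P (m + 1) - (real N - real m) * coeff P m)"
      unfolding t by (simp add: power2_eq_square algebra_simps)
    also have "\<dots> = h ^ (m + 2) * fact (Suc m) * (real (m + 2) * coeff P (m + 2))"
      using c(3)[of m] by simp
    finally show ?thesis unfolding 3 P_def[symmetric] by (simp add: algebra_simps)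
  qed
qed

text \<open>
  Orthogonality of the Kravchuk polynomials to the constants is the binomial theorem for
  \<open>((1 + z) + (1 - z))\<^sup>N\<close>.
\<close>

lemma kravchuk_generating_sum:
  "(\<Sum>k\<le>N. real (N choose k) * coeff ([:1,1:] ^ k * [:1,-1:] ^ (N - k)) n) = (if n = 0 then 2 ^ N else 0)"
proof -
  have "([:1,1:] + [:1,-1:] :: real poly) ^ N = (\<Sum>k\<le>N. of_nat (N choose k) * [:1,1:] ^ k * [:1,-1:] ^ (N - k))"
    by (rule binomial_ring)
  also have "([:1,1:] + [:1,-1:] :: real poly) ^ N = [:2 ^ N:]"
    by (simp add: poly_const_pow numeral_poly)
  finally have "coeff [:2 ^ N:] n = coeff (\<Sum>k\<le>N. of_nat (N choose k) * [:1,1:] ^ k * [:1,-1:] ^ (N - k) :: real poly) n"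
    by simp
  also have "\<dots> = (\<Sum>k\<le>N. real (N choose k) * coeff ([:1,1:] ^ k * [:1,-1:] ^ (N - k)) n)"
    by (simp add: coeff_sum of_nat_poly mult.assoc)
  finally show ?thesis by (cases n) auto
qed

lemma mesh_facts: assumes "N > 0" shows "mesh N > 0" "(mesh N)\<^sup>2 * real N = 2" "1 / (mesh N)\<^sup>2 = real N / 2"
proof -
  show p: "mesh N > 0" using assms by (simp add: mesh_def)
  have "(real N powr (- 1 / 2))\<^sup>2 = real N powr (-1)"
    by (simp add: power2_eq_square flip: powr_add)
  then have "(mesh N)\<^sup>2 = 2 * (1 / real N)"
  proof -
    have "(mesh N)\<^sup>2 = 2 * (real N powr (- 1 / 2))\<^sup>2" by (simp only: mesh_def power_mult_distrib) simp
    also have "\<dots> = 2 * (1 / real N)"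
      by (subst \<open>(real N powr (- 1 / 2))\<^sup>2 = real N powr (-1)\<close>) (use assms in \<open>simp add: powr_minus_divide\<close>)
    finally show ?thesis .
  qed
  then show "(mesh N)\<^sup>2 * real N = 2" "1 / (mesh N)\<^sup>2 = real N / 2" using assms by simp_all
qed

text \<open>
  The point of the lattice window with the index \<open>k\<close>, for \<open>0 \<le> k \<le> N\<close>.
\<close>

definition lattice_pt :: "nat \<Rightarrow> nat \<Rightarrow> real" where "lattice_pt N k = mesh N * (real k - real N / 2)"

lemma lattice_window_eq:
  assumes "even N" "N > 0"
  shows "lattice_window (mesh N) = lattice_pt N ` {..N}"
proof -
  define h where "h = mesh N"
  note m = mesh_facts[OF assms(2), folded h_def]
  obtain n where n: "N = 2 * n" using assms(1) by blast
  have hh: "1 / h = h * real n" using m n by (simp add: field_simps power2_eq_square)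
  show ?thesis
  proof (intro equalityI subsetI)
    fix a assume "a \<in> lattice_window (mesh N)"
    then obtain k :: int where k: "a = h * real_of_int k" "- 1 / h \<le> a" "a \<le> 1 / h"
      by (auto simp: lattice_window_def lattice_def h_def)
    have "h * - real n \<le> h * real_of_int k" "h * real_of_int k \<le> h * real n" using k hh by auto
    then have "- real n \<le> real_of_int k" "real_of_int k \<le> real n" using m(1) by (simp_all only: mult_le_cancel_left_pos)
    then have "- int n \<le> k" "k \<le> int n" by linarith+
    then have "a = lattice_pt N (nat (k + int n))" "nat (k + int n) \<le> N"
      using k n by (auto simp: lattice_pt_def h_def)
    then show "a \<in> lattice_pt N ` {..N}" by auto
  next
    fix a assume "a \<in> lattice_pt N ` {..N}"
    then obtain k where k: "k \<le> N" "a = lattice_pt N k" by auto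
    have "a = h * real_of_int (int k - int n)" using k n by (simp add: lattice_pt_def h_def)
    moreover have "h * - real n \<le> h * (real k - real n)" "h * (real k - real n) \<le> h * real n"
      by (simp_all only: mult_le_cancel_left_pos[OF m(1)]) (use k n in auto)
    moreover have "a \<in> lattice h"
      unfolding lattice_def using \<open>a = h * real_of_int (int k - int n)\<close> by (rule range_eqI)
    ultimately show "a \<in> lattice_window (mesh N)"
      using hh by (auto simp: lattice_window_def h_def)
  qed
qed

lemma lattice_pt_inj: "N > 0 \<Longrightarrow> inj_on (lattice_pt N) A"
  using mesh_facts(1)[of N] by (auto simp: inj_on_def lattice_pt_def)

lemma finite_lattice_window [simp]: "even N \<Longrightarrow> N > 0 \<Longrightarrow> finite (lattice_window (mesh N))"
  by (simp add: lattice_window_eq)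

lemma kravchuk_weight_lattice_pt:
  assumes "even N" "N > 0" "k \<le> N"
  shows "kravchuk_weight N (lattice_pt N k) = 1 / (mesh N * 2 ^ N) * real (N choose k)"
proof -
  note m = mesh_facts[OF assms(2)]
  have "1 / (mesh N)\<^sup>2 + lattice_pt N k / mesh N = real k" using m by (simp add: lattice_pt_def)
  moreover have "lattice_pt N k \<in> lattice_window (mesh N)" using assms by (auto simp: lattice_window_eq)
  ultimately show ?thesis by (simp add: kravchuk_weight_def Let_def)
qed

lemma kravchuk_weight_nonneg: "N > 0 \<Longrightarrow> kravchuk_weight N a \<ge> 0"
  using mesh_facts(1)[of N] by (simp add: kravchuk_weight_def Let_def)

text \<open>
  The off-diagonal entries of the Jacobi matrix of the Kravchuk functions.  The entry of index
  \<open>N + 1\<close> vanishes.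
\<close>

definition kravchuk_jac :: "nat \<Rightarrow> nat \<Rightarrow> real" where
  "kravchuk_jac N n = sqrt (real n / 2 * (1 - (mesh N)\<^sup>2 * (real n - 1) / 2))"

lemma kravchuk_jac_0 [simp]: "kravchuk_jac N 0 = 0" by (simp add: kravchuk_jac_def)

lemma kravchuk_jac_sq: assumes "N > 0" "n \<le> N" shows "kravchuk_jac N n * kravchuk_jac N n = real n / 2 * (1 - (mesh N)\<^sup>2 * (real n - 1) / 2)"
proof -
  have "(mesh N)\<^sup>2 * (real n - 1) \<le> (mesh N)\<^sup>2 * real N" using assms by (intro mult_left_mono) auto
  then have "(mesh N)\<^sup>2 * (real n - 1) / 2 \<le> 1" using mesh_facts[OF assms(1)] by simp
  then show ?thesis unfolding kravchuk_jac_def by (simp add: real_sqrt_mult_self)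
qed

lemma kravchuk_jac_pos: assumes "N > 0" "0 < n" "n \<le> N" shows "kravchuk_jac N n > 0"
proof -
  have "(mesh N)\<^sup>2 * (real n - 1) < (mesh N)\<^sup>2 * real N" using assms mesh_facts(1)[OF assms(1)] by (intro mult_strict_left_mono) auto
  then have "(mesh N)\<^sup>2 * (real n - 1) / 2 < 1" using mesh_facts[OF assms(1)] by simp
  then show ?thesis unfolding kravchuk_jac_def using assms by simp
qed

lemma kravchuk_normalization_Suc:
  assumes "N > 0" "n < N"
  shows "kravchuk_normalization N n = 2 * kravchuk_jac N (Suc n) * kravchuk_normalization N (Suc n)"
proof -
  define h where "h = mesh N"
  note m = mesh_facts[OF assms(1), folded h_def]
  have pos: "kravchuk_normalization N n \<ge> 0" for n using m(1) by (simp add: kravchuk_normalization_def h_def)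
  have sq: "(kravchuk_normalization N n)\<^sup>2 = (1 / (h\<^sup>2) ^ n) * (fact (N - n) / (fact N * fact n))" for n
    by (simp add: kravchuk_normalization_def power_mult_distrib power_divide h_def power_mult[symmetric] mult.commute)
  define p where "p = N - Suc n"
  have d: "N - n = Suc p" using assms by (simp add: p_def)
  define y where "y = h\<^sup>2"
  have y: "y > 0" using m(1) by (simp add: y_def)
  have "4 * (kravchuk_jac N (Suc n) * kravchuk_jac N (Suc n)) = 2 * real (Suc n) * (1 - h\<^sup>2 * real n / 2)"
    using assms by (subst kravchuk_jac_sq) (auto simp: h_def)
  also have "2 * (1 - h\<^sup>2 * real n / 2) = h\<^sup>2 * (real N - real n)" using m by (simp add: algebra_simps)
  then have "2 * real (Suc n) * (1 - h\<^sup>2 * real n / 2) = real (Suc n) * (h\<^sup>2 * (real N - real n))"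
    by (simp only: mult.assoc mult.left_commute[of 2])
  finally have k: "4 * (kravchuk_jac N (Suc n) * kravchuk_jac N (Suc n)) = h\<^sup>2 * real (Suc n) * real (N - n)"
    using assms by (simp add: of_nat_diff)
  have "(2 * kravchuk_jac N (Suc n) * kravchuk_normalization N (Suc n))\<^sup>2 =
     4 * (kravchuk_jac N (Suc n) * kravchuk_jac N (Suc n)) * (kravchuk_normalization N (Suc n))\<^sup>2"
    by (simp add: power2_eq_square)
  also have "\<dots> = (kravchuk_normalization N n)\<^sup>2"
  proof -
    define u v where "u = real (Suc n)" and "v = real (Suc p)"
    have uv: "u > 0" "v > 0" "(fact (Suc n) :: real) = u * fact n" "(fact (Suc p) :: real) = v * fact p"
      by (simp_all add: u_def v_def)
    show ?thesis
      unfolding k sq d p_def[symmetric] y_def[symmetric] u_def[symmetric] v_def[symmetric] uv(3,4) power_Suc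
      using y uv(1,2) by (simp add: field_simps)
  qed
  finally have e: "(2 * kravchuk_jac N (Suc n) * kravchuk_normalization N (Suc n))\<^sup>2 = (kravchuk_normalization N n)\<^sup>2" .
  have "0 \<le> kravchuk_jac N (Suc n)" using kravchuk_jac_pos[of N "Suc n"] assms by (intro less_imp_le) auto
  then have "0 \<le> 2 * kravchuk_jac N (Suc n) * kravchuk_normalization N (Suc n)"
    using pos[of "Suc n"] by (intro mult_nonneg_nonneg) auto
  then show ?thesis by (rule power2_eq_imp_eq[OF e[symmetric] pos])
qed

lemma kravchuk_fun_rec:
  assumes "N > 0" "n < N"
  shows "a * kravchuk_fun N n a = kravchuk_jac N (Suc n) * kravchuk_fun N (Suc n) a + kravchuk_jac N n * kravchuk_fun N (n - 1) a"
proof -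
  let ?w = "sqrt (kravchuk_weight N a)" and ?k = "\<lambda>n. kravchuk_poly (mesh N) n a"
  have r: "2 * a * ?k n = ?k (Suc n) + 4 * (kravchuk_jac N n * kravchuk_jac N n) * ?k (n - 1)"
  proof (cases n)
    case (Suc m)
    have "4 * (kravchuk_jac N n * kravchuk_jac N n) = 4 * (real n / 2 * (1 - (mesh N)\<^sup>2 * (real n - 1) / 2))"
      using assms by (subst kravchuk_jac_sq) auto
    also have "\<dots> = 2 * real (Suc m) * (1 - (mesh N)\<^sup>2 * real m / 2)" by (simp add: Suc)
    finally show ?thesis using Suc by simp
  qed simp
  have s: "kravchuk_normalization N n * (4 * (kravchuk_jac N n * kravchuk_jac N n)) * ?k (n - 1) = 2 * kravchuk_jac N n * (kravchuk_normalization N (n - 1) * ?k (n - 1))"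
  proof (cases n)
    case (Suc m)
    then show ?thesis using kravchuk_normalization_Suc[of N m] assms by simp
  qed simp
  have "2 * (a * kravchuk_fun N n a) = kravchuk_normalization N n * (2 * a * ?k n) * ?w"
    by (simp add: kravchuk_fun_def)
  also have "\<dots> = kravchuk_normalization N n * ?k (Suc n) * ?w + kravchuk_normalization N n * (4 * (kravchuk_jac N n * kravchuk_jac N n)) * ?k (n - 1) * ?w"
    unfolding r by (simp add: algebra_simps)
  also have "\<dots> = 2 * (kravchuk_jac N (Suc n) * kravchuk_fun N (Suc n) a + kravchuk_jac N n * kravchuk_fun N (n - 1) a)"
    unfolding s unfolding kravchuk_normalization_Suc[OF assms] kravchuk_fun_def by (simp add: algebra_simps)
  finally show ?thesis by simp
qed

lemma kravchuk_gram_0: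
  assumes "even N" "N > 0" "n \<le> N"
  shows "mesh N * (\<Sum>a\<in>lattice_window (mesh N). kravchuk_fun N n a * kravchuk_fun N 0 a) = (if n = 0 then 1 else 0)"
proof -
  define h where "h = mesh N"
  note m = mesh_facts[OF assms(2), folded h_def]
  have "kravchuk_fun N n (lattice_pt N k) * kravchuk_fun N 0 (lattice_pt N k) =
     kravchuk_normalization N n * h ^ n * fact n / (h * 2 ^ N) * (real (N choose k) * coeff ([:1,1:] ^ k * [:1,-1:] ^ (N - k)) n)"
    if "k \<le> N" for k
  proof -
    have w: "sqrt (kravchuk_weight N (lattice_pt N k)) * sqrt (kravchuk_weight N (lattice_pt N k)) = 1 / (h * 2 ^ N) * real (N choose k)"
      using kravchuk_weight_nonneg[OF assms(2), of "lattice_pt N k"] kravchuk_weight_lattice_pt[OF assms(1,2) that]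
      by (simp only: h_def real_sqrt_mult_self abs_of_nonneg)
    have "kravchuk_fun N n (lattice_pt N k) * kravchuk_fun N 0 (lattice_pt N k) =
       kravchuk_normalization N n * kravchuk_poly h n (lattice_pt N k) * (sqrt (kravchuk_weight N (lattice_pt N k)) * sqrt (kravchuk_weight N (lattice_pt N k)))"
      by (simp add: kravchuk_fun_def kravchuk_normalization_def[of N 0] h_def)
    also have "\<dots> = kravchuk_normalization N n * (h ^ n * fact n * coeff ([:1,1:] ^ k * [:1,-1:] ^ (N - k)) n) * (1 / (h * 2 ^ N) * real (N choose k))"
      unfolding w unfolding lattice_pt_def h_def[symmetric] kravchuk_poly_eq_coeff[OF that m(2,1)] ..
    finally show ?thesis by simp
  qed
  then have "(\<Sum>a\<in>lattice_window h. kravchuk_fun N n a * kravchuk_fun N 0 a) =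
     (\<Sum>k\<le>N. kravchuk_normalization N n * h ^ n * fact n / (h * 2 ^ N) * (real (N choose k) * coeff ([:1,1:] ^ k * [:1,-1:] ^ (N - k)) n))"
    unfolding h_def lattice_window_eq[OF assms(1,2)] by (subst sum.reindex[OF lattice_pt_inj[OF assms(2)]]) auto
  also have "\<dots> = kravchuk_normalization N n * h ^ n * fact n / (h * 2 ^ N) * (if n = 0 then 2 ^ N else 0)"
    by (simp only: sum_distrib_left[symmetric] kravchuk_generating_sum)
  finally show ?thesis using m(1) by (simp add: h_def[symmetric] kravchuk_normalization_def)
qed

lemma kravchuk_gram:
  assumes "even N" "N > 0" "n + m \<le> N"
  shows "mesh N * (\<Sum>a\<in>lattice_window (mesh N). kravchuk_fun N n a * kravchuk_fun N m a) = (if n = m then 1 else 0)"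
proof (rule jacobi_orthonormal[where b = "kravchuk_jac N" and N = N and
    E = "\<lambda>n m. mesh N * (\<Sum>a\<in>lattice_window (mesh N). kravchuk_fun N n a * kravchuk_fun N m a)"])
  fix n m :: nat assume nm: "n + m < N"
  let ?W = "lattice_window (mesh N)" and ?f = "kravchuk_fun N"
  have "kravchuk_jac N (Suc m) * (mesh N * (\<Sum>a\<in>?W. ?f n a * ?f (Suc m) a)) + kravchuk_jac N m * (mesh N * (\<Sum>a\<in>?W. ?f n a * ?f (m - 1) a))
    = mesh N * (\<Sum>a\<in>?W. ?f n a * (a * ?f m a))"
    using nm by (simp add: kravchuk_fun_rec[OF assms(2)] sum_distrib_left sum.distrib algebra_simps)
  also have "\<dots> = mesh N * (\<Sum>a\<in>?W. (a * ?f n a) * ?f m a)" by (simp add: mult_ac)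
  also have "\<dots> = kravchuk_jac N (Suc n) * (mesh N * (\<Sum>a\<in>?W. ?f (Suc n) a * ?f m a)) + kravchuk_jac N n * (mesh N * (\<Sum>a\<in>?W. ?f (n - 1) a * ?f m a))"
    using nm by (simp add: kravchuk_fun_rec[OF assms(2)] sum_distrib_left sum.distrib algebra_simps)
  finally show "kravchuk_jac N (Suc m) * (mesh N * (\<Sum>a\<in>?W. ?f n a * ?f (Suc m) a)) + kravchuk_jac N m * (mesh N * (\<Sum>a\<in>?W. ?f n a * ?f (m - 1) a))
    = kravchuk_jac N (Suc n) * (mesh N * (\<Sum>a\<in>?W. ?f (Suc n) a * ?f m a)) + kravchuk_jac N n * (mesh N * (\<Sum>a\<in>?W. ?f (n - 1) a * ?f m a))" .
next
  fix n assume "0 < n" "n \<le> N"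
  then show "kravchuk_jac N n \<noteq> 0" using kravchuk_jac_pos[OF assms(2)] by (metis less_irrefl)
qed (use assms kravchuk_gram_0 in auto)

section \<open>The ground state\<close>

text \<open>
  Each quotient \<open>(n + i + 1) / (n - i)\<close> of consecutive binomial coefficients is at most
  \<open>exp ((2 i + 1) / (n - i))\<close>, the denominators are at
  least \<open>n - j\<close>, and the first \<open>j\<close> odd numbers sum to \<open>j\<^sup>2\<close>.
\<close>

lemma binomial_central_ratio:
  assumes "j < n"
  shows "real ((2 * n) choose (n + j)) \<ge> real ((2 * n) choose n) * exp (- (real j)\<^sup>2 / real (n - j))"
proof -
  have "i \<le> j \<Longrightarrow> real ((2 * n) choose (n + i)) \<ge> real ((2 * n) choose n) * exp (- (real i)\<^sup>2 / real (n - j))" for i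
  proof (induction i)
    case (Suc i)
    have nj: "real (n - j) > 0" "real (n - j) \<le> real n - real i" using assms Suc by auto
    have "Suc (n + i) * ((2 * n) choose Suc (n + i)) = (2 * n - (n + i)) * ((2 * n) choose (n + i))"
      by (simp only: binomial_absorption binomial_absorb_comp)
    then have "real (Suc (n + i) * ((2 * n) choose Suc (n + i))) = real ((n - i) * ((2 * n) choose (n + i)))"
      by (simp del: of_nat_mult)
    then have eq: "(real n + real i + 1) * real ((2 * n) choose Suc (n + i)) = (real n - real i) * real ((2 * n) choose (n + i))"
      using Suc assms by (simp only: of_nat_mult) (simp add: of_nat_diff algebra_simps)
    define r where "r = (2 * real i + 1) / (real n - real i)"
    have pos: "real n - real i > 0" using nj by linarith
    have r: "real n + real i + 1 = (1 + r) * (real n - real i)"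
    proof -
      have "r * (real n - real i) = 2 * real i + 1" using pos by (simp add: r_def)
      then show ?thesis by (simp only: distrib_right) simp
    qed
    have "(real n - real i) * ((1 + r) * real ((2 * n) choose Suc (n + i))) = (real n - real i) * real ((2 * n) choose (n + i))"
      using eq unfolding r by (simp only: mult_ac)
    then have eq2: "(1 + r) * real ((2 * n) choose Suc (n + i)) = real ((2 * n) choose (n + i))"
      using pos by simp
    have "r \<le> (2 * real i + 1) / real (n - j)" unfolding r_def using nj by (intro divide_left_mono) auto
    have r0: "r \<ge> 0" using pos by (simp add: r_def)
    have "exp (- ((2 * real i + 1) / real (n - j))) * real ((2 * n) choose (n + i)) \<le> exp (- r) * real ((2 * n) choose (n + i))"
      using \<open>r \<le> _\<close> by (intro mult_right_mono) auto
    also have "\<dots> = (exp (- r) * (1 + r)) * real ((2 * n) choose Suc (n + i))" by (simp only: eq2[symmetric] mult.assoc)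
    also have "\<dots> \<le> 1 * real ((2 * n) choose Suc (n + i))"
    proof (intro mult_right_mono)
      have "exp (- r) * (1 + r) \<le> exp (- r) * exp r" by (intro mult_left_mono) (auto simp: exp_ge_add_one_self)
      then show "exp (- r) * (1 + r) \<le> 1" by (simp flip: exp_add)
    qed simp
    finally have s: "exp (- ((2 * real i + 1) / real (n - j))) * real ((2 * n) choose (n + i)) \<le> real ((2 * n) choose Suc (n + i))"
      by simp
    have "- (real (Suc i))\<^sup>2 / real (n - j) = - (real i)\<^sup>2 / real (n - j) + - ((2 * real i + 1) / real (n - j))"
    proof -
      have "- (real (Suc i))\<^sup>2 / d = - (real i)\<^sup>2 / d + - ((2 * real i + 1) / d)" if "d > 0" for d :: real
        using that by (simp add: field_simps power2_eq_square)
      then show ?thesis using nj(1) .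
    qed
    then have "real ((2 * n) choose n) * exp (- (real (Suc i))\<^sup>2 / real (n - j)) =
       exp (- ((2 * real i + 1) / real (n - j))) * (real ((2 * n) choose n) * exp (- (real i)\<^sup>2 / real (n - j)))"
      by (simp only: exp_add mult_ac)
    also have "\<dots> \<le> exp (- ((2 * real i + 1) / real (n - j))) * real ((2 * n) choose (n + i))"
      using Suc by (intro mult_left_mono) auto
    also note s
    finally show ?case by simp
  qed simp
  then show ?thesis by simp
qed

text \<open>
  The partial products of Wallis' product for \<open>\<pi> / 2\<close> increase, and the \<open>n\<close>-th one is the
  reciprocal of \<open>(2 n + 1) q\<^sub>n\<^sup>2\<close> for \<open>q\<^sub>n = (2 n choose n) / 4\<^sup>n\<close>.
\<close>

lemma central_binomial_lower:
  "real ((2 * n) choose n) / 4 ^ n \<ge> 1 / sqrt (pi * (real n + 1 / 2))"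
proof -
  define q where "q = (\<lambda>n. real ((2 * n) choose n) / 4 ^ n)"
  define P where "P = (\<lambda>n. \<Prod>k=1..n. (4 * real k ^ 2) / (4 * real k ^ 2 - 1))"
  have qS: "q (Suc n) = q n * (2 * real n + 1) / (2 * real n + 2)" for n
  proof -
    have a: "Suc n * ((2 * n + 1) choose Suc n) = (2 * n + 1) * ((2 * n) choose n)"
      using binomial_absorption[of n "2 * n + 1"] by simp
    have b: "Suc n * ((2 * n + 2) choose Suc n) = (2 * n + 2) * ((2 * n + 1) choose n)"
      using binomial_absorption[of n "2 * n + 2"] by simp
    have c: "(2 * n + 1) choose n = (2 * n + 1) choose Suc n"
      using binomial_symmetric[of n "2 * n + 1"] by simp
    have "Suc n * (Suc n * ((2 * n + 2) choose Suc n)) = (2 * n + 2) * ((2 * n + 1) * ((2 * n) choose n))"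
      by (simp only: b c mult.left_commute[of "Suc n" "2 * n + 2"] a)
    then have "real (Suc n * (Suc n * ((2 * n + 2) choose Suc n))) = real ((2 * n + 2) * ((2 * n + 1) * ((2 * n) choose n)))"
      by (simp only:)
    then have "(real n + 1) * ((real n + 1) * real ((2 * n + 2) choose Suc n)) = 2 * (real n + 1) * ((2 * real n + 1) * real ((2 * n) choose n))"
      by (simp only: of_nat_mult) (simp add: algebra_simps)
    then have "(real n + 1) * real ((2 * n + 2) choose Suc n) = 2 * ((2 * real n + 1) * real ((2 * n) choose n))"
      by (simp only: mult.assoc mult.left_commute[of 2]) simp
    then have d: "real ((2 * n + 2) choose Suc n) = 2 * ((2 * real n + 1) * real ((2 * n) choose n)) / (real n + 1)"
      by (simp add: eq_divide_eq mult.commute add_eq_0_iff)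
    have "q (Suc n) = real ((2 * n + 2) choose Suc n) / 4 ^ Suc n" by (simp add: q_def)
    also have "\<dots> = q n * (2 * real n + 1) / (2 * real n + 2)"
      unfolding d q_def by (simp add: divide_simps add_eq_0_iff)
    finally show ?thesis .
  qed
  have Pq: "P n * ((2 * real n + 1) * (q n)\<^sup>2) = 1" for n
  proof (induction n)
    case 0 then show ?case by (simp add: P_def q_def)
  next
    case (Suc n)
    define t where "t = 2 * real n + 2"
    have t: "t \<ge> 2" by (simp add: t_def)
    have "P (Suc n) = P n * (t\<^sup>2 / (t\<^sup>2 - 1))"
      unfolding P_def by (simp add: t_def power2_eq_square algebra_simps)
    moreover have "q (Suc n) = q n * (t - 1) / t" "2 * real (Suc n) + 1 = t + 1" using qS[of n] by (simp_all add: t_def)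
    ultimately have "P (Suc n) * ((2 * real (Suc n) + 1) * (q (Suc n))\<^sup>2) =
       P n * (t\<^sup>2 / (t\<^sup>2 - 1)) * ((t + 1) * (q n * (t - 1) / t)\<^sup>2)" by simp
    also have "\<dots> = P n * ((t - 1) * (q n)\<^sup>2) * ((t\<^sup>2 * ((t + 1) * (t - 1))) / ((t\<^sup>2 - 1) * t\<^sup>2))"
      by (simp add: power_mult_distrib power_divide power2_eq_square)
    also have "(t + 1) * (t - 1) = t\<^sup>2 - 1" by (simp add: power2_eq_square algebra_simps)
    also have "(t\<^sup>2 * (t\<^sup>2 - 1)) / ((t\<^sup>2 - 1) * t\<^sup>2) = 1"
    proof -
      have "t\<^sup>2 - 1 \<noteq> 0" using t power_mono[of 2 t 2] by auto
      then show ?thesis using t by simp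
    qed
    finally have e: "P (Suc n) * ((2 * real (Suc n) + 1) * (q (Suc n))\<^sup>2) = P n * ((t - 1) * (q n)\<^sup>2)"
      by (simp only: mult_1_right)
    have "t - 1 = 2 * real n + 1" by (simp add: t_def)
    then show ?case unfolding e using Suc by (simp only:)
  qed
  have Ppos: "P n \<ge> 0" for n unfolding P_def
  proof (intro prod_nonneg ballI)
    fix k assume "k \<in> {1..n}"
    then have "1 \<le> real k ^ 2" by (simp add: one_le_power)
    then show "0 \<le> 4 * real k ^ 2 / (4 * real k ^ 2 - 1)" by (intro divide_nonneg_nonneg) auto
  qed
  have "incseq P"
  proof (rule incseq_SucI)
    fix n
    have "1 \<le> real (Suc n) ^ 2" by (intro one_le_power) simp
    then have "1 \<le> 4 * real (Suc n) ^ 2 / (4 * real (Suc n) ^ 2 - 1)" by (subst le_divide_eq_1_pos) linarith+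
    then have "P n * 1 \<le> P n * (4 * real (Suc n) ^ 2 / (4 * real (Suc n) ^ 2 - 1))"
      using Ppos[of n] by (intro mult_left_mono) auto
    then show "P n \<le> P (Suc n)" unfolding P_def by (simp add: prod.nat_ivl_Suc')
  qed
  moreover have "P \<longlonglongrightarrow> pi / 2" using wallis by (simp add: P_def)
  ultimately have Ple: "P n \<le> pi / 2" by (rule incseq_le)
  have q0: "q n > 0" by (simp add: q_def)
  have "1 = P n * ((2 * real n + 1) * (q n)\<^sup>2)" using Pq by simp
  also have "\<dots> \<le> pi / 2 * ((2 * real n + 1) * (q n)\<^sup>2)"
    using Ple by (intro mult_right_mono) auto
  also have "\<dots> = (pi * (real n + 1 / 2)) * (q n)\<^sup>2" by (simp add: algebra_simps)
  finally have "1 \<le> sqrt ((pi * (real n + 1 / 2)) * (q n)\<^sup>2)" by simp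
  also have "\<dots> = sqrt (pi * (real n + 1 / 2)) * q n" using q0 by (simp add: real_sqrt_mult)
  finally have "1 \<le> q n * sqrt (pi * (real n + 1 / 2))" by (simp only: mult.commute)
  moreover have "0 < sqrt (pi * (real n + 1 / 2))" by (simp add: add_nonneg_pos)
  ultimately have "1 / sqrt (pi * (real n + 1 / 2)) \<le> q n" by (simp only: pos_divide_le_eq)
  then show ?thesis by (simp only: q_def)
qed

text \<open>
  Comparison with the integral of \<open>1 / (1 + x\<^sup>2)\<close>, that is, with the increments of the arctangent.
\<close>

lemma lattice_sum_bound:
  assumes "0 < h" "h \<le> 1" "finite F" "F \<subseteq> lattice h"
  shows "h * (\<Sum>a\<in>F. 1 / (1 + a\<^sup>2)) \<le> 5"
proof -
  define w where "w = (\<lambda>k::int. h / (1 + (h * real_of_int k)\<^sup>2))"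
  have w0: "w k \<ge> 0" for k using assms by (simp add: w_def add_nonneg_nonneg)
  \<comment> \<open>the function decreases on the positive axis, so its lower Riemann sums telescope against \<open>arctan\<close>\<close>
  have tel: "(\<Sum>k=1..m. w (int k)) \<le> arctan (h * real m)" for m
  proof (induction m)
    case (Suc m)
    let ?x = "h * real m" and ?y = "h * real (Suc m)"
    have xy: "?x < ?y" using assms by simp
    have "\<exists>z. ?x < z \<and> z < ?y \<and> arctan ?y - arctan ?x = (?y - ?x) * (1 / (1 + z\<^sup>2))"
      using xy by (intro MVT2) (auto intro!: derivative_eq_intros simp: inverse_eq_divide)
    then obtain z where z: "?x < z" "z < ?y" "arctan ?y - arctan ?x = (?y - ?x) * (1 / (1 + z\<^sup>2))" by blast
    have "0 \<le> ?x" using assms by simp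
    then have "z\<^sup>2 \<le> ?y\<^sup>2" using z by (intro power_mono) linarith+
    then have "1 / (1 + ?y\<^sup>2) \<le> 1 / (1 + z\<^sup>2)" by (intro divide_left_mono) (auto intro!: mult_pos_pos add_pos_nonneg)
    then have "h * (1 / (1 + ?y\<^sup>2)) \<le> h * (1 / (1 + z\<^sup>2))" using assms by (intro mult_left_mono) auto
    moreover have "?y - ?x = h" by (simp add: algebra_simps)
    ultimately have "w (int (Suc m)) \<le> arctan ?y - arctan ?x" using z by (simp add: w_def)
    then show ?case using Suc by simp
  qed simp
  have half: "(\<Sum>k=1..m. w (int k)) \<le> 2" for m
    using tel[of m] arctan_ubound[of "h * real m"] pi_less_4 by linarith
  have sym: "(\<Sum>k\<in>{- int m..int m}. w k) \<le> 5" for m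
  proof -
    have "{- int m..int m} = (\<lambda>k. - int k) ` {1..m} \<union> ({0} \<union> int ` {1..m})" (is "_ = ?A \<union> (_ \<union> ?B)")
    proof (intro equalityI subsetI)
      fix k assume k: "k \<in> {- int m..int m}"
      consider "k = 0" | "k > 0" | "k < 0" by linarith
      then show "k \<in> ?A \<union> ({0} \<union> ?B)"
      proof cases
        case 2
        then have "k = int (nat k)" "nat k \<in> {1..m}" using k by auto
        then show ?thesis by blast
      next
        case 3
        then have "k = - int (nat (-k))" "nat (-k) \<in> {1..m}" using k by auto
        then show ?thesis by blast
      qed auto
    qed auto
    then have "(\<Sum>k\<in>{- int m..int m}. w k) = sum w (?A \<union> ({0} \<union> ?B))" by simp
    also have "\<dots> = sum w ?A + (w 0 + sum w ?B)"
      by (subst sum.union_disjoint; (subst sum.union_disjoint)?) auto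
    also have "sum w ?A = (\<Sum>k=1..m. w (int k))"
      by (subst sum.reindex) (auto simp: inj_on_def w_def)
    also have "sum w ?B = (\<Sum>k=1..m. w (int k))"
      by (subst sum.reindex) (auto simp: inj_on_def)
    also have "w 0 \<le> 1" using assms by (simp add: w_def)
    finally show ?thesis using half[of m] by linarith
  qed
  obtain K where K: "F = (\<lambda>k. h * real_of_int k) ` K" "finite K"
    using assms(3,4) finite_subset_image[of F "\<lambda>k. h * real_of_int k" UNIV] unfolding lattice_def by blast
  obtain m :: nat where m: "K \<subseteq> {- int m..int m}"
  proof -
    have "\<bar>k\<bar> \<le> (\<Sum>k\<in>K. \<bar>k\<bar>)" if "k \<in> K" for k using K(2) that by (intro member_le_sum) auto
    then have "K \<subseteq> {- int (nat (\<Sum>k\<in>K. \<bar>k\<bar>))..int (nat (\<Sum>k\<in>K. \<bar>k\<bar>))}" by (auto simp: sum_nonneg abs_le_iff) (smt (verit))+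
    then show ?thesis using that by blast
  qed
  have inj: "inj_on (\<lambda>k. h * real_of_int k) K" using assms by (auto simp: inj_on_def)
  have "h * (\<Sum>a\<in>F. 1 / (1 + a\<^sup>2)) = (\<Sum>k\<in>K. w k)"
    unfolding K(1) sum.reindex[OF inj] by (simp add: sum_distrib_left w_def)
  also have "\<dots> \<le> (\<Sum>k\<in>{- int m..int m}. w k)" using m w0 by (intro sum_mono2) auto
  finally show ?thesis using sym[of m] by linarith
qed

text \<open>
  On each half-axis the Riemann sum with the larger endpoint values exceeds the integral; the
  origin is counted twice in this way, which costs \<open>h\<close>, and truncation costs another \<open>h\<close>.
\<close>

lemma gaussian_lattice_sum_lower:
  assumes "0 < h"
  shows "\<exists>m::nat. h * (\<Sum>k\<in>{- int m..int m}. exp (- (h * real_of_int k)\<^sup>2)) \<ge> sqrt pi - 2 * h"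
proof -
  define G where "G = (\<lambda>x::real. indicator {0..} x *\<^sub>R exp (- x\<^sup>2) :: real)"
  have G: "integrable lborel G" "integral\<^sup>L lborel G = sqrt pi / 2"
    using gaussian_moment_0 unfolding G_def by (auto simp: has_bochner_integral_iff)
  have lim: "((\<lambda>y. \<integral>x. indicator {..y} x *\<^sub>R G x \<partial>lborel) \<longlongrightarrow> sqrt pi / 2) at_top"
    using tendsto_integral_at_top[OF _ G(1)] G(2) by simp
  \<comment> \<open>the origin is excluded because the sum is empty for \<open>m = 0\<close>\<close>
  have pt: "indicator {..h * real m} x *\<^sub>R G x \<le> (\<Sum>k<m. exp (- (h * real k)\<^sup>2) * indicator {h * real k..h * real (Suc k)} x)" if "x \<noteq> 0" for x m
  proof (induction m)
    case 0 then show ?case using that by (auto simp: G_def split: split_indicator)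
  next
    case (Suc m)
    show ?case
    proof (cases "x \<le> h * real m")
      case True
      then have "indicator {..h * real (Suc m)} x *\<^sub>R G x = indicator {..h * real m} x *\<^sub>R G x"
        using assms by (auto split: split_indicator simp: algebra_simps)
      then show ?thesis using Suc by (simp only: sum.lessThan_Suc) (intro add_increasing2; simp)
    next
      case False
      have hm: "0 \<le> h * real m" using assms by simp
      have "indicator {..h * real (Suc m)} x *\<^sub>R G x \<le> exp (- (h * real m)\<^sup>2) * indicator {h * real m..h * real (Suc m)} x"
        using False power_mono[of "h * real m" x 2] hm by (auto simp: G_def split: split_indicator)
      moreover have "0 \<le> (\<Sum>k<m. exp (- (h * real k)\<^sup>2) * indicator {h * real k..h * real (Suc k)} x :: real)"
        by (intro sum_nonneg) auto
      ultimately show ?thesis by simp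
    qed
  qed
  have le: "(\<integral>x. indicator {..h * real m} x *\<^sub>R G x \<partial>lborel) \<le> h * (\<Sum>k<m. exp (- (h * real k)\<^sup>2))" for m
  proof -
    have "(\<integral>x. indicator {..h * real m} x *\<^sub>R G x \<partial>lborel) \<le> (\<integral>x. (\<Sum>k<m. exp (- (h * real k)\<^sup>2) * indicator {h * real k..h * real (Suc k)} x) \<partial>lborel)"
    proof (rule integral_mono_AE)
      show "integrable lborel (\<lambda>x. indicator {..h * real m} x *\<^sub>R G x)"
        using G(1) by (intro integrable_mult_indicator) auto
      show "integrable lborel (\<lambda>x. \<Sum>k<m. exp (- (h * real k)\<^sup>2) * indicator {h * real k..h * real (Suc k)} x :: real)"
        by (intro Bochner_Integration.integrable_sum integrable_mult_right integrable_real_indicator)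
           (auto simp: emeasure_lborel_Icc_eq)
      show "AE x in lborel. indicator {..h * real m} x *\<^sub>R G x \<le> (\<Sum>k<m. exp (- (h * real k)\<^sup>2) * indicator {h * real k..h * real (Suc k)} x)"
        using AE_lborel_singleton[of 0] by eventually_elim (rule pt)
    qed
    also have "\<dots> = (\<Sum>k<m. exp (- (h * real k)\<^sup>2) * h)"
      using assms by (subst Bochner_Integration.integral_sum) (auto intro!: sum.cong simp: algebra_simps)
    finally show ?thesis by (simp add: sum_distrib_left mult.commute)
  qed
  have "eventually (\<lambda>y. (\<integral>x. indicator {..y} x *\<^sub>R G x \<partial>lborel) > sqrt pi / 2 - h / 2) at_top"
    using lim assms by (intro order_tendstoD) auto
  then obtain y0 where y0: "\<And>y. y \<ge> y0 \<Longrightarrow> (\<integral>x. indicator {..y} x *\<^sub>R G x \<partial>lborel) > sqrt pi / 2 - h / 2"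
    by (auto simp: eventually_at_top_linorder)
  obtain m :: nat where m: "real m \<ge> y0 / h" using real_arch_simple by blast
  then have "h * real m \<ge> y0" using assms by (simp add: field_simps)
  then have half: "h * (\<Sum>k<m. exp (- (h * real k)\<^sup>2)) > sqrt pi / 2 - h / 2" using y0 le[of m] by fastforce
  have "2 * (\<Sum>k<m. exp (- (h * real k)\<^sup>2)) - 1 \<le> (\<Sum>k\<in>{- int m..int m}. exp (- (h * real_of_int k)\<^sup>2))"
  proof -
    let ?E = "\<lambda>k. exp (- (h * real_of_int k)\<^sup>2)"
    let ?A = "(\<lambda>k. - int k) ` ({..<m} - {0})" and ?B = "int ` {..<m}"
    have "(\<Sum>k<m. exp (- (h * real k)\<^sup>2)) + (\<Sum>k\<in>{..<m} - {0}. exp (- (h * real k)\<^sup>2)) = sum ?E ?B + sum ?E ?A"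
      by (subst (1 2) sum.reindex) (auto simp: inj_on_def)
    also have "\<dots> = sum ?E (?B \<union> ?A)" by (intro sum.union_disjoint[symmetric]) auto
    also have "\<dots> \<le> sum ?E {- int m..int m}" by (intro sum_mono2) auto
    finally have "(\<Sum>k<m. exp (- (h * real k)\<^sup>2)) + (\<Sum>k\<in>{..<m} - {0}. exp (- (h * real k)\<^sup>2)) \<le> sum ?E {- int m..int m}" .
    moreover have "(\<Sum>k<m. exp (- (h * real k)\<^sup>2)) \<le> (\<Sum>k\<in>{..<m} - {0}. exp (- (h * real k)\<^sup>2)) + 1"
    proof (cases "m = 0")
      case False
      then show ?thesis by (subst sum.remove[of _ 0]) auto
    qed simp
    ultimately show ?thesis by linarith
  qed
  then have "h * (2 * (\<Sum>k<m. exp (- (h * real k)\<^sup>2)) - 1) \<le> h * (\<Sum>k\<in>{- int m..int m}. exp (- (h * real_of_int k)\<^sup>2))"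
    using assms by (intro mult_left_mono) auto
  with half assms have "sqrt pi - 2 * h \<le> h * (\<Sum>k\<in>{- int m..int m}. exp (- (h * real_of_int k)\<^sup>2))"
    by (simp add: algebra_simps)
  then show ?thesis by blast
qed

text \<open>
  A one-sided local limit theorem with rate.  For \<open>\<bar>a\<bar>\<^sup>3 h \<ge> 1\<close> the right-hand side is not
  positive, which removes the need for tail estimates.
\<close>

lemma kravchuk_ground_lower:
  assumes "even N" "N \<ge> 16" "a \<in> lattice (mesh N)"
  shows "kravchuk_fun N 0 a \<ge> (1 - (mesh N)\<^sup>2) * hermite_fun 0 a * (1 - \<bar>a\<bar> ^ 3 * mesh N)"
proof -
  have N0: "N > 0" using assms by simp
  define h where "h = mesh N"
  note mf = mesh_facts[OF N0, folded h_def]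
  obtain n where n: "N = 2 * n" using assms(1) by blast
  have n8: "n \<ge> 8" using assms n by simp
  have hn: "h\<^sup>2 * real n = 1" using mf n by simp
  have h1: "h\<^sup>2 \<le> 1" using hn n8 mult_left_mono[of 1 "real n" "h\<^sup>2"] by simp
  obtain k :: int where k: "a = h * real_of_int k" using assms(3) by (auto simp: lattice_def h_def)
  define j where "j = nat \<bar>k\<bar>"
  have aj: "\<bar>a\<bar> = h * real j" using mf(1) by (simp add: k j_def abs_mult)
  have a3: "\<bar>a\<bar> ^ 3 * h = (h\<^sup>2)\<^sup>2 * (real j) ^ 3" unfolding aj by (simp add: power_mult_distrib eval_nat_numeral)
  have phi: "kravchuk_fun N 0 a = sqrt (kravchuk_weight N a)"
    by (simp add: kravchuk_fun_def kravchuk_normalization_def)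
  have w0: "kravchuk_weight N a \<ge> 0" by (rule kravchuk_weight_nonneg[OF N0])
  have g0: "hermite_fun 0 a \<ge> 0" by (simp add: hermite_fun_0)
  show ?thesis
  proof (cases "\<bar>a\<bar> ^ 3 * h \<ge> 1")
    case True
    then have "(1 - h\<^sup>2) * hermite_fun 0 a * (1 - \<bar>a\<bar> ^ 3 * h) \<le> 0"
      using h1 g0 by (intro mult_nonneg_nonpos mult_nonneg_nonneg) auto
    also have "0 \<le> kravchuk_fun N 0 a" using phi w0 by simp
    finally show ?thesis by (simp add: h_def)
  next
    case False
    \<comment> \<open>points with \<open>\<bar>a\<bar>\<^sup>3 h < 1\<close> are far from the ends of the window\<close>
    have jn: "2 * j \<le> n"
    proof (rule ccontr)
      assume "\<not> 2 * j \<le> n"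
      then have "(real n / 2) ^ 3 \<le> (real j) ^ 3" by (intro power_mono) auto
      then have "(h\<^sup>2)\<^sup>2 * (real n / 2) ^ 3 \<le> \<bar>a\<bar> ^ 3 * h" unfolding a3 by (intro mult_left_mono) auto
      also have "(h\<^sup>2)\<^sup>2 * (real n / 2) ^ 3 = (h\<^sup>2 * real n)\<^sup>2 * real n / 8" by (simp add: power2_eq_square power3_eq_cube)
      finally show False using False n8 hn by simp
    qed
    have jlt: "j < n" using jn n8 by linarith
    have wk: "kravchuk_weight N a = real ((2 * n) choose (n + j)) / (h * 4 ^ n)"
    proof -
      have "a = lattice_pt N (nat (int n + k))" using jlt k n by (auto simp: lattice_pt_def h_def j_def)
      moreover have le: "nat (int n + k) \<le> N" using jlt n by (auto simp: j_def)
      moreover have "N choose nat (int n + k) = N choose (n + j)"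
      proof (cases "k \<ge> 0")
        case True then show ?thesis by (simp add: j_def nat_add_distrib)
      next
        case False
        then have "N - nat (int n + k) = n + j" using jlt n by (auto simp: j_def)
        then show ?thesis using binomial_symmetric[OF le] by simp
      qed
      ultimately show ?thesis using kravchuk_weight_lattice_pt[OF assms(1) N0 le] n by (simp add: h_def power_mult)
    qed
    define r where "r = (1 - h\<^sup>2) * hermite_fun 0 a * exp (- (\<bar>a\<bar> ^ 3 * h))"
    have expo: "(real j)\<^sup>2 / real (n - j) \<le> a\<^sup>2 + 2 * (\<bar>a\<bar> ^ 3 * h)"
    proof -
      have pos: "real n - real j > 0" "real n > 0" "real n \<le> 2 * (real n - real j)"
        using jlt of_nat_mono[OF jn, where 'a = real] by auto
      have h2: "h\<^sup>2 = 1 / real n" using hn pos by (simp add: eq_divide_eq)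
      have "a\<^sup>2 = \<bar>a\<bar>\<^sup>2" by simp
      also have "\<dots> = (real j)\<^sup>2 / real n" unfolding aj by (simp add: power_mult_distrib h2)
      finally have a2: "a\<^sup>2 = (real j)\<^sup>2 / real n" .
      have "(real j)\<^sup>2 / real (n - j) = (real j)\<^sup>2 / real n + (real j) ^ 3 / (real n * (real n - real j))"
        using pos jlt by (simp add: of_nat_diff divide_simps) (simp add: power2_eq_square power3_eq_cube algebra_simps)
      also have "(real j) ^ 3 / (real n * (real n - real j)) \<le> (real j) ^ 3 / (real n * (real n / 2))"
        using pos by (intro divide_left_mono mult_left_mono mult_pos_pos) auto
      also have "(real j) ^ 3 / (real n * (real n / 2)) = 2 * (\<bar>a\<bar> ^ 3 * h)"
        unfolding a3 h2 by (simp add: power2_eq_square)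
      finally show ?thesis using a2 by simp
    qed
    have r2: "r\<^sup>2 = (1 - h\<^sup>2)\<^sup>2 / sqrt pi * exp (- (a\<^sup>2 + 2 * (\<bar>a\<bar> ^ 3 * h)))"
    proof -
      have "exp (- a\<^sup>2 / 2) ^ 2 = exp (- a\<^sup>2)" by (simp flip: exp_double)
      moreover have "exp (- (\<bar>a\<bar> ^ 3 * h)) ^ 2 = exp (- (2 * (\<bar>a\<bar> ^ 3 * h)))" by (simp flip: exp_double)
      moreover have "sqrt (sqrt pi) ^ 2 = sqrt pi" by simp
      moreover have "exp (- (a\<^sup>2 + 2 * (\<bar>a\<bar> ^ 3 * h))) = exp (- a\<^sup>2) * exp (- (2 * (\<bar>a\<bar> ^ 3 * h)))"
        by (simp flip: exp_add)
      ultimately show ?thesis unfolding r_def hermite_fun_0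
        by (simp only: power_mult_distrib power_divide times_divide_eq_left times_divide_eq_right mult.assoc)
    qed
    have "(1 - h\<^sup>2)\<^sup>2 * sqrt (1 + h\<^sup>2 / 2) \<le> 1"
    proof -
      have "((1 - h\<^sup>2)\<^sup>2 * sqrt (1 + h\<^sup>2 / 2))\<^sup>2 = (1 - h\<^sup>2) ^ 3 * ((1 - h\<^sup>2) * (1 + h\<^sup>2 / 2))"
        by (simp add: power_mult_distrib) (simp add: eval_nat_numeral)
      also have "\<dots> \<le> 1 * 1"
      proof (intro mult_mono)
        show "(1 - h\<^sup>2) ^ 3 \<le> 1" using h1 by (intro power_le_one) auto
        have "(1 - h\<^sup>2) * (1 + h\<^sup>2 / 2) = 1 - h\<^sup>2 / 2 - h\<^sup>2 * h\<^sup>2 / 2"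
        proof -
          have "(1 - y) * (1 + y / 2) = 1 - y / 2 - y * y / 2" for y :: real by (simp add: field_simps)
          then show ?thesis .
        qed
        also have "\<dots> \<le> 1" using zero_le_power2[of h] mult_nonneg_nonneg[of "h\<^sup>2" "h\<^sup>2"] by linarith
        finally show "(1 - h\<^sup>2) * (1 + h\<^sup>2 / 2) \<le> 1" .
        show "0 \<le> (1 - h\<^sup>2) * (1 + h\<^sup>2 / 2)" using h1 by (intro mult_nonneg_nonneg) auto
      qed auto
      finally show ?thesis using power2_le_imp_le[of _ "1::real"] by simp
    qed
    then have c1: "(1 - h\<^sup>2)\<^sup>2 \<le> 1 / sqrt (1 + h\<^sup>2 / 2)"
      by (subst le_divide_eq) (auto simp: add_pos_nonneg mult.commute)
    have c2: "1 / (h * sqrt (pi * (real n + 1 / 2))) = 1 / sqrt pi * (1 / sqrt (1 + h\<^sup>2 / 2))"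
    proof -
      have "h * sqrt (pi * (real n + 1 / 2)) = sqrt (h\<^sup>2) * sqrt (pi * (real n + 1 / 2))" using mf(1) by simp
      also have "\<dots> = sqrt (h\<^sup>2 * (pi * (real n + 1 / 2)))" by (simp only: real_sqrt_mult)
      also have "h\<^sup>2 * (pi * (real n + 1 / 2)) = pi * (h\<^sup>2 * real n + h\<^sup>2 / 2)" by (simp add: algebra_simps)
      finally show ?thesis unfolding hn by (simp add: real_sqrt_mult)
    qed
    have "r\<^sup>2 \<le> 1 / (h * sqrt (pi * (real n + 1 / 2))) * exp (- ((real j)\<^sup>2 / real (n - j)))"
    proof -
      have "r\<^sup>2 = 1 / sqrt pi * (1 - h\<^sup>2)\<^sup>2 * exp (- (a\<^sup>2 + 2 * (\<bar>a\<bar> ^ 3 * h)))" unfolding r2 by simp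
      also have "\<dots> \<le> 1 / sqrt pi * (1 / sqrt (1 + h\<^sup>2 / 2)) * exp (- ((real j)\<^sup>2 / real (n - j)))"
        using c1 expo by (intro mult_mono mult_left_mono) auto
      finally show ?thesis unfolding c2 .
    qed
    also have "\<dots> = (1 / sqrt (pi * (real n + 1 / 2))) * exp (- ((real j)\<^sup>2 / real (n - j))) / h" by simp
    also have "\<dots> \<le> (real ((2 * n) choose n) / 4 ^ n) * exp (- ((real j)\<^sup>2 / real (n - j))) / h"
      using mf(1) by (intro divide_right_mono mult_right_mono central_binomial_lower) auto
    also have "\<dots> = (real ((2 * n) choose n) * exp (- (real j)\<^sup>2 / real (n - j))) / (h * 4 ^ n)" by simp
    also have "\<dots> \<le> kravchuk_weight N a" unfolding wk
      using mf(1) by (intro divide_right_mono binomial_central_ratio[OF jlt]) auto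
    finally have "\<bar>r\<bar> \<le> sqrt (kravchuk_weight N a)" by (rule real_le_rsqrt[of "\<bar>r\<bar>", simplified])
    then have "r \<le> kravchuk_fun N 0 a" unfolding phi by simp
    moreover have "(1 - h\<^sup>2) * hermite_fun 0 a * (1 - \<bar>a\<bar> ^ 3 * h) \<le> r" unfolding r_def
      using h1 g0 exp_ge_add_one_self[of "- (\<bar>a\<bar> ^ 3 * h)"] by (intro mult_left_mono mult_nonneg_nonneg) auto
    ultimately show ?thesis by (simp add: h_def)
  qed
qed

text \<open>
  Both functions have norm \<open>1\<close> up to \<open>O(h)\<close>, so the distance is controlled by a lower bound for
  their inner product, and only the lower bound on the Kravchuk ground state is needed.
\<close>

lemma ground_state_error:
  "\<exists>C\<ge>0. \<forall>N F. even N \<longrightarrow> N \<ge> 16 \<longrightarrow> finite F \<longrightarrow> F \<subseteq> lattice (mesh N) \<longrightarrow>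
     mesh N * (\<Sum>a\<in>F. (hermite_fun 0 a - kravchuk_fun N 0 a)\<^sup>2) \<le> C * mesh N"
proof -
  define g where "g = hermite_fun 0"
  have rg2: "rapid (\<lambda>x. g x * g x)" unfolding g_def by (intro rapid_mult rapid_hermite_fun)
  have g0: "g a \<ge> 0" for a by (simp add: g_def hermite_fun_0)
  have bd: "\<exists>C\<ge>0. \<forall>x. \<bar>x\<bar> ^ k * (g x * g x) \<le> C * (1 / (1 + x\<^sup>2))" for k
  proof -
    obtain A where A: "\<forall>x. \<bar>x\<bar> ^ k * \<bar>g x * g x\<bar> \<le> A" "A \<ge> 0" using rapidD[OF rg2] by meson
    obtain B where B: "\<forall>x. \<bar>x\<bar> ^ (k + 2) * \<bar>g x * g x\<bar> \<le> B" "B \<ge> 0" using rapidD[OF rg2] by meson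
    have "\<bar>x\<bar> ^ k * (g x * g x) \<le> (A + B) * (1 / (1 + x\<^sup>2))" for x
    proof -
      have "(\<bar>x\<bar> ^ k * (g x * g x)) * (1 + x\<^sup>2) = \<bar>x\<bar> ^ k * (g x * g x) + \<bar>x\<bar> ^ (k + 2) * (g x * g x)"
        by (simp add: power_add power2_eq_square algebra_simps)
      also have "\<dots> \<le> A + B" using A B g0 by (intro add_mono) (auto simp: abs_mult)
      finally show ?thesis using add_pos_nonneg[of 1 "x\<^sup>2"] by (simp add: field_simps)
    qed
    then show ?thesis using A B by (intro exI[of _ "A + B"]) auto
  qed
  obtain C0 where C0: "C0 \<ge> 0" "\<forall>x. \<bar>x\<bar> ^ 0 * (g x * g x) \<le> C0 * (1 / (1 + x\<^sup>2))" using bd by meson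
  obtain C3 where C3: "C3 \<ge> 0" "\<forall>x. \<bar>x\<bar> ^ 3 * (g x * g x) \<le> C3 * (1 / (1 + x\<^sup>2))" using bd by meson
  have "mesh N * (\<Sum>a\<in>F. (g a - kravchuk_fun N 0 a)\<^sup>2) \<le> (2 + 10 * C0 + 10 * C3) * mesh N"
    if N: "even N" "N \<ge> 16" and F: "finite F" "F \<subseteq> lattice (mesh N)" for N F
  proof -
    have N0: "N > 0" using N by simp
    define h where "h = mesh N"
    note mf = mesh_facts[OF N0, folded h_def]
    have h2: "h\<^sup>2 \<le> 1" using mf N mult_left_mono[of 2 "real N" "h\<^sup>2"] by simp
    have h1: "h \<le> 1" using h2 mf(1) by (simp add: power_le_one_iff)
    obtain m :: nat where m: "h * (\<Sum>k\<in>{- int m..int m}. exp (- (h * real_of_int k)\<^sup>2)) \<ge> sqrt pi - 2 * h"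
      using gaussian_lattice_sum_lower[OF mf(1)] by blast
    define L where "L = (\<lambda>k. h * real_of_int k) ` {- int m..int m}"
    define W where "W = lattice_window h"
    \<comment> \<open>\<open>W\<close> carries the Kravchuk function, and \<open>L\<close> almost all of the Gaussian\<close>
    define F' where "F' = F \<union> W \<union> L"
    let ?p = "kravchuk_fun N 0"
    have finW: "finite W" using N N0 by (simp add: W_def h_def)
    have fin: "finite F'" using F finW by (simp add: F'_def L_def)
    have sub: "F' \<subseteq> lattice h" using F by (auto simp: F'_def L_def W_def h_def lattice_def lattice_window_def)
    have b: "h * (\<Sum>a\<in>F'. 1 / (1 + a\<^sup>2)) \<le> 5" by (rule lattice_sum_bound[OF mf(1) h1 fin sub])
    have bsum: "h * (\<Sum>a\<in>F'. u a) \<le> 5 * C" if "C \<ge> 0" "\<And>a. u a \<le> C * (1 / (1 + a\<^sup>2))" for C u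
    proof -
      have "h * (\<Sum>a\<in>F'. u a) \<le> h * (\<Sum>a\<in>F'. C * (1 / (1 + a\<^sup>2)))"
        using that mf(1) by (intro mult_left_mono sum_mono) auto
      also have "\<dots> = C * (h * (\<Sum>a\<in>F'. 1 / (1 + a\<^sup>2)))" by (simp only: sum_distrib_left[symmetric] mult.left_commute)
      also have "\<dots> \<le> C * 5" using b that by (intro mult_left_mono) auto
      finally show ?thesis by simp
    qed
    define S where "S = h * (\<Sum>a\<in>F'. g a * g a)"
    define T where "T = h * (\<Sum>a\<in>F'. \<bar>a\<bar> ^ 3 * (g a * g a))"
    have SU: "S \<le> 5 * C0" unfolding S_def by (rule bsum) (use C0 in auto)
    have TU: "T \<le> 5 * C3" unfolding T_def by (rule bsum) (use C3 in auto)
    have S0: "S \<ge> 0" unfolding S_def using mf(1) g0 by (intro mult_nonneg_nonneg sum_nonneg) auto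
    have T0: "T \<ge> 0" unfolding T_def using mf(1) g0 by (intro mult_nonneg_nonneg sum_nonneg) auto
    have SL: "S \<ge> 1 - 2 * h"
    proof -
      have gg: "g a * g a = exp (- a\<^sup>2) / sqrt pi" for a
      proof -
        have "g a * g a = (exp (- a\<^sup>2 / 2) * exp (- a\<^sup>2 / 2)) / (sqrt (sqrt pi) * sqrt (sqrt pi))"
          unfolding g_def hermite_fun_0 by (simp add: times_divide_times_eq)
        then show ?thesis by (simp flip: exp_add)
      qed
      have "(sqrt pi - 2 * h) / sqrt pi \<le> h * (\<Sum>k\<in>{- int m..int m}. exp (- (h * real_of_int k)\<^sup>2)) / sqrt pi"
        using m by (intro divide_right_mono) auto
      also have "\<dots> = h * (\<Sum>a\<in>L. g a * g a)"
        unfolding L_def gg using mf(1) by (subst sum.reindex) (auto simp: inj_on_def simp flip: sum_divide_distrib)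
      also have "\<dots> \<le> S" unfolding S_def using mf(1) fin by (intro mult_left_mono sum_mono2) (auto simp: F'_def)
      finally have "1 - 2 * h / sqrt pi \<le> S" by (simp add: diff_divide_distrib)
      moreover have "2 * h / sqrt pi \<le> 2 * h / 1"
        using mf(1) pi_ge_two by (intro divide_left_mono) auto
      ultimately show ?thesis by simp
    qed
    have one: "h * (\<Sum>a\<in>F'. ?p a * ?p a) = 1"
    proof -
      have "(\<Sum>a\<in>F'. ?p a * ?p a) = (\<Sum>a\<in>W. ?p a * ?p a)"
        by (intro sum.mono_neutral_right fin) (auto simp: F'_def W_def h_def kravchuk_fun_def kravchuk_weight_def)
      then show ?thesis using kravchuk_gram[OF N(1) N0, of 0 0] by (simp add: W_def h_def)
    qed
    have cross: "h * (\<Sum>a\<in>F'. g a * ?p a) \<ge> (1 - h\<^sup>2) * (S - h * T)"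
    proof -
      have "(1 - h\<^sup>2) * (S - h * T) = h * (\<Sum>a\<in>F'. g a * ((1 - h\<^sup>2) * g a * (1 - \<bar>a\<bar> ^ 3 * h)))"
      proof -
        have "(1 - h\<^sup>2) * (S - h * T) = (\<Sum>a\<in>F'. (1 - h\<^sup>2) * (h * (g a * g a) - h * (h * (\<bar>a\<bar> ^ 3 * (g a * g a)))))"
          unfolding S_def T_def by (simp only: sum_distrib_left sum_subtractf right_diff_distrib)
        also have "\<dots> = (\<Sum>a\<in>F'. h * (g a * ((1 - h\<^sup>2) * g a * (1 - \<bar>a\<bar> ^ 3 * h))))"
          by (intro sum.cong refl) (simp add: algebra_simps)
        finally show ?thesis by (simp only: sum_distrib_left)
      qed
      also have "\<dots> \<le> h * (\<Sum>a\<in>F'. g a * ?p a)"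
        using mf(1) sub kravchuk_ground_lower[OF N] g0 unfolding g_def h_def
        by (intro mult_left_mono sum_mono) (auto simp: g_def h_def)
      finally show ?thesis .
    qed
    have "h * (\<Sum>a\<in>F. (g a - ?p a)\<^sup>2) \<le> h * (\<Sum>a\<in>F'. (g a - ?p a)\<^sup>2)"
      using mf(1) fin by (intro mult_left_mono sum_mono2) (auto simp: F'_def)
    also have "\<dots> = S + h * (\<Sum>a\<in>F'. ?p a * ?p a) - 2 * (h * (\<Sum>a\<in>F'. g a * ?p a))"
      unfolding S_def by (simp add: power2_eq_square sum_distrib_left sum.distrib sum_subtractf algebra_simps)
    also have "\<dots> \<le> S + 1 - 2 * ((1 - h\<^sup>2) * (S - h * T))" using one cross by simp
    also have "\<dots> = 1 - S + 2 * (h\<^sup>2 * S) + 2 * (h * T) - 2 * (h\<^sup>2 * (h * T))" by (simp add: algebra_simps)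
    also have "\<dots> \<le> 2 * h + 2 * (h * (5 * C0)) + 2 * (h * (5 * C3))"
    proof -
      have "h\<^sup>2 * S \<le> h * (5 * C0)" using SU S0 mf(1) h1 by (intro mult_mono) (auto simp: power2_eq_square mult_left_le)
      moreover have "h * T \<le> h * (5 * C3)" using TU mf(1) by (intro mult_left_mono) auto
      moreover have "0 \<le> h\<^sup>2 * (h * T)" using T0 mf(1) by simp
      ultimately show ?thesis using SL by linarith
    qed
    also have "\<dots> = (2 + 10 * C0 + 10 * C3) * h" by (simp add: algebra_simps)
    finally show ?thesis by (simp add: h_def)
  qed
  then show ?thesis using C0(1) C3(1) unfolding g_def by (intro exI[of _ "2 + 10 * C0 + 10 * C3"]) auto
qed

section \<open>Comparison of Hermite and Kravchuk functions\<close>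

text \<open>
  The norm of \<open>\<ell>\<^sup>2(h\<int>)\<close> restricted to a set \<open>F\<close>, which is always finite below; bounds
  uniform in \<open>F\<close> replace infinite sums.
\<close>

definition lnorm :: "real \<Rightarrow> real set \<Rightarrow> (real \<Rightarrow> real) \<Rightarrow> real" where
  "lnorm h F u = sqrt h * L2_set u F"

lemma lnorm_nonneg: "h \<ge> 0 \<Longrightarrow> lnorm h F u \<ge> 0"
  by (simp add: lnorm_def L2_set_nonneg)

lemma lnorm_triangle: "h \<ge> 0 \<Longrightarrow> lnorm h F (\<lambda>a. u a + v a) \<le> lnorm h F u + lnorm h F v"
  unfolding lnorm_def by (simp add: L2_set_triangle_ineq mult_left_mono flip: distrib_left)

lemma lnorm_cmult: "lnorm h F (\<lambda>a. c * u a) = \<bar>c\<bar> * lnorm h F u"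
proof -
  have "L2_set (\<lambda>a. c * u a) F = \<bar>c\<bar> * L2_set u F"
    by (simp add: L2_set_def power_mult_distrib real_sqrt_mult flip: sum_distrib_left)
  then show ?thesis by (simp add: lnorm_def)
qed

lemma lnorm_diff: "h \<ge> 0 \<Longrightarrow> lnorm h F (\<lambda>a. u a - v a) \<le> lnorm h F u + lnorm h F v"
  using lnorm_triangle[of h F u "\<lambda>a. -1 * v a"] lnorm_cmult[of h F "-1" v] by simp

lemma lnorm_mono: "h \<ge> 0 \<Longrightarrow> (\<And>a. a \<in> F \<Longrightarrow> \<bar>u a\<bar> \<le> \<bar>v a\<bar>) \<Longrightarrow> lnorm h F u \<le> lnorm h F v"
  unfolding lnorm_def L2_set_def by (intro mult_left_mono real_sqrt_le_mono sum_mono) (auto simp: abs_le_square_iff)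

lemma lnorm_sq: "h \<ge> 0 \<Longrightarrow> (lnorm h F u)\<^sup>2 = h * (\<Sum>a\<in>F. (u a)\<^sup>2)"
  by (simp add: lnorm_def power_mult_distrib L2_set_def sum_nonneg)

text \<open>
  Smallness of \<open>u\<close> and boundedness of a higher moment give smallness of the lower moments.
\<close>

lemma lnorm_interpolate:
  assumes "h \<ge> 0" "finite F"
  shows "(lnorm h F (\<lambda>a. a ^ j * u a))\<^sup>2 \<le> lnorm h F u * lnorm h F (\<lambda>a. a ^ (2 * j) * u a)"
proof -
  have "(lnorm h F (\<lambda>a. a ^ j * u a))\<^sup>2 = h * (\<Sum>a\<in>F. \<bar>u a\<bar> * \<bar>a ^ (2 * j) * u a\<bar>)"
  proof -
    have "(a ^ j * u a)\<^sup>2 = \<bar>u a\<bar> * \<bar>a ^ (2 * j) * u a\<bar>" for a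
    proof -
      have "\<bar>u a\<bar> * \<bar>a ^ (2 * j) * u a\<bar> = (\<bar>u a\<bar> * \<bar>u a\<bar>) * \<bar>(a ^ j)\<^sup>2\<bar>"
        by (simp add: abs_mult power_mult mult.commute[of 2])
      also have "\<dots> = (a ^ j * u a)\<^sup>2" by (simp add: power_mult_distrib power2_eq_square)
      finally show ?thesis by simp
    qed
    then show ?thesis by (simp add: lnorm_sq assms)
  qed
  also have "\<dots> \<le> h * (L2_set u F * L2_set (\<lambda>a. a ^ (2 * j) * u a) F)"
    by (intro mult_left_mono L2_set_mult_ineq assms)
  also have "\<dots> = (sqrt h * sqrt h) * (L2_set u F * L2_set (\<lambda>a. a ^ (2 * j) * u a) F)"
    using assms by simp
  also have "\<dots> = lnorm h F u * lnorm h F (\<lambda>a. a ^ (2 * j) * u a)" unfolding lnorm_def by (simp only: mult_ac)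
  finally show ?thesis .
qed

lemma lnorm_weighted_bound:
  assumes "0 < h" "h \<le> 1" "finite F" "F \<subseteq> lattice h" "\<And>a. (1 + a\<^sup>2) * \<bar>u a\<bar> \<le> B" "B \<ge> 0"
  shows "lnorm h F u \<le> 3 * B"
proof (rule power2_le_imp_le)
  have "(u a)\<^sup>2 \<le> B\<^sup>2 * (1 / (1 + a\<^sup>2))" for a
  proof -
    have p: "1 + a\<^sup>2 \<ge> 1" by simp
    have "\<bar>u a\<bar> * 1 \<le> \<bar>u a\<bar> * (1 + a\<^sup>2)" using p by (intro mult_left_mono) auto
    then have "\<bar>u a\<bar> \<le> B" using assms(5)[of a] by (simp add: mult.commute)
    then have "((1 + a\<^sup>2) * \<bar>u a\<bar>) * \<bar>u a\<bar> \<le> B * B" using assms(5,6) by (intro mult_mono) auto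
    moreover have "((1 + a\<^sup>2) * \<bar>u a\<bar>) * \<bar>u a\<bar> = (u a)\<^sup>2 * (1 + a\<^sup>2)"
      by (simp add: power2_eq_square)
    ultimately have "(u a)\<^sup>2 * (1 + a\<^sup>2) \<le> B\<^sup>2" by (simp only: power2_eq_square[of B])
    moreover have "1 + a\<^sup>2 > 0" using p by linarith
    ultimately have "(u a)\<^sup>2 \<le> B\<^sup>2 / (1 + a\<^sup>2)" by (simp only: pos_le_divide_eq)
    then show ?thesis by simp
  qed
  then have "(lnorm h F u)\<^sup>2 \<le> h * (\<Sum>a\<in>F. B\<^sup>2 * (1 / (1 + a\<^sup>2)))"
    unfolding lnorm_sq[OF less_imp_le[OF assms(1)]] using assms(1) by (intro mult_left_mono sum_mono) auto
  also have "\<dots> = B\<^sup>2 * (h * (\<Sum>a\<in>F. 1 / (1 + a\<^sup>2)))" by (simp only: sum_distrib_left[symmetric] mult.left_commute)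
  also have "\<dots> \<le> B\<^sup>2 * 9" using lattice_sum_bound[OF assms(1-4)] by (intro mult_left_mono) auto
  finally show "(lnorm h F u)\<^sup>2 \<le> (3 * B)\<^sup>2" by (simp add: power_mult_distrib)
qed (use assms in simp)

lemma lnorm_hermite:
  assumes "0 < h" "h \<le> 1" "finite F" "F \<subseteq> lattice h"
  shows "lnorm h F (hermite_fun n) \<le> 30 * (real n + 3) ^ 3"
  using lnorm_weighted_bound[OF assms hermite_fun_weighted_bound] by simp

lemma kravchuk_fun_outside: "a \<notin> lattice_window (mesh N) \<Longrightarrow> kravchuk_fun N n a = 0"
  by (simp add: kravchuk_fun_def kravchuk_weight_def)

lemma lnorm_kravchuk:
  assumes "even N" "N > 0" "2 * n \<le> N" "finite F"
  shows "lnorm (mesh N) F (kravchuk_fun N n) \<le> 1"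
proof (rule power2_le_imp_le)
  let ?W = "lattice_window (mesh N)" and ?f = "kravchuk_fun N n"
  have h: "mesh N > 0" by (rule mesh_facts[OF assms(2)])
  have "(\<Sum>a\<in>F. (?f a)\<^sup>2) = (\<Sum>a\<in>F \<inter> ?W. (?f a)\<^sup>2)"
    using assms(4) by (intro sum.mono_neutral_right) (auto simp: kravchuk_fun_outside)
  also have "\<dots> \<le> (\<Sum>a\<in>?W. (?f a)\<^sup>2)" using assms by (intro sum_mono2) auto
  finally have "(lnorm (mesh N) F ?f)\<^sup>2 \<le> mesh N * (\<Sum>a\<in>?W. (?f a)\<^sup>2)"
    using h by (simp add: lnorm_sq)
  also have "\<dots> = 1" using kravchuk_gram[OF assms(1,2), of n n] assms(3) by (simp add: power2_eq_square)
  finally show "(lnorm (mesh N) F ?f)\<^sup>2 \<le> 1\<^sup>2" by simp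
qed simp

lemma kravchuk_jac_le_hermite_jac: assumes "N > 0" "n \<le> N" shows "kravchuk_jac N n \<le> hermite_jac n"
proof (cases n)
  case (Suc m)
  have "real n / 2 * (1 - (mesh N)\<^sup>2 * (real n - 1) / 2) \<le> real n / 2 * 1"
    using Suc by (intro mult_left_mono) auto
  then show ?thesis unfolding kravchuk_jac_def hermite_jac_def by (intro real_sqrt_le_mono) simp
qed simp

lemma kravchuk_jac_diff_hermite_jac:
  assumes "N > 0" "n \<le> N"
  shows "\<bar>kravchuk_jac N n - hermite_jac n\<bar> \<le> (mesh N)\<^sup>2 * (real n)\<^sup>2"
proof (cases n)
  case (Suc m)
  define y where "y = (mesh N)\<^sup>2 * (real n - 1) / 2"
  have y0: "0 \<le> y" using Suc by (simp add: y_def)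
  have "(mesh N)\<^sup>2 * (real n - 1) \<le> (mesh N)\<^sup>2 * real N" using assms by (intro mult_left_mono) auto
  then have y1: "y \<le> 1" using mesh_facts[OF assms(1)] by (simp add: y_def)
  have k: "kravchuk_jac N n = hermite_jac n * sqrt (1 - y)" unfolding kravchuk_jac_def hermite_jac_def y_def by (simp only: real_sqrt_mult)
  have "(1 - y) * (1 - y) \<le> (1 - y) * 1" using y0 y1 by (intro mult_left_mono) auto
  then have "1 - y \<le> sqrt (1 - y)" using y1 by (intro real_le_rsqrt) (simp add: power2_eq_square)
  then have "hermite_jac n * (1 - sqrt (1 - y)) \<le> hermite_jac n * y" by (intro mult_left_mono) auto
  also have "\<dots> \<le> real n * ((mesh N)\<^sup>2 * real n)"
  proof (intro mult_mono hermite_jac_le)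
    have "2 * y = (mesh N)\<^sup>2 * (real n - 1)" by (simp add: y_def)
    then have "y \<le> (mesh N)\<^sup>2 * (real n - 1)" using y0 by linarith
    also have "\<dots> \<le> (mesh N)\<^sup>2 * real n" by (intro mult_left_mono) auto
    finally show "y \<le> (mesh N)\<^sup>2 * real n" .
  qed (use y0 in auto)
  finally have "hermite_jac n - kravchuk_jac N n \<le> (mesh N)\<^sup>2 * (real n)\<^sup>2"
    unfolding k by (simp add: algebra_simps power2_eq_square)
  then show ?thesis using kravchuk_jac_le_hermite_jac[OF assms] by simp
qed simp

lemma kravchuk_jac_Suc_ge_half: assumes "N > 0" "2 * n < N" shows "kravchuk_jac N (Suc n) \<ge> 1 / 2"
proof -
  have "(mesh N)\<^sup>2 * (2 * real n) \<le> (mesh N)\<^sup>2 * real N"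
  proof (intro mult_left_mono)
    show "2 * real n \<le> real N" using of_nat_mono[OF less_imp_le[OF assms(2)], where 'a = real] by simp
  qed simp
  then have "(mesh N)\<^sup>2 * real n / 2 \<le> 1 / 2" using mesh_facts[OF assms(1)] by simp
  then have "1 / 2 * (1 / 2) \<le> real (Suc n) / 2 * (1 - (mesh N)\<^sup>2 * (real (Suc n) - 1) / 2)"
    by (intro mult_mono) auto
  then show ?thesis unfolding kravchuk_jac_def by (intro real_le_rsqrt) (simp add: power2_eq_square)
qed

text \<open>
  A common bound for the norms of \<open>a\<^sup>j (\<psi>\<^sub>n - \<phi>\<^sub>n)\<close> and \<open>a\<^sup>j \<psi>\<^sub>n\<close> with \<open>n + j \<le> 2 T\<close>.
\<close>

definition moment_const :: "nat \<Rightarrow> real" where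
  "moment_const T = (4 * real T + 1) ^ (2 * T) * (30 * (2 * real T + 3) ^ 3 + 1)"

lemma moment_const_pos: "moment_const T \<ge> 1"
proof -
  have "1 * 1 \<le> moment_const T" unfolding moment_const_def
    by (intro mult_mono one_le_power) auto
  then show ?thesis by simp
qed

lemma moment_bound_step:
  assumes "h \<ge> 0" "B \<ge> 0" and rec: "\<And>a. a * u n a = c * u (Suc n) a + d * u (n - 1) a"
    and cd: "0 \<le> c" "c \<le> real n + 1" "0 \<le> d" "d \<le> real n"
    and u: "lnorm h F (\<lambda>a. a ^ j * u (Suc n) a) \<le> B" "lnorm h F (\<lambda>a. a ^ j * u (n - 1) a) \<le> B"
  shows "lnorm h F (\<lambda>a. a ^ Suc j * u n a) \<le> (2 * real n + 1) * B"
proof -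
  have "a ^ Suc j * u n a = c * (a ^ j * u (Suc n) a) + d * (a ^ j * u (n - 1) a)" for a
  proof -
    have "a ^ Suc j * u n a = a ^ j * (a * u n a)" by simp
    then show ?thesis unfolding rec by (simp add: algebra_simps)
  qed
  then have "lnorm h F (\<lambda>a. a ^ Suc j * u n a) \<le> c * lnorm h F (\<lambda>a. a ^ j * u (Suc n) a) + d * lnorm h F (\<lambda>a. a ^ j * u (n - 1) a)"
    using lnorm_triangle[OF assms(1), of F "\<lambda>a. c * (a ^ j * u (Suc n) a)" "\<lambda>a. d * (a ^ j * u (n - 1) a)"] cd
    by (simp add: lnorm_cmult)
  also have "\<dots> \<le> (real n + 1) * B + real n * B"
    using cd u lnorm_nonneg[OF assms(1)] by (intro add_mono mult_mono) auto
  finally show ?thesis by (simp add: algebra_simps)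
qed

text \<open>
  Powers of \<open>a\<close> are absorbed one at a time by the three-term recursion.
\<close>

lemma moment_bound:
  assumes "h \<ge> 0" "A \<ge> 0" and rec: "\<And>n a. n < S \<Longrightarrow> a * u n a = c n * u (Suc n) a + d n * u (n - 1) a"
    and cd: "\<And>n. n < S \<Longrightarrow> 0 \<le> c n \<and> c n \<le> real n + 1 \<and> 0 \<le> d n \<and> d n \<le> real n"
    and u: "\<And>n. n \<le> S \<Longrightarrow> lnorm h F (u n) \<le> A"
  shows "n + j \<le> S \<Longrightarrow> lnorm h F (\<lambda>a. a ^ j * u n a) \<le> (2 * real S + 1) ^ j * A"
proof (induction j arbitrary: n)
  case 0
  then show ?case using u by simp
next
  case (Suc j)
  have "lnorm h F (\<lambda>a. a ^ Suc j * u n a) \<le> (2 * real n + 1) * ((2 * real S + 1) ^ j * A)"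
  proof (rule moment_bound_step[where c = "c n" and d = "d n" and u = u])
    show "lnorm h F (\<lambda>a. a ^ j * u (Suc n) a) \<le> (2 * real S + 1) ^ j * A"
      "lnorm h F (\<lambda>a. a ^ j * u (n - 1) a) \<le> (2 * real S + 1) ^ j * A"
      using Suc.prems by (auto intro!: Suc.IH)
  qed (use assms(1,2) rec cd Suc.prems in auto)
  also have "\<dots> \<le> (2 * real S + 1) * ((2 * real S + 1) ^ j * A)"
    using Suc.prems assms(2) by (intro mult_right_mono) auto
  finally show ?case by (simp add: mult.assoc)
qed

text \<open>
  With \<open>e\<^sub>n = \<psi>\<^sub>n - \<phi>\<^sub>n\<close>, subtracting the two recursions expresses \<open>e\<^sub>n\<^sub>+\<^sub>1\<close> by \<open>a e\<^sub>n\<close>,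
  \<open>e\<^sub>n\<^sub>-\<^sub>1\<close> and terms of size \<open>h\<^sup>2\<close>.  The factor \<open>a\<close> is unbounded, so the induction on \<open>n\<close>
  controls all moments of order \<open>j \<le> T - n\<close> at once; it starts from the moments of \<open>e\<^sub>0\<close>, which
  are small by interpolation.
\<close>

lemma kravchuk_hermite_error:
  fixes C :: real
  assumes N: "even N" "N \<ge> 16" "4 * T + 4 \<le> N" and F: "finite F" "F \<subseteq> lattice (mesh N)"
    and C: "C \<ge> 0" and g: "mesh N * (\<Sum>a\<in>F. (hermite_fun 0 a - kravchuk_fun N 0 a)\<^sup>2) \<le> C * mesh N"
  shows "n \<le> T \<Longrightarrow> lnorm (mesh N) F (\<lambda>a. hermite_fun n a - kravchuk_fun N n a) \<le>
     (8 * (real T + 1)\<^sup>2) ^ T * (sqrt (sqrt (C * mesh N) * moment_const T) + (mesh N)\<^sup>2 * moment_const T)"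
proof -
  define h where "h = mesh N"
  have N0: "N > 0" using N by simp
  note mf = mesh_facts[OF N0, folded h_def]
  have h0: "h \<ge> 0" using mf by simp
  have h2: "h\<^sup>2 \<le> 1" using mf N mult_left_mono[of 2 "real N" "h\<^sup>2"] by simp
  have h1: "h \<le> 1" using h2 mf(1) by (simp add: power_le_one_iff)
  let ?n = "lnorm h F" and ?p = hermite_fun and ?k = "kravchuk_fun N"
  define e where "e = (\<lambda>n a. ?p n a - ?k n a)"
  define A where "A = 30 * (2 * real T + 3) ^ 3"
  define Q where "Q = (4 * real T + 1) ^ (2 * T)"
  have A0: "A \<ge> 0" and Q0: "Q \<ge> 1" by (auto simp: A_def Q_def one_le_power)
  have moment_const: "moment_const T = Q * (A + 1)" by (simp add: moment_const_def A_def Q_def)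
  have Qj: "(2 * real (2 * T) + 1) ^ j \<le> Q" if "j \<le> 2 * T" for j
    unfolding Q_def using that by (simp add: power_increasing)
  have mp: "?n (\<lambda>a. a ^ j * ?p n a) \<le> Q * A" if "n + j \<le> 2 * T" for n j
  proof -
    have "?n (\<lambda>a. a ^ j * ?p n a) \<le> (2 * real (2 * T) + 1) ^ j * A"
    proof (rule moment_bound[where c = "\<lambda>n. hermite_jac (Suc n)" and d = hermite_jac and u = ?p])
      fix n assume "n \<le> 2 * T"
      then have "30 * (real n + 3) ^ 3 \<le> A" unfolding A_def by (intro mult_left_mono power_mono) auto
      then show "?n (?p n) \<le> A" using lnorm_hermite[OF mf(1) h1 F(1)] F(2) order_trans unfolding h_def by blast
    qed (use h0 A0 that hermite_fun_rec hermite_jac_le[of "Suc _"] hermite_jac_le in \<open>auto simp: add.commute\<close>)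
    also have "\<dots> \<le> Q * A" using Qj A0 that by (intro mult_right_mono) auto
    finally show ?thesis .
  qed
  have mk: "?n (\<lambda>a. a ^ j * ?k n a) \<le> Q * 1" if "n + j \<le> 2 * T" for n j
  proof -
    have "?n (\<lambda>a. a ^ j * ?k n a) \<le> (2 * real (2 * T) + 1) ^ j * 1"
    proof (rule moment_bound[where c = "\<lambda>n. kravchuk_jac N (Suc n)" and d = "kravchuk_jac N" and u = ?k])
      fix n assume n: "n < 2 * T"
      then show "a * ?k n a = kravchuk_jac N (Suc n) * ?k (Suc n) a + kravchuk_jac N n * ?k (n - 1) a" for a
        using N by (intro kravchuk_fun_rec[OF N0]) auto
      have "kravchuk_jac N n \<ge> 0" using kravchuk_jac_pos[OF N0, of n] n N by (cases "n = 0") (auto intro: less_imp_le)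
      moreover have "kravchuk_jac N (Suc n) > 0" using n N by (intro kravchuk_jac_pos[OF N0]) auto
      moreover have "kravchuk_jac N n \<le> real n" using kravchuk_jac_le_hermite_jac[OF N0, of n] hermite_jac_le[of n] n N by linarith
      moreover have "kravchuk_jac N (Suc n) \<le> real (Suc n)" using kravchuk_jac_le_hermite_jac[OF N0, of "Suc n"] hermite_jac_le[of "Suc n"] n N by linarith
      ultimately show "0 \<le> kravchuk_jac N (Suc n) \<and> kravchuk_jac N (Suc n) \<le> real n + 1 \<and> 0 \<le> kravchuk_jac N n \<and> kravchuk_jac N n \<le> real n" by simp
    next
      fix n assume "n \<le> 2 * T"
      then show "?n (?k n) \<le> 1" unfolding h_def using N by (intro lnorm_kravchuk[OF N(1) N0 _ F(1)]) auto
    qed (use h0 that in auto)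
    also have "\<dots> \<le> Q * 1" using Qj that by (intro mult_right_mono) auto
    finally show ?thesis .
  qed
  have me: "?n (\<lambda>a. a ^ j * e n a) \<le> moment_const T" if "n + j \<le> 2 * T" for n j
    using lnorm_diff[OF h0, of F "\<lambda>a. a ^ j * ?p n a" "\<lambda>a. a ^ j * ?k n a"] mp[OF that] mk[OF that]
    by (simp add: e_def right_diff_distrib moment_const algebra_simps)
  have mp': "?n (\<lambda>a. a ^ j * ?p n a) \<le> moment_const T" if "n + j \<le> 2 * T" for n j
    using mp[OF that] Q0 by (simp add: moment_const algebra_simps)
  define Z where "Z = sqrt (sqrt (C * h) * moment_const T) + h\<^sup>2 * moment_const T"
  have Z1: "h\<^sup>2 * moment_const T \<le> Z" and Z0: "Z \<ge> 0" using moment_const_pos[of T] C h0 by (auto simp: Z_def)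
  have base: "?n (\<lambda>a. a ^ j * e 0 a) \<le> Z" if "j \<le> T" for j
  proof -
    have "?n (e 0) = sqrt ((?n (e 0))\<^sup>2)" using lnorm_nonneg[OF h0] by simp
    also have "\<dots> \<le> sqrt (C * h)" unfolding lnorm_sq[OF h0] using g by (intro real_sqrt_le_mono) (simp add: e_def h_def)
    finally have "?n (e 0) * ?n (\<lambda>a. a ^ (2 * j) * e 0 a) \<le> sqrt (C * h) * moment_const T"
      using me[of 0 "2 * j"] that lnorm_nonneg[OF h0] C h0 by (intro mult_mono) auto
    then have "(?n (\<lambda>a. a ^ j * e 0 a))\<^sup>2 \<le> sqrt (C * h) * moment_const T"
      using lnorm_interpolate[OF h0 F(1), of j "e 0"] by linarith
    then have "?n (\<lambda>a. a ^ j * e 0 a) \<le> sqrt (sqrt (C * h) * moment_const T)" by (rule real_le_rsqrt)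
    also have "\<dots> \<le> Z" using moment_const_pos[of T] by (simp add: Z_def)
    finally show ?thesis .
  qed
  define c where "c = 8 * (real T + 1)\<^sup>2"
  have "1 \<le> (real T + 1)\<^sup>2" by (intro one_le_power) simp
  then have c1: "c \<ge> 1" unfolding c_def by linarith
  have W: "n + j \<le> T \<Longrightarrow> ?n (\<lambda>a. a ^ j * e n a) \<le> c ^ n * Z" for n j
  proof (induction n arbitrary: j rule: less_induct)
    case (less n)
    show ?case
    proof (cases n)
      case 0
      then show ?thesis using base less.prems by simp
    next
      case (Suc m)
      have mN: "m < N" "Suc m \<le> N" using less.prems Suc N by auto
      have rec: "kravchuk_jac N (Suc m) * e (Suc m) a = a * e m a - kravchuk_jac N m * e (m - 1) a + (kravchuk_jac N (Suc m) - hermite_jac (Suc m)) * ?p (Suc m) a + (kravchuk_jac N m - hermite_jac m) * ?p (m - 1) a" for a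
        using hermite_fun_rec[of a m] kravchuk_fun_rec[OF N0 mN(1), of a] unfolding e_def by (simp add: algebra_simps)
      have rec2: "kravchuk_jac N (Suc m) * (a ^ j * e (Suc m) a) = ((a ^ Suc j * e m a - kravchuk_jac N m * (a ^ j * e (m - 1) a))
          + (kravchuk_jac N (Suc m) - hermite_jac (Suc m)) * (a ^ j * ?p (Suc m) a)) + (kravchuk_jac N m - hermite_jac m) * (a ^ j * ?p (m - 1) a)" for a
      proof -
        have "kravchuk_jac N (Suc m) * (a ^ j * e (Suc m) a) = a ^ j * (kravchuk_jac N (Suc m) * e (Suc m) a)" by simp
        then show ?thesis unfolding rec by (simp add: algebra_simps)
      qed
      have half: "kravchuk_jac N (Suc m) \<ge> 1 / 2" using less.prems Suc N by (intro kravchuk_jac_Suc_ge_half[OF N0]) auto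
      have kBm: "0 \<le> kravchuk_jac N m" "kravchuk_jac N m \<le> real T"
      proof -
        show "0 \<le> kravchuk_jac N m" using kravchuk_jac_pos[OF N0, of m] mN by (cases "m = 0") (auto intro: less_imp_le)
        have "kravchuk_jac N m \<le> real m" using kravchuk_jac_le_hermite_jac[OF N0, of m] hermite_jac_le[of m] mN by linarith
        then show "kravchuk_jac N m \<le> real T" using less.prems Suc by simp
      qed
      have "kravchuk_jac N (Suc m) * ?n (\<lambda>a. a ^ j * e (Suc m) a) = ?n (\<lambda>a. kravchuk_jac N (Suc m) * (a ^ j * e (Suc m) a))"
        using half by (simp add: lnorm_cmult)
      also have "\<dots> \<le> ((?n (\<lambda>a. a ^ Suc j * e m a) + ?n (\<lambda>a. kravchuk_jac N m * (a ^ j * e (m - 1) a)))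
          + ?n (\<lambda>a. (kravchuk_jac N (Suc m) - hermite_jac (Suc m)) * (a ^ j * ?p (Suc m) a))) + ?n (\<lambda>a. (kravchuk_jac N m - hermite_jac m) * (a ^ j * ?p (m - 1) a))"
        unfolding rec2
        by (rule order_trans[OF lnorm_triangle[OF h0]] add_right_mono)+ (rule lnorm_diff[OF h0])
      also have "\<dots> = ((?n (\<lambda>a. a ^ Suc j * e m a) + kravchuk_jac N m * ?n (\<lambda>a. a ^ j * e (m - 1) a))
          + \<bar>kravchuk_jac N (Suc m) - hermite_jac (Suc m)\<bar> * ?n (\<lambda>a. a ^ j * ?p (Suc m) a)) + \<bar>kravchuk_jac N m - hermite_jac m\<bar> * ?n (\<lambda>a. a ^ j * ?p (m - 1) a)"
        unfolding lnorm_cmult using kBm by simp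
      also have "\<dots> \<le> ((c ^ m * Z + real T * (c ^ m * Z)) + (h\<^sup>2 * (real T)\<^sup>2) * moment_const T) + (h\<^sup>2 * (real T)\<^sup>2) * moment_const T"
      proof (intro add_mono mult_mono)
        show "?n (\<lambda>a. a ^ Suc j * e m a) \<le> c ^ m * Z" using less.prems Suc by (intro less.IH) auto
        have "?n (\<lambda>a. a ^ j * e (m - 1) a) \<le> c ^ (m - 1) * Z" using less.prems Suc by (intro less.IH) auto
        also have "\<dots> \<le> c ^ m * Z" using c1 Z0 by (intro mult_right_mono power_increasing) auto
        finally show "?n (\<lambda>a. a ^ j * e (m - 1) a) \<le> c ^ m * Z" .
        have "\<bar>kravchuk_jac N (Suc m) - hermite_jac (Suc m)\<bar> \<le> h\<^sup>2 * (real (Suc m))\<^sup>2" unfolding h_def by (rule kravchuk_jac_diff_hermite_jac[OF N0 mN(2)])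
        also have "\<dots> \<le> h\<^sup>2 * (real T)\<^sup>2" using less.prems Suc by (intro mult_left_mono power_mono) auto
        finally show "\<bar>kravchuk_jac N (Suc m) - hermite_jac (Suc m)\<bar> \<le> h\<^sup>2 * (real T)\<^sup>2" .
        have "\<bar>kravchuk_jac N m - hermite_jac m\<bar> \<le> h\<^sup>2 * (real m)\<^sup>2" unfolding h_def using mN by (intro kravchuk_jac_diff_hermite_jac[OF N0]) auto
        also have "\<dots> \<le> h\<^sup>2 * (real T)\<^sup>2" using less.prems Suc by (intro mult_left_mono power_mono) auto
        finally show "\<bar>kravchuk_jac N m - hermite_jac m\<bar> \<le> h\<^sup>2 * (real T)\<^sup>2" .
        show "?n (\<lambda>a. a ^ j * ?p (Suc m) a) \<le> moment_const T" "?n (\<lambda>a. a ^ j * ?p (m - 1) a) \<le> moment_const T"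
          using less.prems Suc by (auto intro!: mp')
      qed (use kBm lnorm_nonneg[OF h0] h0 in auto)
      also have "\<dots> = (1 + real T) * (c ^ m * Z) + (2 * (real T)\<^sup>2) * (h\<^sup>2 * moment_const T)" by (simp add: algebra_simps)
      also have "\<dots> \<le> (1 + real T) * (c ^ m * Z) + (2 * (real T)\<^sup>2) * (c ^ m * Z)"
      proof (intro add_left_mono mult_left_mono)
        have "1 * Z \<le> c ^ m * Z" using c1 Z0 by (intro mult_right_mono one_le_power)
        then show "h\<^sup>2 * moment_const T \<le> c ^ m * Z" using Z1 by linarith
      qed simp
      also have "\<dots> = (1 + real T + 2 * (real T)\<^sup>2) * (c ^ m * Z)" by (simp add: algebra_simps)
      also have "\<dots> \<le> (c / 2) * (c ^ m * Z)"
        using c1 Z0 by (intro mult_right_mono) (auto simp: c_def power2_eq_square algebra_simps)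
      finally have "kravchuk_jac N (Suc m) * ?n (\<lambda>a. a ^ j * e (Suc m) a) \<le> (c / 2) * (c ^ m * Z)" .
      moreover have "1 / 2 * ?n (\<lambda>a. a ^ j * e (Suc m) a) \<le> kravchuk_jac N (Suc m) * ?n (\<lambda>a. a ^ j * e (Suc m) a)"
        using half lnorm_nonneg[OF h0] by (intro mult_right_mono) auto
      ultimately show ?thesis using Suc by simp
    qed
  qed
  assume nT: "n \<le> T"
  have "?n (e n) \<le> c ^ n * Z" using W[of n 0] nT by simp
  also have "\<dots> \<le> c ^ T * Z" using c1 Z0 nT by (intro mult_right_mono power_increasing) auto
  finally show "lnorm (mesh N) F (\<lambda>a. hermite_fun n a - kravchuk_fun N n a) \<le>
     (8 * (real T + 1)\<^sup>2) ^ T * (sqrt (sqrt (C * mesh N) * moment_const T) + (mesh N)\<^sup>2 * moment_const T)"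
    by (simp add: e_def c_def Z_def h_def)
qed

section \<open>The error of the discrete evolution\<close>

text \<open>
  The analogue of \<open>lnorm\<close> for complex-valued functions.
\<close>

definition clnorm :: "real \<Rightarrow> real set \<Rightarrow> (real \<Rightarrow> complex) \<Rightarrow> real" where
  "clnorm h F u = lnorm h F (\<lambda>a. norm (u a))"

lemma clnorm_nonneg: "h \<ge> 0 \<Longrightarrow> clnorm h F u \<ge> 0"
  by (simp add: clnorm_def lnorm_nonneg)

lemma clnorm_triangle:
  assumes "h \<ge> 0" shows "clnorm h F (\<lambda>a. u a + v a) \<le> clnorm h F u + clnorm h F v"
proof -
  have "clnorm h F (\<lambda>a. u a + v a) \<le> lnorm h F (\<lambda>a. norm (u a) + norm (v a))"
    unfolding clnorm_def by (rule lnorm_mono[OF assms]) (simp add: norm_triangle_ineq)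
  also have "\<dots> \<le> clnorm h F u + clnorm h F v" unfolding clnorm_def by (rule lnorm_triangle[OF assms])
  finally show ?thesis .
qed

lemma clnorm_sum:
  assumes "h \<ge> 0" "finite I" shows "clnorm h F (\<lambda>a. \<Sum>i\<in>I. u i a) \<le> (\<Sum>i\<in>I. clnorm h F (u i))"
  using assms(2)
proof (induction I)
  case empty
  show ?case by (simp add: clnorm_def lnorm_def L2_set_def)
next
  case (insert i I)
  then show ?case using clnorm_triangle[OF assms(1), of F "u i" "\<lambda>a. \<Sum>i\<in>I. u i a"] by simp
qed

lemma clnorm_uminus: "clnorm h F (\<lambda>a. - u a) = clnorm h F u"
  by (simp add: clnorm_def)

lemma clnorm_cmult_real: "clnorm h F (\<lambda>a. c * complex_of_real (u a)) = norm c * lnorm h F u"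
proof -
  have "clnorm h F (\<lambda>a. c * complex_of_real (u a)) = lnorm h F (\<lambda>a. norm c * \<bar>u a\<bar>)"
    unfolding clnorm_def by (simp add: norm_mult)
  also have "\<dots> = norm c * lnorm h F u" by (simp add: lnorm_cmult) (simp add: lnorm_def L2_set_def)
  finally show ?thesis .
qed

lemma clnorm_subset:
  assumes "h \<ge> 0" "finite G" "F \<subseteq> G" shows "clnorm h F u \<le> clnorm h G u"
  unfolding clnorm_def lnorm_def L2_set_def using assms
  by (intro mult_left_mono real_sqrt_le_mono sum_mono2) auto

lemma l2_lattice_of_bound:
  assumes "h > 0" "\<And>F. finite F \<Longrightarrow> F \<subseteq> lattice h \<Longrightarrow> clnorm h F u \<le> B"
  shows "u \<in> l2_lattice h" "l2_lattice_norm h u \<le> B"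
proof -
  have B0: "B \<ge> 0" using assms(2)[of "{}"] clnorm_nonneg[of h "{}" u] assms(1) by simp
  have b: "(\<Sum>a\<in>F. (norm (u a))\<^sup>2) \<le> B\<^sup>2 / h" if "finite F" "F \<subseteq> lattice h" for F
  proof -
    have "(clnorm h F u)\<^sup>2 \<le> B\<^sup>2" using assms that clnorm_nonneg[of h F u] by (intro power_mono) auto
    then have "h * (\<Sum>a\<in>F. (norm (u a))\<^sup>2) \<le> B\<^sup>2" unfolding clnorm_def using assms(1) by (subst (asm) lnorm_sq) auto
    then show ?thesis using assms(1) by (simp add: field_simps)
  qed
  have s: "(\<lambda>a. (norm (u a))\<^sup>2) summable_on lattice h"
    by (rule nonneg_bdd_above_summable_on) (auto intro!: bdd_aboveI[of _ "B\<^sup>2 / h"] b)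
  then show "u \<in> l2_lattice h" by (simp add: l2_lattice_def)
  have "infsum (\<lambda>a. (norm (u a))\<^sup>2) (lattice h) \<le> B\<^sup>2 / h"
    by (rule infsum_le_finite_sums[OF s b])
  then have "h * infsum (\<lambda>a. (norm (u a))\<^sup>2) (lattice h) \<le> B\<^sup>2" using assms(1) by (simp add: field_simps)
  then have "l2_lattice_norm h u \<le> sqrt (B\<^sup>2)" unfolding l2_lattice_norm_def by (rule real_sqrt_le_mono)
  then show "l2_lattice_norm h u \<le> B" using B0 by simp
qed

lemma kravchuk_parseval:
  assumes "even N" "N > 0" "2 * q \<le> N"
  shows "mesh N * (\<Sum>a\<in>lattice_window (mesh N). (\<Sum>n\<le>q. b n * kravchuk_fun N n a)\<^sup>2) = (\<Sum>n\<le>q. (b n)\<^sup>2)"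
proof -
  let ?W = "lattice_window (mesh N)" and ?f = "kravchuk_fun N"
  have "mesh N * (\<Sum>a\<in>?W. (\<Sum>n\<le>q. b n * ?f n a)\<^sup>2) = mesh N * (\<Sum>a\<in>?W. \<Sum>n\<le>q. \<Sum>m\<le>q. b n * b m * (?f n a * ?f m a))"
    by (simp add: power2_eq_square sum_product mult_ac)
  also have "(\<Sum>a\<in>?W. \<Sum>n\<le>q. \<Sum>m\<le>q. b n * b m * (?f n a * ?f m a)) = (\<Sum>n\<le>q. \<Sum>a\<in>?W. \<Sum>m\<le>q. b n * b m * (?f n a * ?f m a))"
    by (rule sum.swap)
  also have "\<dots> = (\<Sum>n\<le>q. \<Sum>m\<le>q. \<Sum>a\<in>?W. b n * b m * (?f n a * ?f m a))"
    by (intro sum.cong refl sum.swap)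
  also have "mesh N * \<dots> = (\<Sum>n\<le>q. \<Sum>m\<le>q. b n * b m * (mesh N * (\<Sum>a\<in>?W. ?f n a * ?f m a)))"
    by (simp add: sum_distrib_left mult_ac)
  also have "\<dots> = (\<Sum>n\<le>q. \<Sum>m\<le>q. b n * b m * (if n = m then 1 else 0))"
    using assms by (intro sum.cong refl) (subst kravchuk_gram, auto)
  also have "\<dots> = (\<Sum>n\<le>q. (b n)\<^sup>2)"
    by (intro sum.cong refl) (simp add: power2_eq_square if_distrib cong: if_cong)
  finally show ?thesis .
qed

lemma kravchuk_bessel:
  assumes "even N" "N > 0" "2 * q \<le> N"
  shows "(\<Sum>n\<le>q. (mesh N * (\<Sum>a\<in>lattice_window (mesh N). v a * kravchuk_fun N n a))\<^sup>2) \<le> mesh N * (\<Sum>a\<in>lattice_window (mesh N). (v a)\<^sup>2)"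
proof -
  let ?W = "lattice_window (mesh N)" and ?f = "kravchuk_fun N"
  define b where "b = (\<lambda>n. mesh N * (\<Sum>a\<in>?W. v a * ?f n a))"
  have h: "mesh N > 0" by (rule mesh_facts[OF assms(2)])
  define P where "P = (\<lambda>a. \<Sum>n\<le>q. b n * ?f n a)"
  have cr: "mesh N * (\<Sum>a\<in>?W. v a * P a) = (\<Sum>n\<le>q. (b n)\<^sup>2)"
  proof -
    have "mesh N * (\<Sum>a\<in>?W. v a * P a) = mesh N * (\<Sum>a\<in>?W. \<Sum>n\<le>q. b n * (v a * ?f n a))"
      by (simp add: P_def sum_distrib_left mult_ac)
    also have "(\<Sum>a\<in>?W. \<Sum>n\<le>q. b n * (v a * ?f n a)) = (\<Sum>n\<le>q. \<Sum>a\<in>?W. b n * (v a * ?f n a))"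
      by (rule sum.swap)
    also have "mesh N * \<dots> = (\<Sum>n\<le>q. b n * (mesh N * (\<Sum>a\<in>?W. v a * ?f n a)))"
      by (simp add: sum_distrib_left mult_ac)
    finally show ?thesis by (simp add: b_def power2_eq_square)
  qed
  have "0 \<le> mesh N * (\<Sum>a\<in>?W. (v a - P a)\<^sup>2)" using h by (intro mult_nonneg_nonneg sum_nonneg) auto
  also have "\<dots> = mesh N * (\<Sum>a\<in>?W. (v a)\<^sup>2) - 2 * (mesh N * (\<Sum>a\<in>?W. v a * P a)) + mesh N * (\<Sum>a\<in>?W. (P a)\<^sup>2)"
    by (simp add: power2_diff sum.distrib sum_subtractf sum_distrib_left algebra_simps)
  also have "\<dots> = mesh N * (\<Sum>a\<in>?W. (v a)\<^sup>2) - (\<Sum>n\<le>q. (b n)\<^sup>2)"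
    using kravchuk_parseval[OF assms, of b] cr by (simp add: P_def)
  finally show ?thesis by (simp add: b_def)
qed

text \<open>
  The discrete evolution of the projection of \<open>v\<close> onto the first Kravchuk functions, with
  arbitrary unimodular factors, does not increase the norm.
\<close>

lemma kravchuk_projection_bound:
  fixes v :: "real \<Rightarrow> complex"
  assumes "even N" "N > 0" "2 * q \<le> N" "finite F" "lattice_window (mesh N) \<subseteq> F" "\<And>n. norm (c n) = 1"
  shows "clnorm (mesh N) F (\<lambda>a. \<Sum>n\<le>q. (mesh N * (\<Sum>a\<in>lattice_window (mesh N). v a * complex_of_real (kravchuk_fun N n a))) * c n * complex_of_real (kravchuk_fun N n a))
     \<le> clnorm (mesh N) F v"
proof (rule power2_le_imp_le)
  let ?W = "lattice_window (mesh N)" and ?f = "kravchuk_fun N"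
  have h: "mesh N > 0" by (rule mesh_facts[OF assms(2)])
  define b where "b = (\<lambda>n. mesh N * (\<Sum>a\<in>?W. v a * complex_of_real (?f n a)))"
  define P where "P = (\<lambda>a. \<Sum>n\<le>q. b n * c n * complex_of_real (?f n a))"
  have ReP: "Re (P a) = (\<Sum>n\<le>q. Re (b n * c n) * ?f n a)" and ImP: "Im (P a) = (\<Sum>n\<le>q. Im (b n * c n) * ?f n a)" for a
    by (simp_all add: P_def)
  have Reb: "Re (b n) = mesh N * (\<Sum>a\<in>?W. Re (v a) * ?f n a)" and Imb: "Im (b n) = mesh N * (\<Sum>a\<in>?W. Im (v a) * ?f n a)" for n
    by (simp_all add: b_def)
  have cm: "(norm z)\<^sup>2 = (Re z)\<^sup>2 + (Im z)\<^sup>2" for z by (simp add: cmod_power2)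
  have "(clnorm (mesh N) F P)\<^sup>2 = mesh N * (\<Sum>a\<in>F. (norm (P a))\<^sup>2)"
    unfolding clnorm_def using h by (subst lnorm_sq) auto
  also have "(\<Sum>a\<in>F. (norm (P a))\<^sup>2) = (\<Sum>a\<in>?W. (norm (P a))\<^sup>2)"
    using assms(4,5) by (intro sum.mono_neutral_right) (auto simp: P_def kravchuk_fun_outside)
  also have "mesh N * \<dots> = mesh N * (\<Sum>a\<in>?W. (\<Sum>n\<le>q. Re (b n * c n) * ?f n a)\<^sup>2) + mesh N * (\<Sum>a\<in>?W. (\<Sum>n\<le>q. Im (b n * c n) * ?f n a)\<^sup>2)"
    unfolding cm ReP ImP by (simp add: sum.distrib distrib_left)
  also have "\<dots> = (\<Sum>n\<le>q. (Re (b n * c n))\<^sup>2) + (\<Sum>n\<le>q. (Im (b n * c n))\<^sup>2)"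
    by (simp only: kravchuk_parseval[OF assms(1-3)])
  also have "\<dots> = (\<Sum>n\<le>q. (norm (b n * c n))\<^sup>2)" unfolding cm by (simp only: sum.distrib)
  also have "\<dots> = (\<Sum>n\<le>q. (norm (b n))\<^sup>2)" using assms(6) by (simp add: norm_mult)
  also have "\<dots> = (\<Sum>n\<le>q. (Re (b n))\<^sup>2) + (\<Sum>n\<le>q. (Im (b n))\<^sup>2)" unfolding cm by (simp only: sum.distrib)
  also have "\<dots> \<le> mesh N * (\<Sum>a\<in>?W. (Re (v a))\<^sup>2) + mesh N * (\<Sum>a\<in>?W. (Im (v a))\<^sup>2)"
    unfolding Reb Imb by (intro add_mono kravchuk_bessel assms)
  also have "\<dots> = mesh N * (\<Sum>a\<in>?W. (norm (v a))\<^sup>2)" unfolding cm by (simp add: sum.distrib distrib_left)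
  also have "\<dots> \<le> mesh N * (\<Sum>a\<in>F. (norm (v a))\<^sup>2)"
    using h assms(4,5) by (intro mult_left_mono sum_mono2) auto
  also have "\<dots> = (clnorm (mesh N) F v)\<^sup>2" unfolding clnorm_def using h by (subst lnorm_sq) auto
  finally show "(clnorm (mesh N) F (\<lambda>a. \<Sum>n\<le>q. (mesh N * (\<Sum>a\<in>?W. v a * complex_of_real (?f n a))) * c n * complex_of_real (?f n a)))\<^sup>2 \<le> (clnorm (mesh N) F v)\<^sup>2"
    unfolding P_def b_def .
qed (use mesh_facts[OF assms(2)] in \<open>simp add: clnorm_nonneg\<close>)

text \<open>
  Let \<open>w t\<close> be the error made by replacing, in \<open>e\<^bsup>-itH\<^esup> f\<close>, the first \<open>M\<close> Hermite functions by
  Kravchuk functions and dropping the other modes.  The discrete solution reproduces the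
  Kravchuk part exactly, and its remaining part is the discrete evolution of the projection of
  \<open>w 0\<close>; so the total error is at most the sum of the norms of \<open>w t\<close> and \<open>w 0\<close>.
\<close>

lemma discretization_error:
  assumes f: "\<forall>n. f \<in> Sigma_space n"
    and N: "even N" "N > 0" "2 * q \<le> N" and M: "M \<le> q" and h1: "mesh N \<le> 1"
    and S: "(\<Sum>m<M. norm (hermite_coeff f m)) \<le> S"
    and E: "\<And>F m. finite F \<Longrightarrow> F \<subseteq> lattice (mesh N) \<Longrightarrow> m < M \<Longrightarrow> lnorm (mesh N) F (\<lambda>a. hermite_fun m a - kravchuk_fun N m a) \<le> E"
    and E0: "E \<ge> 0" and D0: "D \<ge> 0"
    and D: "\<And>t x. (1 + x\<^sup>2) * norm (evol f t x - (\<Sum>n<M. evol_term f t n x)) \<le> D"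
    and F: "finite F" "F \<subseteq> lattice (mesh N)"
  shows "clnorm (mesh N) F (\<lambda>a. lattice_restr (mesh N) (propagator t f) a - discrete_solution f N q t a) \<le> 2 * (S * E + 3 * D)"
proof -
  define h where "h = mesh N"
  have hp: "h > 0" unfolding h_def by (rule mesh_facts[OF N(2)])
  let ?W = "lattice_window h" and ?k = "kravchuk_fun N"
  have Wl: "?W \<subseteq> lattice h" by (auto simp: lattice_window_def)
  \<comment> \<open>\<open>G\<close> contains the support of the Kravchuk functions, as needed for orthonormality\<close>
  define G where "G = F \<union> ?W"
  have G: "finite G" "G \<subseteq> lattice h" "?W \<subseteq> G" "F \<subseteq> G" using F N Wl by (auto simp: G_def h_def)
  define r where "r = (\<lambda>t x. evol f t x - (\<Sum>n<M. evol_term f t n x))"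
  define w where "w = (\<lambda>t a. (\<Sum>m<M. hermite_coeff f m * phase t m * complex_of_real (hermite_fun m a - ?k m a)) + r t a)"
  have evw: "evol f t a = w t a + (\<Sum>m<M. hermite_coeff f m * phase t m * complex_of_real (?k m a))" for t a
    unfolding w_def r_def evol_term_def by (simp add: sum_subtractf right_diff_distrib)
  have wb: "clnorm h G (w t) \<le> S * E + 3 * D" for t
  proof -
    have "clnorm h G (w t) \<le> clnorm h G (\<lambda>a. \<Sum>m<M. hermite_coeff f m * phase t m * complex_of_real (hermite_fun m a - ?k m a)) + clnorm h G (r t)"
      unfolding w_def using hp by (intro clnorm_triangle) auto
    also have "\<dots> \<le> (\<Sum>m<M. clnorm h G (\<lambda>a. hermite_coeff f m * phase t m * complex_of_real (hermite_fun m a - ?k m a))) + clnorm h G (r t)"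
      using hp by (intro add_right_mono clnorm_sum) auto
    also have "(\<Sum>m<M. clnorm h G (\<lambda>a. hermite_coeff f m * phase t m * complex_of_real (hermite_fun m a - ?k m a)))
        = (\<Sum>m<M. norm (hermite_coeff f m) * lnorm h G (\<lambda>a. hermite_fun m a - ?k m a))"
      by (simp only: clnorm_cmult_real norm_mult norm_phase mult_1_right)
    also have "\<dots> \<le> (\<Sum>m<M. norm (hermite_coeff f m) * E)"
      using E[of G] G unfolding h_def by (intro sum_mono mult_left_mono) auto
    also have "\<dots> \<le> S * E" using S E0 by (simp add: sum_distrib_right[symmetric] mult_right_mono)
    also have "clnorm h G (r t) \<le> 3 * D"
      unfolding clnorm_def by (rule lnorm_weighted_bound[OF hp _ G(1,2)]) (use h1 D D0 in \<open>auto simp: h_def r_def\<close>)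
    finally show ?thesis by simp
  qed
  have coeff: "kravchuk_coeff f N n = h * (\<Sum>a\<in>?W. w 0 a * complex_of_real (?k n a)) + (if n < M then hermite_coeff f n else 0)" if n: "n \<le> q" for n
  proof -
    have "kravchuk_coeff f N n = h * (\<Sum>a\<in>?W. evol f 0 a * complex_of_real (?k n a))"
      unfolding kravchuk_coeff_def h_def lattice_restr_def cont_rep_initial[OF f] using Wl
      by (auto simp: h_def intro!: sum.cong)
    also have "(\<Sum>a\<in>?W. evol f 0 a * complex_of_real (?k n a)) = (\<Sum>a\<in>?W. w 0 a * complex_of_real (?k n a))
        + (\<Sum>a\<in>?W. \<Sum>m<M. hermite_coeff f m * complex_of_real (?k m a * ?k n a))"
      unfolding evw by (simp add: sum.distrib distrib_right sum_distrib_right mult.assoc)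
    also have "(\<Sum>a\<in>?W. \<Sum>m<M. hermite_coeff f m * complex_of_real (?k m a * ?k n a)) =
        (\<Sum>m<M. hermite_coeff f m * complex_of_real (\<Sum>a\<in>?W. ?k m a * ?k n a))"
      by (subst sum.swap) (simp add: sum_distrib_left)
    also have "h * ((\<Sum>a\<in>?W. w 0 a * complex_of_real (?k n a)) + (\<Sum>m<M. hermite_coeff f m * complex_of_real (\<Sum>a\<in>?W. ?k m a * ?k n a)))
       = h * (\<Sum>a\<in>?W. w 0 a * complex_of_real (?k n a)) + (\<Sum>m<M. hermite_coeff f m * complex_of_real (h * (\<Sum>a\<in>?W. ?k m a * ?k n a)))"
    proof -
      have "h * (X + (\<Sum>m<M. c m * complex_of_real (z m))) = h * X + (\<Sum>m<M. c m * complex_of_real (h * z m))" for X :: complex and c z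
        by (simp add: distrib_left sum_distrib_left mult_ac)
      then show ?thesis .
    qed
    also have "(\<Sum>m<M. hermite_coeff f m * complex_of_real (h * (\<Sum>a\<in>?W. ?k m a * ?k n a))) = (\<Sum>m<M. if m = n then hermite_coeff f m else 0)"
    proof (intro sum.cong refl)
      fix m assume "m \<in> {..<M}"
      then have "m + n \<le> N" using n M N(3) by auto
      then show "hermite_coeff f m * complex_of_real (h * (\<Sum>a\<in>?W. ?k m a * ?k n a)) = (if m = n then hermite_coeff f m else 0)"
        unfolding h_def by (subst kravchuk_gram[OF N(1,2)]) auto
    qed
    also have "\<dots> = (if n < M then hermite_coeff f n else 0)" by simp
    finally show ?thesis .
  qed
  define Q where "Q = (\<lambda>a. \<Sum>n\<le>q. (h * (\<Sum>a\<in>?W. w 0 a * complex_of_real (?k n a))) * phase t n * complex_of_real (?k n a))"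
  have disc: "discrete_solution f N q t a = Q a + (\<Sum>m<M. hermite_coeff f m * phase t m * complex_of_real (?k m a))" for a
  proof -
    have "discrete_solution f N q t a = (\<Sum>n\<le>q. (h * (\<Sum>a\<in>?W. w 0 a * complex_of_real (?k n a)) + (if n < M then hermite_coeff f n else 0)) * phase t n * complex_of_real (?k n a))"
      unfolding discrete_solution_def phase_def by (intro sum.cong refl) (simp add: coeff)
    also have "\<dots> = Q a + (\<Sum>n\<le>q. if n < M then hermite_coeff f n * phase t n * complex_of_real (?k n a) else 0)"
      unfolding Q_def sum.distrib[symmetric] by (intro sum.cong refl) (simp add: algebra_simps)
    also have "(\<Sum>n\<le>q. if n < M then hermite_coeff f n * phase t n * complex_of_real (?k n a) else 0) = (\<Sum>m<M. hermite_coeff f m * phase t m * complex_of_real (?k m a))"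
      using M by (subst sum.inter_filter[symmetric]) (auto intro!: sum.cong)
    finally show ?thesis .
  qed
  have Qb: "clnorm h G Q \<le> S * E + 3 * D"
  proof -
    have "clnorm h G Q \<le> clnorm h G (w 0)"
      unfolding Q_def h_def by (rule kravchuk_projection_bound) (use N G in \<open>auto simp: h_def\<close>)
    then show ?thesis using wb[of 0] by linarith
  qed
  let ?d = "\<lambda>a. lattice_restr (mesh N) (propagator t f) a - discrete_solution f N q t a"
  have "clnorm h F ?d = clnorm h F (\<lambda>a. w t a + - Q a)"
  proof -
    have "?d a = w t a + - Q a" if "a \<in> F" for a
      using that F unfolding lattice_restr_def cont_rep_propagator[OF f] disc by (auto simp: evw)
    then show ?thesis unfolding clnorm_def lnorm_def by (simp cong: L2_set_cong)
  qed
  also have "\<dots> \<le> clnorm h G (\<lambda>a. w t a + - Q a)" using hp G by (intro clnorm_subset) auto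
  also have "\<dots> \<le> clnorm h G (w t) + clnorm h G (\<lambda>a. - Q a)" using hp by (intro clnorm_triangle) auto
  also have "\<dots> \<le> (S * E + 3 * D) + (S * E + 3 * D)"
    unfolding clnorm_uminus by (intro add_mono wb Qb)
  finally show ?thesis by (simp add: h_def algebra_simps)
qed

text \<open>
  All factors are bounded by exponentials of quadratic polynomials in \<open>T\<close>, using \<open>1 + x \<le> exp x\<close>.
\<close>

lemma error_factor_bound:
  assumes "0 \<le> h" "0 \<le> C"
  shows "(8 * (real T + 1)\<^sup>2) ^ T * (sqrt (sqrt (C * h) * moment_const T) + h\<^sup>2 * moment_const T)
     \<le> exp (13 * (real T + 1)\<^sup>2) * (sqrt (sqrt C) * sqrt (sqrt h) + h\<^sup>2)"
proof -
  define T' where "T' = real T"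
  have T0: "T' \<ge> 0" by (simp add: T'_def)
  have e1: "1 + x \<le> exp x" for x :: real by (rule exp_ge_add_one_self)
  have e2: "2 ^ k \<le> exp (real k)" for k
  proof -
    have "(2::real) ^ k \<le> exp 1 ^ k" using e1[of 1] by (intro power_mono) auto
    then show ?thesis by (simp flip: exp_of_nat_mult)
  qed
  have m: "moment_const T \<le> exp (11 * (T' + 1)\<^sup>2)"
  proof -
    have "(4 * T' + 1) ^ (2 * T) \<le> exp (4 * T') ^ (2 * T)" using e1[of "4 * T'"] T0 by (intro power_mono) (auto simp: add.commute)
    also have "\<dots> = exp (8 * T'\<^sup>2)" by (simp add: T'_def power2_eq_square flip: exp_of_nat_mult)
    finally have a: "(4 * T' + 1) ^ (2 * T) \<le> exp (8 * T'\<^sup>2)" .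
    have "1 \<le> (2 * T' + 3) ^ 3" using T0 by (intro one_le_power) auto
    then have "30 * (2 * T' + 3) ^ 3 + 1 \<le> 2 ^ 5 * (2 * T' + 3) ^ 3" by simp
    also have "\<dots> \<le> exp (real 5) * exp (2 * T' + 2) ^ 3"
      using e1[of "2 * T' + 2"] T0 by (intro mult_mono e2 power_mono) auto
    also have "\<dots> = exp (6 * T' + 11)" by (simp add: algebra_simps flip: exp_of_nat_mult exp_add)
    finally have b: "30 * (2 * T' + 3) ^ 3 + 1 \<le> exp (6 * T' + 11)" .
    have "moment_const T \<le> exp (8 * T'\<^sup>2) * exp (6 * T' + 11)"
      unfolding moment_const_def T'_def[symmetric] using T0 by (intro mult_mono a b) auto
    also have "\<dots> = exp (8 * T'\<^sup>2 + (6 * T' + 11))" by (simp only: exp_add)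
    also have "\<dots> \<le> exp (11 * (T' + 1)\<^sup>2)" using T0 by (simp add: power2_eq_square algebra_simps)
    finally show ?thesis .
  qed
  have p: "(8 * (T' + 1)\<^sup>2) ^ T \<le> exp (2 * (T' + 1)\<^sup>2)"
  proof -
    have "8 * (T' + 1)\<^sup>2 \<le> exp (real 3) * exp T' ^ 2"
      using e2[of 3] e1[of T'] T0 by (intro mult_mono power_mono) (auto simp: add.commute)
    also have "\<dots> = exp (3 + 2 * T')" by (simp flip: exp_of_nat_mult exp_add)
    finally have "(8 * (T' + 1)\<^sup>2) ^ T \<le> exp (3 + 2 * T') ^ T" by (intro power_mono) auto
    also have "\<dots> = exp (T' * (3 + 2 * T'))" by (simp add: T'_def flip: exp_of_nat_mult)
    also have "\<dots> \<le> exp (2 * (T' + 1)\<^sup>2)" using T0 by (simp add: power2_eq_square algebra_simps)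
    finally show ?thesis .
  qed
  define B where "B = exp (11 * (T' + 1)\<^sup>2)"
  have B1: "B \<ge> 1" by (simp add: B_def)
  have "sqrt (sqrt (C * h) * moment_const T) \<le> sqrt (sqrt (C * h) * (B * B))"
  proof (intro real_sqrt_le_mono mult_left_mono)
    have "moment_const T \<le> B * 1" using m by (simp add: B_def)
    also have "\<dots> \<le> B * B" using B1 by (intro mult_left_mono) auto
    finally show "moment_const T \<le> B * B" .
  qed (use assms in auto)
  also have "\<dots> = B * (sqrt (sqrt C) * sqrt (sqrt h))" using B1 by (simp add: real_sqrt_mult)
  finally have "sqrt (sqrt (C * h) * moment_const T) + h\<^sup>2 * moment_const T \<le> B * (sqrt (sqrt C) * sqrt (sqrt h)) + h\<^sup>2 * B"
    using m by (intro add_mono mult_left_mono) (auto simp: B_def)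
  also have "\<dots> = B * (sqrt (sqrt C) * sqrt (sqrt h) + h\<^sup>2)" by (simp add: algebra_simps)
  finally have "(8 * (T' + 1)\<^sup>2) ^ T * (sqrt (sqrt (C * h) * moment_const T) + h\<^sup>2 * moment_const T)
     \<le> exp (2 * (T' + 1)\<^sup>2) * (B * (sqrt (sqrt C) * sqrt (sqrt h) + h\<^sup>2))"
    using p assms moment_const_pos[of T] by (intro mult_mono) auto
  also have "\<dots> = (exp (2 * (T' + 1)\<^sup>2) * exp (11 * (T' + 1)\<^sup>2)) * (sqrt (sqrt C) * sqrt (sqrt h) + h\<^sup>2)"
    by (simp add: B_def)
  also have "exp (2 * (T' + 1)\<^sup>2) * exp (11 * (T' + 1)\<^sup>2) = exp (13 * (T' + 1)\<^sup>2)"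
    by (simp flip: exp_add)
  finally show ?thesis by (simp add: T'_def)
qed

theorem theorem4:
  fixes f :: "real \<Rightarrow> complex" and \<delta> :: real
  assumes "\<forall>n. f \<in> Sigma_space n"
    and "\<delta> > 0"
  shows "\<exists>C::real. \<forall>s::real. \<exists>C\<^sub>s::real. \<exists>h\<^sub>0>0. \<forall>N::nat. \<forall>n_max::nat. \<forall>t::real.
    even N \<longrightarrow> N > 0 \<longrightarrow> mesh N \<le> h\<^sub>0 \<longrightarrow>
    1 / 4 * \<delta> * \<bar>ln (mesh N)\<bar> \<le> real n_max \<longrightarrow> real n_max \<le> 1 / 3 * \<delta> * \<bar>ln (mesh N)\<bar> \<longrightarrow>
    t \<ge> 0 \<longrightarrow>
    (\<lambda>a. lattice_restr (mesh N) (propagator t f) a - discrete_solution f N n_max t a)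
      \<in> l2_lattice (mesh N) \<and>
    l2_lattice_norm (mesh N)
      (\<lambda>a. lattice_restr (mesh N) (propagator t f) a - discrete_solution f N n_max t a)
      \<le> C * mesh N powr (2 - \<delta>) + C\<^sub>s / \<bar>ln (mesh N)\<bar> powr s"
\<comment> \<open>the logarithmic term dominates every positive power of \<open>h\<close>, so no multiple of \<open>h powr (2 - \<delta>)\<close> is needed\<close>
proof (rule exI[of _ 0], intro allI)
  fix s :: real
  note f = assms(1)
  obtain C0 where C0: "C0 \<ge> 0" "\<And>N F. even N \<Longrightarrow> N \<ge> 16 \<Longrightarrow> finite F \<Longrightarrow> F \<subseteq> lattice (mesh N) \<Longrightarrow>
     mesh N * (\<Sum>a\<in>F. (hermite_fun 0 a - kravchuk_fun N 0 a)\<^sup>2) \<le> C0 * mesh N"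
    using ground_state_error by meson
  \<comment> \<open>with \<open>M \<approx> \<bar>log h\<bar>\<^bsup>1/4\<^esup>\<close> modes, a tail of order \<open>M\<^sup>-\<^sup>k\<close> is \<open>O(\<bar>log h\<bar>\<^sup>-\<^sup>s)\<close> if \<open>k \<ge> 4 s\<close>\<close>
  obtain k :: nat where k: "4 * s \<le> real k" using real_arch_simple by blast
  obtain D where D: "D \<ge> 0" "\<And>t M x. (1 + x\<^sup>2) * norm (evol f t x - (\<Sum>n<M. evol_term f t n x)) \<le> D / (real M + 1) ^ k"
    using evol_tail[OF f, of k] by meson
  obtain B where B: "\<forall>m. norm (hermite_coeff f m) * (real m + 1) ^ 2 \<le> B"
    using hermite_coeff_decay[OF f] by blast
  define S where "S = (\<Sum>n. B * (1 / (real n + 1) ^ 2))"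
  have B0: "B \<ge> 0" using B[rule_format, of 0] order_trans[OF norm_ge_zero] by fastforce
  have Ssum: "(\<Sum>m<M. norm (hermite_coeff f m)) \<le> S" for M
  proof -
    have "(\<Sum>m<M. norm (hermite_coeff f m)) \<le> (\<Sum>m<M. B * (1 / (real m + 1) ^ 2))"
    proof (intro sum_mono)
      fix m
      have "norm (hermite_coeff f m) \<le> B / (real m + 1) ^ 2"
        using B by (subst pos_le_divide_eq) auto
      then show "norm (hermite_coeff f m) \<le> B * (1 / (real m + 1) ^ 2)" by simp
    qed
    also have "\<dots> \<le> S" unfolding S_def using B0
      by (intro sum_le_suminf summable_mult summable_inverse_square) auto
    finally show ?thesis .
  qed
  have S0: "S \<ge> 0" using Ssum[of 0] by simp
  \<comment> \<open>the mode error times \<open>\<bar>log h\<bar>\<^sup>s\<close>; its exponential is \<open>exp (O(\<surd>\<bar>log h\<bar>))\<close>,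
     smaller than every negative power of \<open>h\<close>\<close>
  define R where "R = (\<lambda>h. S * (exp (13 * (sqrt (sqrt (- ln h)) + 1)\<^sup>2) * (sqrt (sqrt C0) * sqrt (sqrt h) + h\<^sup>2)) * (- ln h) powr s)"
  have l1: "((\<lambda>h::real. exp (13 * (sqrt (sqrt (- ln h)) + 1)\<^sup>2) * (sqrt (sqrt h)) * (- ln h) powr s) \<longlongrightarrow> 0) (at_right 0)"
    by real_asymp
  have l2: "((\<lambda>h::real. exp (13 * (sqrt (sqrt (- ln h)) + 1)\<^sup>2) * (h\<^sup>2) * (- ln h) powr s) \<longlongrightarrow> 0) (at_right 0)"
    by real_asymp
  have "(R \<longlongrightarrow> S * (sqrt (sqrt C0) * 0 + 0)) (at_right 0)"
  proof -
    have R: "R = (\<lambda>h. S * (sqrt (sqrt C0) * (exp (13 * (sqrt (sqrt (- ln h)) + 1)\<^sup>2) * (sqrt (sqrt h)) * (- ln h) powr s)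
       + exp (13 * (sqrt (sqrt (- ln h)) + 1)\<^sup>2) * (h\<^sup>2) * (- ln h) powr s))"
      unfolding R_def by (simp add: algebra_simps)
    show ?thesis unfolding R by (intro tendsto_mult tendsto_add tendsto_const l1 l2)
  qed
  then have ev1: "eventually (\<lambda>h. R h < 1) (at_right 0)" by (intro order_tendstoD) auto
  have ev2: "eventually (\<lambda>h. sqrt (sqrt (- ln h)) \<le> 1/4 * \<delta> * (-ln h)) (at_right (0::real))"
    using assms(2) by real_asymp
  have ev3: "eventually (\<lambda>h. 1/3 * \<delta> * (-ln h) \<le> 1 / h\<^sup>2) (at_right (0::real))"
    using assms(2) by real_asymp
  have ev4: "eventually (\<lambda>h. 4 * sqrt (sqrt (- ln h)) + 4 \<le> 2 / h\<^sup>2) (at_right (0::real))"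
    by real_asymp
  have ev5: "eventually (\<lambda>h. - ln h > 1) (at_right (0::real))" by real_asymp
  have ev6: "eventually (\<lambda>h. 16 \<le> 2 / h\<^sup>2) (at_right (0::real))" by real_asymp
  have "eventually (\<lambda>h. R h < 1 \<and> sqrt (sqrt (- ln h)) \<le> 1/4 * \<delta> * (-ln h) \<and> 1/3 * \<delta> * (-ln h) \<le> 1 / h\<^sup>2
      \<and> 4 * sqrt (sqrt (- ln h)) + 4 \<le> 2 / h\<^sup>2 \<and> - ln h > 1 \<and> 16 \<le> 2 / h\<^sup>2) (at_right 0)"
    using ev1 ev2 ev3 ev4 ev5 ev6 by eventually_elim auto
  then obtain b where b: "b > 0" "\<And>h. 0 < h \<Longrightarrow> h < b \<Longrightarrow> R h < 1 \<and> sqrt (sqrt (- ln h)) \<le> 1/4 * \<delta> * (-ln h) \<and> 1/3 * \<delta> * (-ln h) \<le> 1 / h\<^sup>2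
      \<and> 4 * sqrt (sqrt (- ln h)) + 4 \<le> 2 / h\<^sup>2 \<and> - ln h > 1 \<and> 16 \<le> 2 / h\<^sup>2"
    unfolding eventually_at_right_field by auto
  have main: "(\<lambda>a. lattice_restr (mesh N) (propagator t f) a - discrete_solution f N q t a) \<in> l2_lattice (mesh N) \<and>
    l2_lattice_norm (mesh N) (\<lambda>a. lattice_restr (mesh N) (propagator t f) a - discrete_solution f N q t a)
      \<le> 0 * mesh N powr (2 - \<delta>) + (6 * D + 2) / \<bar>ln (mesh N)\<bar> powr s"
    if N: "even N" "N > 0" and hb: "mesh N \<le> b / 2" and q1: "1 / 4 * \<delta> * \<bar>ln (mesh N)\<bar> \<le> real q"
      and q2: "real q \<le> 1 / 3 * \<delta> * \<bar>ln (mesh N)\<bar>" for N q t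
  proof -
    define h where "h = mesh N"
    note mf = mesh_facts[OF N(2), folded h_def]
    have hb': "0 < h" "h < b" using mf b hb by (auto simp: h_def)
    define L where "L = - ln h"
    have P: "R h < 1" "sqrt (sqrt L) \<le> 1/4 * \<delta> * L" "1/3 * \<delta> * L \<le> 1 / h\<^sup>2"
      "4 * sqrt (sqrt L) + 4 \<le> 2 / h\<^sup>2" "L > 1" "16 \<le> 2 / h\<^sup>2" using b(2)[OF hb'] by (auto simp: L_def)
    have absL: "\<bar>ln (mesh N)\<bar> = L" using P(5) by (simp add: L_def h_def)
    have N2: "2 / h\<^sup>2 = real N" using mf(3) by simp
    define M where "M = nat \<lfloor>sqrt (sqrt L)\<rfloor>"
    have Mx: "real M \<le> sqrt (sqrt L)" "sqrt (sqrt L) \<le> real M + 1"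
      using P(5) by (auto simp: M_def)
    have Mq: "M \<le> q" using Mx(1) P(2) q1 unfolding absL by linarith
    have qN: "2 * q \<le> N"
    proof -
      have "real q \<le> real N / 2" using q2 P(3) mf(3) unfolding absL by linarith
      then show ?thesis by linarith
    qed
    have TN: "4 * M + 4 \<le> N" using Mx(1) P(4) unfolding N2 by linarith
    have N16: "N \<ge> 16" using P(6) unfolding N2 by linarith
    have h1: "h \<le> 1"
    proof -
      have "ln h < 0" using P(5) by (simp add: L_def)
      then show ?thesis using hb'(1) by (simp add: ln_less_zero_iff)
    qed
    define E where "E = (8 * (real M + 1)\<^sup>2) ^ M * (sqrt (sqrt (C0 * h) * moment_const M) + h\<^sup>2 * moment_const M)"
    have E0: "E \<ge> 0" unfolding E_def using moment_const_pos[of M] C0(1) hb'(1) by auto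
    have Eb: "lnorm (mesh N) F (\<lambda>a. hermite_fun m a - kravchuk_fun N m a) \<le> E"
      if "finite F" "F \<subseteq> lattice (mesh N)" "m < M" for F m
      unfolding E_def h_def
      by (rule kravchuk_hermite_error[OF N(1) N16 TN that(1,2) C0(1) C0(2)[OF N(1) N16 that(1,2)]]) (use that in auto)
    have Lpos: "L powr s > 0" using P(5) by simp
    have SE: "S * E \<le> 1 / L powr s"
    proof -
      have "E \<le> exp (13 * (real M + 1)\<^sup>2) * (sqrt (sqrt C0) * sqrt (sqrt h) + h\<^sup>2)"
        unfolding E_def using hb' C0(1) by (intro error_factor_bound) auto
      also have "\<dots> \<le> exp (13 * (sqrt (sqrt L) + 1)\<^sup>2) * (sqrt (sqrt C0) * sqrt (sqrt h) + h\<^sup>2)"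
        using Mx(1) hb' C0(1) by (intro mult_right_mono) (auto intro!: power_mono)
      finally have "S * E * L powr s \<le> R h" unfolding R_def L_def[symmetric]
        using S0 by (intro mult_right_mono mult_left_mono) auto
      then have "S * E * L powr s \<le> 1" using P(1) by simp
      then show ?thesis using Lpos by (simp add: pos_le_divide_eq)
    qed
    have DL: "D / (real M + 1) ^ k \<le> D / L powr s"
    proof (intro divide_left_mono D(1) mult_pos_pos Lpos)
      have "L powr s \<le> L powr (real k / 4)" using P(5) k by (intro powr_mono) auto
      also have "\<dots> = (sqrt (sqrt L)) ^ k"
      proof -
        have "sqrt (sqrt L) = L powr (1 / 4)" using P(5) by (simp add: powr_half_sqrt[symmetric] powr_powr)
        then have "(sqrt (sqrt L)) ^ k = (L powr (1 / 4)) powr (real k)" using P(5) by (simp add: powr_realpow)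
        then show ?thesis by (simp add: powr_powr)
      qed
      also have "\<dots> \<le> (real M + 1) ^ k" using Mx(2) P(5) by (intro power_mono) auto
      finally show "L powr s \<le> (real M + 1) ^ k" .
    qed auto
    have D0: "D / (real M + 1) ^ k \<ge> 0" using D(1) by simp
    have bound: "clnorm (mesh N) F (\<lambda>a. lattice_restr (mesh N) (propagator t f) a - discrete_solution f N q t a) \<le> (6 * D + 2) / L powr s"
      if F: "finite F" "F \<subseteq> lattice (mesh N)" for F
    proof -
      have "clnorm (mesh N) F (\<lambda>a. lattice_restr (mesh N) (propagator t f) a - discrete_solution f N q t a)
         \<le> 2 * (S * E + 3 * (D / (real M + 1) ^ k))"
        by (rule discretization_error[OF f N qN Mq _ Ssum Eb E0 D0 D(2) F]) (use h1 in \<open>simp add: h_def\<close>)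
      also have "\<dots> \<le> 2 * (1 / L powr s + 3 * (D / L powr s))" using SE DL by (intro mult_left_mono add_mono) auto
      also have "\<dots> = (6 * D + 2) / L powr s" by (simp add: add_divide_distrib)
      finally show ?thesis .
    qed
    have hm: "mesh N > 0" using hb' by (simp add: h_def)
    show ?thesis using l2_lattice_of_bound[OF hm bound] unfolding absL by simp
  qed
  show "\<exists>C\<^sub>s. \<exists>h\<^sub>0>0. \<forall>N n_max t. even N \<longrightarrow> N > 0 \<longrightarrow> mesh N \<le> h\<^sub>0 \<longrightarrow>
    1 / 4 * \<delta> * \<bar>ln (mesh N)\<bar> \<le> real n_max \<longrightarrow> real n_max \<le> 1 / 3 * \<delta> * \<bar>ln (mesh N)\<bar> \<longrightarrow> t \<ge> 0 \<longrightarrow>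
    (\<lambda>a. lattice_restr (mesh N) (propagator t f) a - discrete_solution f N n_max t a) \<in> l2_lattice (mesh N) \<and>
    l2_lattice_norm (mesh N) (\<lambda>a. lattice_restr (mesh N) (propagator t f) a - discrete_solution f N n_max t a)
      \<le> 0 * mesh N powr (2 - \<delta>) + C\<^sub>s / \<bar>ln (mesh N)\<bar> powr s"
    using main b(1) by (intro exI[of _ "6 * D + 2"] exI[of _ "b / 2"]) auto
qed

end
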